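(* Let $(X,\triangleleft)$ be a finite abelian quandle with $r$ orbits. Then $$H_2(X,\triangleleft)\cong\mathbb{Z}^{r^2}\oplus\bigoplus_{i=1}^rT_i,$$ where the $T_i$ ($1\le i\le r$) are finite groups, each of which is a quotient of the parameter group $G'(X,\triangleleft)$.
   Context: A quandle is a non-empty set $X$ with a binary operation $\triangleleft$ such that for all $a,b,c$: $(a\triangleleft b)\triangleleft c=(a\triangleleft c)\triangleleft(b\triangleleft c)$; the right translation $-\triangleleft b$ is a bijection of $X$; $a\triangleleft a=a$. Its orbits are the orbits of $X$ under the group generated by all right translations. It is abelian if $(a\triangleleft b)\triangleleft c=(a\triangleleft c)\triangleleft b$ for all $a,b,c$. Rack homology. $H_\bullet(X,\triangleleft)$ is the homology of the chain complex $C_k=\mathbb{Z}X^k$ (free abelian group on $X^k$) with $d_k(a_1,\ldots,a_k)=\sum_{i=2}^k(-1)^{i-1}[(a_1,\ldots,\widehat{a_i},\ldots,a_k)-(a_1\triangleleft a_i,\ldots,a_{i-1}\triangleleft a_i,a_{i+1},\ldots,a_k)]$. In particular $d_2(a,b)=a\triangleleft b-a$, $d_3(a,b,c)=(a\triangleleft b,c)-(a,c)-(a\triangleleft c,b\triangleleft c)+(a,b)$, and $H_2=\ker d_2/\operatorname{im}d_3$. Parameters. Let $r\ge 1$. A parameter collection is a family of integers $M=(m_{i,j})_{1\le j\le i<r}$ with $m_{i,i}\ge 1$ and $0\le m_{j,i}<m_{i,i}$ for $i<j$ (empty if $r=1$). It defines the finite abelian group $G(M)$ generated by pairwise commuting $x_1,\ldots,x_{r-1}$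 subject to $x_1^{m_{i,1}}x_2^{m_{i,2}}\cdots x_i^{m_{i,i}}=1$ for $1\le i\le r-1$. Put $x_0:=1$. Given $r$ parameter collections, let $Q(M^{(1)},\ldots,M^{(r)})=G(M^{(1)})\sqcup\cdots\sqcup G(M^{(r)})$, with $x_k^{(i)}$ denoting the element $x_k$ of $G(M^{(i)})$, and $a\triangleleft b=a\,x_k^{(i)}$ for $a\in G(M^{(i)})$, $b\in G(M^{(i+k)})$, $0\le k<r$ ($i+k$ modulo $r$). This is an abelian quandle with orbits $G(M^{(i)})$. Every finite abelian quandle with ordered orbits $O_1,\ldots,O_r$ is isomorphic, by an isomorphism matching $O_i$ with $G(M^{(i)})$ for all $i$, to $Q(M^{(1)},\ldots,M^{(r)})$ for unique $M^{(1)},\ldots,M^{(r)}$, called its parameters. Orbits are assumed ordered. The parameter group of $(X,\triangleleft)$ is the quotient $G'(X,\triangleleft)=\prod_{i=1}^rG(M^{(i)})\big/\langle x^{(i)}_{j-i}x^{(j)}_{i-j},\ 1\le i<j\le r\rangle$, lower indices being taken modulo $r$ in $\{0,\dots,r-1\}$. *)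

theory Defs
  imports "HOL-Algebra.Group_Action" "HOL-Algebra.Free_Abelian_Groups"
begin

locale quandle =
  fixes Q :: "'a set" and tri :: "'a \<Rightarrow> 'a \<Rightarrow> 'a" (infixl \<open>\<triangleleft>\<close> 70)
  assumes nonempty: "Q \<noteq> {}"
    and self_distrib: "\<lbrakk>a \<in> Q; b \<in> Q; c \<in> Q\<rbrakk> \<Longrightarrow> (a \<triangleleft> b) \<triangleleft> c = (a \<triangleleft> c) \<triangleleft> (b \<triangleleft> c)"
    and bij_right_translation: "b \<in> Q \<Longrightarrow> bij_betw (\<lambda>a. a \<triangleleft> b) Q Q"
    and idem: "a \<in> Q \<Longrightarrow> a \<triangleleft> a = a"

locale abelian_quandle = quandle +
  assumes abelian: "\<lbrakk>a \<in> Q; b \<in> Q; c \<in> Q\<rbrakk> \<Longrightarrow> (a \<triangleleft> b) \<triangleleft> c = (a \<triangleleft> c) \<triangleleft> b"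

definition quandle_orbits :: "'a set \<Rightarrow> ('a \<Rightarrow> 'a \<Rightarrow> 'a) \<Rightarrow> 'a set set" where
  "quandle_orbits Q tri =
     orbits (subgroup_generated (BijGroup Q) ((\<lambda>b. restrict (\<lambda>a. tri a b) Q) ` Q)) Q (\<lambda>g. g)"


section \<open>Rack homology\<close>

definition rack_chain :: "'a set \<Rightarrow> nat \<Rightarrow> ('a list \<Rightarrow>\<^sub>0 int) monoid" where
  "rack_chain Q k = free_Abelian_group {xs. length xs = k \<and> set xs \<subseteq> Q}"

text \<open>The entry \<open>a\<^sub>i\<close> of a tuple \<open>xs = (a\<^sub>1, \<dots>, a\<^sub>k)\<close> is \<open>xs ! (i - 1)\<close>.\<close>

definition rack_boundary ::
    "('a \<Rightarrow> 'a \<Rightarrow> 'a) \<Rightarrow> nat \<Rightarrow> ('a list \<Rightarrow>\<^sub>0 int) \<Rightarrow> ('a list \<Rightarrow>\<^sub>0 int)" where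
  "rack_boundary tri k = frag_extend (\<lambda>xs. \<Sum>i = 2..k. frag_cmul ((-1) ^ (i - 1))
     (frag_of (take (i - 1) xs @ drop i xs) -
      frag_of (map (\<lambda>a. tri a (xs ! (i - 1))) (take (i - 1) xs) @ drop i xs)))"

text \<open>In degree \<open>0\<close> the truncated \<open>k - 1\<close> is harmless, since \<open>rack_boundary tri 0\<close> is zero.\<close>

definition rack_homology ::
    "nat \<Rightarrow> 'a set \<Rightarrow> ('a \<Rightarrow> 'a \<Rightarrow> 'a) \<Rightarrow> ('a list \<Rightarrow>\<^sub>0 int) set monoid" where
  "rack_homology k Q tri =
     (rack_chain Q k)
       \<lparr>carrier := kernel (rack_chain Q k) (rack_chain Q (k - 1)) (rack_boundary tri k)\<rparr>
     Mod (rack_boundary tri (Suc k) ` carrier (rack_chain Q (Suc k)))"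


section \<open>Parameters\<close>

text \<open>A family indexed by \<open>1 \<le> j \<le> i < r\<close> is represented by its extension by zero, so that
  distinct functions satisfying this predicate are distinct families.\<close>

definition param_collection :: "nat \<Rightarrow> (nat \<Rightarrow> nat \<Rightarrow> int) \<Rightarrow> bool" where
  "param_collection r m \<longleftrightarrow>
     (\<forall>i. 1 \<le> i \<and> i < r \<longrightarrow> m i i \<ge> 1) \<and>
     (\<forall>i j. 1 \<le> i \<and> i < j \<and> j < r \<longrightarrow> 0 \<le> m j i \<and> m j i < m i i) \<and>
     (\<forall>i j. \<not> (1 \<le> j \<and> j \<le> i \<and> i < r) \<longrightarrow> m i j = 0)"

text \<open>The group presented by pairwise commuting \<open>x\<^sub>1, \<dots>, x\<^bsub>r-1\<^esub>\<close> subject to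
  \<open>x\<^sub>1\<^bsup>m i 1\<^esup> \<dots> x\<^sub>i\<^bsup>m i i\<^esup> = 1\<close>. Commutation is built into the free abelian group,
  in which the generated subgroup is already normal.\<close>

definition param_relations :: "nat \<Rightarrow> (nat \<Rightarrow> nat \<Rightarrow> int) \<Rightarrow> (nat \<Rightarrow>\<^sub>0 int) set" where
  "param_relations r m = generate (free_Abelian_group {1..<r})
     ((\<lambda>i. \<Sum>j = 1..i. frag_cmul (m i j) (frag_of j)) ` {1..<r})"

definition param_grp :: "nat \<Rightarrow> (nat \<Rightarrow> nat \<Rightarrow> int) \<Rightarrow> (nat \<Rightarrow>\<^sub>0 int) set monoid" where
  "param_grp r m = free_Abelian_group {1..<r} Mod param_relations r m"

definition param_gen :: "nat \<Rightarrow> (nat \<Rightarrow> nat \<Rightarrow> int) \<Rightarrow> nat \<Rightarrow> (nat \<Rightarrow>\<^sub>0 int) set" where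
  "param_gen r m k = (if k = 0 then \<one>\<^bsub>param_grp r m\<^esub>
     else param_relations r m #>\<^bsub>free_Abelian_group {1..<r}\<^esub> frag_of k)"

text \<open>The representative of \<open>j - i\<close> modulo \<open>r\<close> in \<open>{0, \<dots>, r - 1}\<close>.\<close>

definition cyc_diff :: "nat \<Rightarrow> nat \<Rightarrow> nat \<Rightarrow> nat" where
  "cyc_diff r j i = nat ((int j - int i) mod int r)"

text \<open>The disjoint union of the groups given by \<open>M 1, \<dots>, M r\<close>, with
  \<open>a \<triangleleft> b = a x\<^sub>k\<close> for \<open>a\<close> in the \<open>i\<close>-th and \<open>b\<close> in the \<open>(i + k)\<close>-th summand; the first component
  of an element is the index in \<open>{1, \<dots>, r}\<close> of the summand it lies in.\<close>

definition param_quandle_carrier ::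
    "nat \<Rightarrow> (nat \<Rightarrow> nat \<Rightarrow> nat \<Rightarrow> int) \<Rightarrow> (nat \<times> (nat \<Rightarrow>\<^sub>0 int) set) set" where
  "param_quandle_carrier r M = (SIGMA i:{1..r}. carrier (param_grp r (M i)))"

definition param_quandle_op ::
    "nat \<Rightarrow> (nat \<Rightarrow> nat \<Rightarrow> nat \<Rightarrow> int) \<Rightarrow>
     nat \<times> (nat \<Rightarrow>\<^sub>0 int) set \<Rightarrow> nat \<times> (nat \<Rightarrow>\<^sub>0 int) set \<Rightarrow> nat \<times> (nat \<Rightarrow>\<^sub>0 int) set" where
  "param_quandle_op r M = (\<lambda>(i, a) (j, b).
     (i, a \<otimes>\<^bsub>param_grp r (M i)\<^esub> param_gen r (M i) (cyc_diff r j i)))"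

definition is_quandle_parameters ::
    "'a set \<Rightarrow> ('a \<Rightarrow> 'a \<Rightarrow> 'a) \<Rightarrow> nat \<Rightarrow> (nat \<Rightarrow> 'a set) \<Rightarrow>
     (nat \<Rightarrow> nat \<Rightarrow> nat \<Rightarrow> int) \<Rightarrow> bool" where
  "is_quandle_parameters Q tri r Orb M \<longleftrightarrow>
     M \<in> {1..r} \<rightarrow>\<^sub>E {m. param_collection r m} \<and>
     (\<exists>f. bij_betw f Q (param_quandle_carrier r M) \<and>
          (\<forall>a\<in>Q. \<forall>b\<in>Q. f (tri a b) = param_quandle_op r M (f a) (f b)) \<and>
          (\<forall>i\<in>{1..r}. f ` Orb i = {i} \<times> carrier (param_grp r (M i))))"

text \<open>For a finite abelian quandle with orbits \<open>Orb 1, \<dots>, Orb r\<close> such an \<open>M\<close> exists and is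
  unique.\<close>

definition quandle_parameters ::
    "'a set \<Rightarrow> ('a \<Rightarrow> 'a \<Rightarrow> 'a) \<Rightarrow> nat \<Rightarrow> (nat \<Rightarrow> 'a set) \<Rightarrow> nat \<Rightarrow> nat \<Rightarrow> nat \<Rightarrow> int" where
  "quandle_parameters Q tri r Orb = (THE M. is_quandle_parameters Q tri r Orb M)"


section \<open>The parameter group\<close>

definition parameter_product ::
    "nat \<Rightarrow> (nat \<Rightarrow> nat \<Rightarrow> nat \<Rightarrow> int) \<Rightarrow> (nat \<Rightarrow> (nat \<Rightarrow>\<^sub>0 int) set) monoid" where
  "parameter_product r M = product_group {1..r} (\<lambda>i. param_grp r (M i))"

text \<open>The element \<open>x\<^sup>i\<^bsub>j-i\<^esub> x\<^sup>j\<^bsub>i-j\<^esub>\<close> of the product, for \<open>i \<noteq> j\<close>.\<close>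

definition parameter_relator ::
    "nat \<Rightarrow> (nat \<Rightarrow> nat \<Rightarrow> nat \<Rightarrow> int) \<Rightarrow> nat \<Rightarrow> nat \<Rightarrow> nat \<Rightarrow> (nat \<Rightarrow>\<^sub>0 int) set" where
  "parameter_relator r M i j = (\<lambda>k\<in>{1..r}.
     if k = i then param_gen r (M i) (cyc_diff r j i)
     else if k = j then param_gen r (M j) (cyc_diff r i j)
     else \<one>\<^bsub>param_grp r (M k)\<^esub>)"

definition parameter_group ::
    "'a set \<Rightarrow> ('a \<Rightarrow> 'a \<Rightarrow> 'a) \<Rightarrow> nat \<Rightarrow> (nat \<Rightarrow> 'a set) \<Rightarrow>
     (nat \<Rightarrow> (nat \<Rightarrow>\<^sub>0 int) set) set monoid" where
  "parameter_group Q tri r Orb =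
     (let M = quandle_parameters Q tri r Orb in
      parameter_product r M Mod
        generate (parameter_product r M)
          {parameter_relator r M i j | i j. 1 \<le> i \<and> i < j \<and> j \<le> r})"

end

theory Submission
  imports Defs "HOL-Library.Multiset"
begin

text \<open>
  Right translations depend only on the orbit of the translating element, so each orbit is a torsor
  under a quotient of a free abelian group by a lattice. The Hermite normal form of that lattice is
  unique, which gives existence and uniqueness of the parameters.

  The complex in degrees up to three splits according to the orbit of the first entry. Fix such an
  orbit \<open>i\<close>. Modulo boundaries, \<open>[a, b \<triangleleft> c] - [a, b]\<close> depends only on the orbits \<open>j\<close> of
  \<open>b\<close> and \<open>k\<close> of \<open>c\<close>, and it is antisymmetric in \<open>j\<close> and \<open>k\<close>. Hence these classes define a homomorphism
  from the parameter group to homology; its image is the torsion part \<open>T\<^sub>i\<close>. Modulo this image the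
  pair \<open>[a, b]\<close> is an edge from \<open>a\<close> to \<open>a \<triangleleft> b\<close> labelled by the orbit of \<open>b\<close>, and the boundary
  relations let the labels of a path commute. A cycle is therefore determined by the numbers of its
  labels. These numbers form a lattice of finite index in \<open>\<int>\<^sup>r\<close>, which is free of rank \<open>r\<close>, so the
  extension splits.
\<close>

text \<open>The complex splits by the first entry because a \<triangleleft> b stays in the orbit of
  a. That second differences depend only on orbits is read off the boundary of (a, b, c): moving the
  first entry by c turns [a, b \<triangleleft> c] - [a, b] into an expression that changes sign when
  b and c are exchanged and that contains b and c as second entries only inside differences of first
  entries.

  Inverses are avoided: on finite orbits an inverse translation is a positive power, so words in
  labels, applied with \<open>fold\<close>, stand in for group elements, and an integer vector is a
  difference of two letter counts.

  The Hermite normal form is used twice: for the relation lattice of each orbit, and with r^2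
  generators for the lattice of label counts of all cycles. There its triangular rows are a basis
  that can be lifted to cycles. That lattice has finite index because repeating one label eventually
  returns to the starting point.\<close>

lemma keys_add_subset:
  "\<lbrakk>Poly_Mapping.keys x \<subseteq> S; Poly_Mapping.keys y \<subseteq> S\<rbrakk> \<Longrightarrow> Poly_Mapping.keys (x + y) \<subseteq> S"
  using keys_add[of x y] by blast

lemma keys_diff_subset:
  "\<lbrakk>Poly_Mapping.keys x \<subseteq> S; Poly_Mapping.keys y \<subseteq> S\<rbrakk> \<Longrightarrow> Poly_Mapping.keys (x - y) \<subseteq> S"
  for x y :: "'b \<Rightarrow>\<^sub>0 int"
  using keys_diff[of x y] by blast

lemma keys_cmul_subset: "Poly_Mapping.keys x \<subseteq> S \<Longrightarrow> Poly_Mapping.keys (frag_cmul k x) \<subseteq> S"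
  using keys_cmul[of k x] by blast

lemma keys_subsetI:
  "(\<And>k. k \<notin> S \<Longrightarrow> poly_mapping.lookup x k = 0) \<Longrightarrow> Poly_Mapping.keys x \<subseteq> S"
  by (metis in_keys_iff subsetI)

lemma lookup_outside:
  "\<lbrakk>Poly_Mapping.keys x \<subseteq> S; k \<notin> S\<rbrakk> \<Longrightarrow> poly_mapping.lookup x k = 0"
  by (meson not_in_keys_iff_lookup_eq_zero subsetD)

section \<open>Subgroups of free abelian groups in additive notation\<close>

lemma frag_subgroupI:
  assumes "\<And>x. x \<in> L \<Longrightarrow> Poly_Mapping.keys x \<subseteq> S" "0 \<in> L" "\<And>x y. \<lbrakk>x \<in> L; y \<in> L\<rbrakk> \<Longrightarrow> x - y \<in> L"
  shows "subgroup L (free_Abelian_group S)"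
proof -
  have neg: "- x \<in> L" if "x \<in> L" for x
    using assms(3)[OF assms(2) that] by simp
  have add: "x + y \<in> L" if "x \<in> L" "y \<in> L" for x y
    using assms(3)[OF that(1) neg[OF that(2)]] by simp
  show ?thesis
  proof
    show "L \<subseteq> carrier (free_Abelian_group S)" using assms(1) by auto
  next
    fix x assume "x \<in> L"
    then show "inv\<^bsub>free_Abelian_group S\<^esub> x \<in> L" using neg assms(1) by simp
  qed (use assms(2) add in auto)
qed

context
  fixes L :: "('b \<Rightarrow>\<^sub>0 int) set" and S
  assumes L: "subgroup L (free_Abelian_group S)"
begin

lemma frag_subgroup_keys: "x \<in> L \<Longrightarrow> Poly_Mapping.keys x \<subseteq> S"
  using subgroup.subset[OF L] by (metis carrier_free_Abelian_group_iff subsetD)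

lemma frag_subgroup_zero: "0 \<in> L"
  using subgroup.one_closed[OF L] by simp

lemma frag_subgroup_add: "\<lbrakk>x \<in> L; y \<in> L\<rbrakk> \<Longrightarrow> x + y \<in> L"
  using subgroup.m_closed[OF L] by simp

lemma frag_subgroup_minus: "x \<in> L \<Longrightarrow> - x \<in> L"
  using subgroup.m_inv_closed[OF L] frag_subgroup_keys by fastforce

lemma frag_subgroup_diff: "\<lbrakk>x \<in> L; y \<in> L\<rbrakk> \<Longrightarrow> x - y \<in> L"
  using frag_subgroup_add[OF _ frag_subgroup_minus] by fastforce

lemma frag_subgroup_cmul: "x \<in> L \<Longrightarrow> frag_cmul k x \<in> L"
  by (rule frag_closure_minus_cmul) (auto intro: frag_subgroup_zero frag_subgroup_diff)

lemma frag_subgroup_sum: "(\<And>i. i \<in> I \<Longrightarrow> f i \<in> L) \<Longrightarrow> sum f I \<in> L"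
  by (induction I rule: infinite_finite_induct) (auto intro: frag_subgroup_zero frag_subgroup_add)

lemma frag_subgroup_extend:
  assumes "Poly_Mapping.keys x \<subseteq> A" "\<And>a. a \<in> A \<Longrightarrow> f a \<in> L"
  shows "frag_extend f x \<in> L"
  using assms(1)
  by (induction x rule: frag_induction)
    (auto simp: frag_extend_diff intro: assms(2) frag_subgroup_zero frag_subgroup_diff)

end

section \<open>Hermite normal form\<close>

text \<open>The i-th defining relator of \<open>param_grp\<close>, read as a row of a lower
  triangular matrix, so that lattices given by such rows can be compared entry by entry.\<close>

definition hnf_row :: "(nat \<Rightarrow> nat \<Rightarrow> int) \<Rightarrow> nat \<Rightarrow> (nat \<Rightarrow>\<^sub>0 int)" where
  "hnf_row m i = (\<Sum>j = 1..i. frag_cmul (m i j) (frag_of j))"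

lemma lookup_hnf_row: "poly_mapping.lookup (hnf_row m i) j = (if 1 \<le> j \<and> j \<le> i then m i j else 0)"
proof -
  have "poly_mapping.lookup (hnf_row m i) j = (\<Sum>k = 1..i. if j = k then m i k else 0)"
    unfolding hnf_row_def lookup_sum by (rule sum.cong) auto
  then show ?thesis by simp
qed

lemma keys_hnf_row: "Poly_Mapping.keys (hnf_row m i) \<subseteq> {1..i}"
  by (rule keys_subsetI) (auto simp: lookup_hnf_row)

lemma hnf_row_in_carrier: "i \<in> {1..<r} \<Longrightarrow> Poly_Mapping.keys (hnf_row m i) \<subseteq> {1..<r}"
  using keys_hnf_row[of m i] by fastforce

lemma subgroup_param_relations: "subgroup (param_relations r m) (free_Abelian_group {1..<r})"
  unfolding param_relations_def
  by (rule group.generate_is_subgroup[OF group_free_Abelian_group])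
     (use hnf_row_in_carrier in \<open>auto simp: hnf_row_def\<close>)

lemma hnf_row_in_param_relations: "i \<in> {1..<r} \<Longrightarrow> hnf_row m i \<in> param_relations r m"
  unfolding param_relations_def by (rule generate.incl) (simp add: hnf_row_def)

text \<open>Integer combinations of the rows are already closed under differences, so they exhaust
  the generated subgroup. Each lattice vector thereby acquires a coefficient vector, on which the
  leading-term arguments operate.\<close>

lemma param_relations_eq_image:
  "param_relations r m = frag_extend (hnf_row m) ` {c. Poly_Mapping.keys c \<subseteq> {1..<r}}"
  (is "_ = ?I")
proof
  have keys: "Poly_Mapping.keys (frag_extend (hnf_row m) c) \<subseteq> {1..<r}" if "Poly_Mapping.keys c \<subseteq> {1..<r}" for c
    using keys_frag_extend[of "hnf_row m" c] hnf_row_in_carrier[of _ r m] that by blast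
  have "subgroup ?I (free_Abelian_group {1..<r})"
  proof (rule frag_subgroupI)
    show "0 \<in> ?I" by (rule image_eqI[of _ _ 0]) auto
    fix x y assume "x \<in> ?I" "y \<in> ?I"
    then show "x - y \<in> ?I"
      by clarify (metis (mono_tags) frag_extend_diff imageI keys_diff_subset mem_Collect_eq)
  qed (use keys in auto)
  moreover have "hnf_row m i \<in> ?I" if "i \<in> {1..<r}" for i
    by (rule image_eqI[of _ _ "frag_of i"]) (use that in auto)
  ultimately show "param_relations r m \<subseteq> ?I"
    unfolding param_relations_def hnf_row_def[symmetric]
    by (intro group.generate_subgroup_incl[OF group_free_Abelian_group]) auto
  show "?I \<subseteq> param_relations r m"
    using frag_subgroup_extend[OF subgroup_param_relations] hnf_row_in_param_relations by blast
qed

lemma lookup_frag_extend: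
  "poly_mapping.lookup (frag_extend f c) j =
    (\<Sum>i\<in>Poly_Mapping.keys c. poly_mapping.lookup c i * poly_mapping.lookup (f i) j)"
  by (simp add: frag_extend_def lookup_sum)

text \<open>Triangularity rules out cancellation: of the rows used by c only the one with the
  largest index k reaches column k, where it contributes a nonzero diagonal entry. The first
  conclusion is the linear independence of the rows.\<close>

lemma hnf_leading_coefficient:
  assumes c: "Poly_Mapping.keys c \<subseteq> {1..<r}" "c \<noteq> 0" and m: "\<And>i. \<lbrakk>1 \<le> i; i < r\<rbrakk> \<Longrightarrow> m i i \<ge> 1"
  shows "frag_extend (hnf_row m) c \<noteq> 0"
    "Max (Poly_Mapping.keys (frag_extend (hnf_row m) c)) = Max (Poly_Mapping.keys c)"
    "poly_mapping.lookup (frag_extend (hnf_row m) c) (Max (Poly_Mapping.keys c)) =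
       poly_mapping.lookup c (Max (Poly_Mapping.keys c)) * m (Max (Poly_Mapping.keys c)) (Max (Poly_Mapping.keys c))"
proof -
  define k where "k = Max (Poly_Mapping.keys c)"
  have kin: "k \<in> Poly_Mapping.keys c" and le: "\<And>j. j \<in> Poly_Mapping.keys c \<Longrightarrow> j \<le> k"
    unfolding k_def using c by auto
  have kr: "1 \<le> k" "k < r" using kin c by auto
  have "poly_mapping.lookup (frag_extend (hnf_row m) c) k =
      (\<Sum>i\<in>{k}. poly_mapping.lookup c i * poly_mapping.lookup (hnf_row m i) k)"
    unfolding lookup_frag_extend
    by (rule sum.mono_neutral_right) (use kin le in \<open>auto simp: lookup_hnf_row dest!: le\<close>)
  then have lk: "poly_mapping.lookup (frag_extend (hnf_row m) c) k = poly_mapping.lookup c k * m k k"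
    using kr by (simp add: lookup_hnf_row)
  then show "poly_mapping.lookup (frag_extend (hnf_row m) c) (Max (Poly_Mapping.keys c)) =
       poly_mapping.lookup c (Max (Poly_Mapping.keys c)) * m (Max (Poly_Mapping.keys c)) (Max (Poly_Mapping.keys c))"
    by (simp add: k_def)
  have "poly_mapping.lookup (frag_extend (hnf_row m) c) k \<noteq> 0"
    using lk kin m[OF kr] by (simp add: in_keys_iff)
  then have kin': "k \<in> Poly_Mapping.keys (frag_extend (hnf_row m) c)"
    by (simp add: in_keys_iff)
  then show "frag_extend (hnf_row m) c \<noteq> 0" by auto
  have "j \<le> k" if "j \<in> Poly_Mapping.keys (frag_extend (hnf_row m) c)" for j
  proof (rule ccontr)
    assume "\<not> j \<le> k"
    then have "poly_mapping.lookup (frag_extend (hnf_row m) c) j = 0"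
      unfolding lookup_frag_extend using le by (intro sum.neutral) (fastforce simp: lookup_hnf_row)
    with that show False by (simp add: in_keys_iff)
  qed
  with kin' show "Max (Poly_Mapping.keys (frag_extend (hnf_row m) c)) = Max (Poly_Mapping.keys c)"
    unfolding k_def[symmetric] by (intro Max_eqI) auto
qed

lemma param_relations_leading_dvd:
  assumes "v \<in> param_relations r m" "v \<noteq> 0" and m: "\<And>i. \<lbrakk>1 \<le> i; i < r\<rbrakk> \<Longrightarrow> m i i \<ge> 1"
  defines "k \<equiv> Max (Poly_Mapping.keys v)"
  shows "m k k dvd poly_mapping.lookup v k"
proof -
  obtain c where c: "Poly_Mapping.keys c \<subseteq> {1..<r}" "v = frag_extend (hnf_row m) c"
    using assms(1) unfolding param_relations_eq_image by auto
  with assms(2) have "c \<noteq> 0" by auto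
  from hnf_leading_coefficient[of c r m, OF c(1) this m] show ?thesis
    unfolding k_def c(2) by simp
qed

lemma param_collection_diag: "\<lbrakk>param_collection r m; 1 \<le> i; i < r\<rbrakk> \<Longrightarrow> m i i \<ge> 1"
  by (simp add: param_collection_def)

lemma param_collection_offdiag:
  "\<lbrakk>param_collection r m; 1 \<le> i; i < j; j < r\<rbrakk> \<Longrightarrow> 0 \<le> m j i \<and> m j i < m i i"
  by (simp add: param_collection_def)

lemma param_relations_diag_dvd:
  assumes "param_collection r m" "param_collection r m'"
    and "param_relations r m = param_relations r m'" "1 \<le> i" "i < r"
  shows "m' i i dvd m i i"
proof -
  have li: "poly_mapping.lookup (hnf_row m i) i = m i i"
    using assms by (simp add: lookup_hnf_row)
  then have "i \<in> Poly_Mapping.keys (hnf_row m i)"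
    using param_collection_diag[OF assms(1,4,5)] by (simp add: in_keys_iff)
  then have "Max (Poly_Mapping.keys (hnf_row m i)) = i"
    using keys_hnf_row[of m i] by (intro Max_eqI) auto
  moreover have "hnf_row m i \<in> param_relations r m'"
    using hnf_row_in_param_relations[of i r m] assms by simp
  moreover have "hnf_row m i \<noteq> 0" using \<open>i \<in> Poly_Mapping.keys (hnf_row m i)\<close> by auto
  ultimately show ?thesis
    using param_relations_leading_dvd[of "hnf_row m i" r m'] param_collection_diag[OF assms(2)] li by simp
qed

text \<open>Mutual divisibility forces equal positive diagonals. If two rows of index i differed,
  their difference would have its leading column k below i, with an entry divisible by
  \<open>m k k\<close>; but both entries there are residues in [0, \<open>m k k\<close>), so their
  difference is too small.\<close>

lemma param_collection_unique:
  assumes c: "param_collection r m" "param_collection r m'"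
    and eq: "param_relations r m = param_relations r m'"
  shows "m = m'"
proof -
  have diag: "m i i = m' i i" if "1 \<le> i" "i < r" for i
    using param_relations_diag_dvd[OF c eq that] param_relations_diag_dvd[OF c(2,1) eq[symmetric] that]
      param_collection_diag[OF c(1) that] param_collection_diag[OF c(2) that]
    by (simp add: zdvd_antisym_nonneg)
  have row: "hnf_row m i = hnf_row m' i" if i: "1 \<le> i" "i < r" for i
  proof (rule ccontr)
    define d where "d = hnf_row m i - hnf_row m' i"
    define k where "k = Max (Poly_Mapping.keys d)"
    assume "hnf_row m i \<noteq> hnf_row m' i"
    then have "d \<noteq> 0" by (simp add: d_def)
    moreover have "d \<in> param_relations r m"
      unfolding d_def
    proof (rule frag_subgroup_diff[OF subgroup_param_relations])
      show "hnf_row m i \<in> param_relations r m" "hnf_row m' i \<in> param_relations r m"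
        using hnf_row_in_param_relations[of i r m] hnf_row_in_param_relations[of i r m'] i
        unfolding eq by simp_all
    qed
    ultimately have dvd: "m k k dvd poly_mapping.lookup d k"
      unfolding k_def using param_relations_leading_dvd[of d r m] param_collection_diag[OF c(1)] by simp
    have "k \<in> Poly_Mapping.keys d" unfolding k_def using \<open>d \<noteq> 0\<close> by (intro Max_in) auto
    then have nz: "poly_mapping.lookup d k \<noteq> 0" by (simp add: in_keys_iff)
    have lk: "poly_mapping.lookup d k = (if 1 \<le> k \<and> k \<le> i then m i k - m' i k else 0)"
      by (simp add: d_def lookup_minus lookup_hnf_row)
    with nz have k: "1 \<le> k" "k \<le> i" by (auto split: if_splits)
    moreover have "k \<noteq> i" using nz lk diag[OF i] k by auto
    ultimately have "1 \<le> k" "k < i" by auto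
    then have "0 \<le> m i k" "m i k < m k k" "0 \<le> m' i k" "m' i k < m k k"
      using param_collection_offdiag[OF c(1), of k i] param_collection_offdiag[OF c(2), of k i] i diag[of k]
      by simp_all
    then have "\<bar>poly_mapping.lookup d k\<bar> < \<bar>m k k\<bar>" using lk k by auto
    with dvd_imp_le_int[OF nz dvd] show False by simp
  qed
  show ?thesis
  proof (intro ext)
    fix i j
    show "m i j = m' i j"
    proof (cases "1 \<le> j \<and> j \<le> i \<and> i < r")
      case True
      then have "poly_mapping.lookup (hnf_row m i) j = poly_mapping.lookup (hnf_row m' i) j"
        using row by simp
      with True show ?thesis by (simp add: lookup_hnf_row)
    next
      case False
      then show ?thesis using c unfolding param_collection_def by metis
    qed
  qed
qed

text \<open>The torsion hypothesis amounts to full rank: it supplies a vector supported in {1..i}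
  with positive entry in column i. One with the least such entry becomes row i, after its earlier
  entries are reduced modulo the diagonal entries of their columns.\<close>

lemma param_collection_exists:
  assumes L: "subgroup L (free_Abelian_group {1..<r})"
    and tors: "\<And>k. \<lbrakk>1 \<le> k; k < r\<rbrakk> \<Longrightarrow> \<exists>N>0. frag_cmul N (frag_of k) \<in> L"
  shows "\<exists>m. param_collection r m \<and> param_relations r m = L"
proof -
  define leading where "leading = (\<lambda>i u. u \<in> L \<and> Poly_Mapping.keys u \<subseteq> {1..i} \<and> poly_mapping.lookup u i \<ge> 1 \<and>
      (\<forall>v\<in>L. Poly_Mapping.keys v \<subseteq> {1..i} \<longrightarrow> poly_mapping.lookup u i dvd poly_mapping.lookup v i))"
  have "\<exists>u. leading i u"
    if i: "1 \<le> i" "i < r" for i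
  proof -
    define P where "P = (\<lambda>n. n > 0 \<and> (\<exists>v\<in>L. Poly_Mapping.keys v \<subseteq> {1..i} \<and> poly_mapping.lookup v i = int n))"
    obtain N where N: "N > 0" "frag_cmul N (frag_of i) \<in> L" using tors[OF i] by auto
    have "P (nat N)"
      unfolding P_def using N i by (auto intro!: bexI[OF _ N(2)] simp: keys_subsetI)
    then have Pl: "P (LEAST n. P n)" by (rule LeastI)
    define n where "n = (LEAST n. P n)"
    obtain u where u: "u \<in> L" "Poly_Mapping.keys u \<subseteq> {1..i}" "poly_mapping.lookup u i = int n" "n > 0"
      using Pl unfolding n_def[symmetric] by (auto simp: P_def)
    have "int n dvd poly_mapping.lookup v i" if v: "v \<in> L" "Poly_Mapping.keys v \<subseteq> {1..i}" for v
    proof (rule ccontr)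
      assume nd: "\<not> int n dvd poly_mapping.lookup v i"
      \<comment> \<open>Division with remainder inside the lattice: the entry of w in column i would
        be positive and below the minimum n.\<close>
      define w where "w = v - frag_cmul (poly_mapping.lookup v i div int n) u"
      have w: "w \<in> L" "Poly_Mapping.keys w \<subseteq> {1..i}"
        unfolding w_def using u v
        by (simp_all add: frag_subgroup_diff[OF L] frag_subgroup_cmul[OF L] keys_diff_subset keys_cmul_subset)
      have pos: "0 < poly_mapping.lookup v i mod int n"
        using nd u(4) by (metis dvd_eq_mod_eq_0 of_nat_0_less_iff order_less_le pos_mod_sign)
      have "poly_mapping.lookup w i = poly_mapping.lookup v i mod int n"
        by (simp add: w_def lookup_minus u minus_div_mult_eq_mod)
      then have "nat (poly_mapping.lookup v i mod int n) > 0 \<and>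
          poly_mapping.lookup w i = int (nat (poly_mapping.lookup v i mod int n))"
        using pos by simp
      then have "P (nat (poly_mapping.lookup v i mod int n))"
        unfolding P_def using w by blast
      then have "n \<le> nat (poly_mapping.lookup v i mod int n)"
        unfolding n_def by (rule Least_le)
      moreover have "poly_mapping.lookup v i mod int n < int n" using u(4) by simp
      ultimately show False using u(4) by (simp add: nat_le_iff le_nat_iff)
    qed
    with u show ?thesis unfolding leading_def by (intro exI[of _ u]) auto
  qed
  then obtain u where "\<And>i. \<lbrakk>1 \<le> i; i < r\<rbrakk> \<Longrightarrow> leading i (u i)"
    by metis
  moreover define d where "d = (\<lambda>i. poly_mapping.lookup (u i) i)"
  ultimately have u: "\<And>i. \<lbrakk>1 \<le> i; i < r\<rbrakk> \<Longrightarrow> u i \<in> L"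
      "\<And>i. \<lbrakk>1 \<le> i; i < r\<rbrakk> \<Longrightarrow> Poly_Mapping.keys (u i) \<subseteq> {1..i}"
      "\<And>i. \<lbrakk>1 \<le> i; i < r\<rbrakk> \<Longrightarrow> poly_mapping.lookup (u i) i = d i"
      "\<And>i. \<lbrakk>1 \<le> i; i < r\<rbrakk> \<Longrightarrow> d i \<ge> (1::int)"
      "\<And>i v. \<lbrakk>1 \<le> i; i < r; v \<in> L; Poly_Mapping.keys v \<subseteq> {1..i}\<rbrakk> \<Longrightarrow> d i dvd poly_mapping.lookup v i"
    unfolding leading_def by blast+
  \<comment> \<open>Columns are treated from the right: a multiple of \<open>u n\<close> settles
    column n and otherwise touches only columns to its left, so later corrections do not disturb
    it.\<close>
  have reduce: "\<exists>w\<in>L. Poly_Mapping.keys (w - v) \<subseteq> {1..<n} \<and>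
      (\<forall>j. 1 \<le> j \<and> j < n \<longrightarrow> 0 \<le> poly_mapping.lookup w j \<and> poly_mapping.lookup w j < d j)"
    if "v \<in> L" "n \<le> r" for v n
    using that
  proof (induction n arbitrary: v)
    case 0
    then show ?case by (intro bexI[of _ v]) auto
  next
    case (Suc n)
    show ?case
    proof (cases "n = 0")
      case True
      then show ?thesis using Suc.prems by (intro bexI[of _ v]) auto
    next
      case False
      then have n: "1 \<le> n" "n < r" using Suc.prems by auto
      define v' where "v' = v - frag_cmul (poly_mapping.lookup v n div d n) (u n)"
      have "v' \<in> L"
        unfolding v'_def using Suc.prems u(1)[OF n]
        by (intro frag_subgroup_diff[OF L] frag_subgroup_cmul[OF L])
      then obtain w where w: "w \<in> L" "Poly_Mapping.keys (w - v') \<subseteq> {1..<n}"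
        "\<And>j. \<lbrakk>1 \<le> j; j < n\<rbrakk> \<Longrightarrow> 0 \<le> poly_mapping.lookup w j \<and> poly_mapping.lookup w j < d j"
        using Suc.IH[of v'] n by auto
      have "w - v = (w - v') - frag_cmul (poly_mapping.lookup v n div d n) (u n)"
        by (simp add: v'_def)
      moreover have "Poly_Mapping.keys ((w - v') - frag_cmul (poly_mapping.lookup v n div d n) (u n)) \<subseteq> {1..<Suc n}"
        using w(2) u(2)[OF n]
        by (intro keys_diff_subset[of "w - v'"] keys_cmul_subset) (auto intro: order_trans)
      ultimately have 1: "Poly_Mapping.keys (w - v) \<subseteq> {1..<Suc n}" by (simp only:)
      have "poly_mapping.lookup (w - v') n = 0" using w(2) by (intro lookup_outside) auto
      then have "poly_mapping.lookup w n = poly_mapping.lookup v n mod d n"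
        by (simp add: lookup_minus v'_def u(3)[OF n] minus_div_mult_eq_mod)
      then have "0 \<le> poly_mapping.lookup w n \<and> poly_mapping.lookup w n < d n"
        using u(4)[OF n] by simp
      with w(3) have "0 \<le> poly_mapping.lookup w j \<and> poly_mapping.lookup w j < d j"
        if "1 \<le> j" "j < Suc n" for j
        using that by (cases "j = n") auto
      with 1 w(1) show ?thesis by blast
    qed
  qed
  define reduced where "reduced = (\<lambda>i w. w \<in> L \<and> Poly_Mapping.keys w \<subseteq> {1..i} \<and> poly_mapping.lookup w i = d i \<and>
      (\<forall>j. 1 \<le> j \<and> j < i \<longrightarrow> 0 \<le> poly_mapping.lookup w j \<and> poly_mapping.lookup w j < d j))"
  have "\<exists>w. reduced i w"
    if i: "1 \<le> i" "i < r" for i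
  proof -
    obtain w where w: "w \<in> L" "Poly_Mapping.keys (w - u i) \<subseteq> {1..<i}"
      "\<forall>j. 1 \<le> j \<and> j < i \<longrightarrow> 0 \<le> poly_mapping.lookup w j \<and> poly_mapping.lookup w j < d j"
      using reduce[OF u(1)[OF i], of i] i by auto
    have "poly_mapping.lookup (w - u i) i = 0" using w(2) by (intro lookup_outside) auto
    then have "poly_mapping.lookup w i = d i" by (simp add: lookup_minus u(3)[OF i])
    moreover have "Poly_Mapping.keys ((w - u i) + u i) \<subseteq> {1..i}"
      using w(2) u(2)[OF i] by (intro keys_add_subset[of "w - u i"]) (auto intro: order_trans)
    ultimately show ?thesis using w unfolding reduced_def by auto
  qed
  then obtain w where "\<And>i. \<lbrakk>1 \<le> i; i < r\<rbrakk> \<Longrightarrow> reduced i (w i)"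
    by metis
  then have w: "\<And>i. \<lbrakk>1 \<le> i; i < r\<rbrakk> \<Longrightarrow> w i \<in> L"
      "\<And>i. \<lbrakk>1 \<le> i; i < r\<rbrakk> \<Longrightarrow> Poly_Mapping.keys (w i) \<subseteq> {1..i}"
      "\<And>i. \<lbrakk>1 \<le> i; i < r\<rbrakk> \<Longrightarrow> poly_mapping.lookup (w i) i = d i"
      "\<And>i j. \<lbrakk>1 \<le> i; i < r; 1 \<le> j; j < i\<rbrakk> \<Longrightarrow> 0 \<le> poly_mapping.lookup (w i) j \<and> poly_mapping.lookup (w i) j < d j"
    unfolding reduced_def by blast+
  define m where "m = (\<lambda>i j. if 1 \<le> j \<and> j \<le> i \<and> i < r then poly_mapping.lookup (w i) j else 0)"
  have row: "hnf_row m i = w i" if "1 \<le> i" "i < r" for i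
    by (rule poly_mapping_eqI)
      (use lookup_outside[OF w(2)[OF that]] that in \<open>simp add: lookup_hnf_row m_def\<close>)
  have "param_collection r m"
    unfolding param_collection_def m_def using w(3,4) u(4) by auto
  \<comment> \<open>Elimination from the last column: its entry is a multiple of \<open>d n\<close>,
    so subtracting a multiple of row n shortens the support.\<close>
  moreover have "v \<in> param_relations r m" if "v \<in> L" "Poly_Mapping.keys v \<subseteq> {1..<n}" "n \<le> r" for v n
    using that
  proof (induction n arbitrary: v)
    case 0
    then show ?case using frag_subgroup_zero[OF subgroup_param_relations] by auto
  next
    case (Suc n)
    show ?case
    proof (cases "n = 0")
      case True
      then show ?thesis using Suc.prems frag_subgroup_zero[OF subgroup_param_relations] by auto
    next
      case False
      then have n: "1 \<le> n" "n < r" using Suc.prems by auto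
      have vn: "Poly_Mapping.keys v \<subseteq> {1..n}" using Suc.prems(2) by auto
      define q where "q = poly_mapping.lookup v n div d n"
      have q: "poly_mapping.lookup v n = q * d n"
        unfolding q_def using u(5)[OF n Suc.prems(1) vn] by simp
      define v' where "v' = v - frag_cmul q (w n)"
      have "v' \<in> L"
        unfolding v'_def using Suc.prems w(1)[OF n]
        by (intro frag_subgroup_diff[OF L] frag_subgroup_cmul[OF L])
      moreover have "Poly_Mapping.keys v' \<subseteq> {1..<n}"
      proof (rule keys_subsetI)
        fix k assume k: "k \<notin> {1..<n}"
        show "poly_mapping.lookup v' k = 0"
        proof (cases "k = n")
          case True
          then show ?thesis by (simp add: v'_def lookup_minus w(3)[OF n] q)
        next
          case False
          with k have "k \<notin> {1..n}" by auto
          then show ?thesis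
            using lookup_outside[OF vn] lookup_outside[OF w(2)[OF n]] by (simp add: v'_def lookup_minus)
        qed
      qed
      ultimately have "v' \<in> param_relations r m" using Suc.IH n by simp
      moreover have "w n \<in> param_relations r m"
        using hnf_row_in_param_relations[of n r m] row[OF n] n by simp
      ultimately have "v' + frag_cmul q (w n) \<in> param_relations r m"
        by (intro frag_subgroup_add[OF subgroup_param_relations] frag_subgroup_cmul[OF subgroup_param_relations])
      then show ?thesis by (simp add: v'_def)
    qed
  qed
  then have "L \<subseteq> param_relations r m"
    using frag_subgroup_keys[OF L] by blast
  moreover have "param_relations r m \<subseteq> L"
    unfolding param_relations_eq_image
    using frag_subgroup_extend[OF L, of _ "{1..<r}" "hnf_row m"] row w(1) by auto
  ultimately show ?thesis by blast
qed

section \<open>Transitive actions of commuting permutations\<close>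

text \<open>The image of a word in the free abelian group. Words have no inverse letters and can
  therefore be applied by \<open>fold\<close>.\<close>

definition letter_count :: "'k list \<Rightarrow> 'k \<Rightarrow>\<^sub>0 int" where
  "letter_count w = sum_list (map frag_of w)"

lemma letter_count_simps [simp]:
  "letter_count [] = 0" "letter_count (k # w) = frag_of k + letter_count w"
  "letter_count (w @ v) = letter_count w + letter_count v"
  by (simp_all add: letter_count_def)

lemma lookup_letter_count: "poly_mapping.lookup (letter_count w) k = int (count (mset w) k)"
  by (induction w) (auto simp: lookup_add)

lemma letter_count_eq_iff: "letter_count w = letter_count v \<longleftrightarrow> mset w = mset v"
  by (auto simp: poly_mapping_eq_iff fun_eq_iff multiset_eq_iff lookup_letter_count)

lemma keys_letter_count: "Poly_Mapping.keys (letter_count w) = set w"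
  by (auto simp: in_keys_iff lookup_letter_count count_eq_zero_iff)

lemma letter_count_concat_replicate:
  "letter_count (concat (replicate n w)) = frag_cmul (int n) (letter_count w)"
  by (induction n) (auto simp: frag_cmul_distrib)

lemma frag_eq_letter_count_diff:
  assumes "Poly_Mapping.keys x \<subseteq> I"
  shows "\<exists>w v. set w \<subseteq> I \<and> set v \<subseteq> I \<and> x = letter_count w - letter_count v"
  using assms
proof (induction x rule: frag_induction)
  case zero
  show ?case by (rule exI[of _ "[]"], rule exI[of _ "[]"]) simp
next
  case (one k)
  then show ?case by (intro exI[of _ "[k]"] exI[of _ "[]"]) simp
next
  case (diff a b)
  then obtain w v w' v' where "set w \<subseteq> I" "set v \<subseteq> I" "a = letter_count w - letter_count v"
    "set w' \<subseteq> I" "set v' \<subseteq> I" "b = letter_count w' - letter_count v'" by auto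
  then show ?case by (intro exI[of _ "w @ v'"] exI[of _ "v @ w'"]) simp
qed

lemma fold_concat_replicate: "fold f (concat (replicate n w)) = (fold f w ^^ n)"
proof (induction n)
  case (Suc n)
  then show ?case by (simp only: replicate_Suc concat.simps fold_append funpow_Suc_right o_apply)
qed simp

text \<open>Pigeonhole gives two equal iterates, and injectivity of the shorter one cancels the
  common start. This is how finiteness replaces inverses by positive powers.\<close>

lemma funpow_returns:
  assumes "finite A" "inj g" "\<And>x. x \<in> A \<Longrightarrow> g x \<in> A" "p \<in> A"
  shows "\<exists>N>0. (g ^^ N) p = p"
proof -
  have "(g ^^ n) p \<in> A" for n by (induction n) (use assms in auto)
  then have "\<not> inj (\<lambda>n. (g ^^ n) p)"
    using assms(1) by (meson finite_imageD finite_subset image_subsetI infinite_UNIV_nat)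
  then obtain m n where "m < n" and eq: "(g ^^ m) p = (g ^^ n) p"
    unfolding inj_on_def by (metis linorder_neqE_nat)
  then have "(g ^^ m) p = (g ^^ m) ((g ^^ (n - m)) p)"
    by (metis add_diff_inverse_nat funpow_add less_or_eq_imp_le linorder_not_le o_apply)
  moreover have "inj (g ^^ m)" using assms(2) by (rule inj_fn)
  ultimately have "(g ^^ (n - m)) p = p" by (metis injD)
  then show ?thesis using \<open>m < n\<close> by (intro exI[of _ "n - m"]) simp
qed

locale commuting_injections =
  fixes I :: "'k set" and t :: "'k \<Rightarrow> 'a \<Rightarrow> 'a"
  assumes commute: "\<lbrakk>k \<in> I; l \<in> I\<rbrakk> \<Longrightarrow> t k \<circ> t l = t l \<circ> t k"
    and inj: "k \<in> I \<Longrightarrow> inj (t k)"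
begin

lemma fold_mset_cong: "\<lbrakk>set w \<subseteq> I; mset w = mset v\<rbrakk> \<Longrightarrow> fold t w = fold t v"
  by (rule fold_multiset_equiv) (auto intro: commute)

lemma fold_append_commute: "\<lbrakk>set w \<subseteq> I; set v \<subseteq> I\<rbrakk> \<Longrightarrow> fold t w (fold t v a) = fold t v (fold t w a)"
  using fold_mset_cong[of "w @ v" "v @ w"] by (simp add: fun_eq_iff)

lemma inj_fold: "set w \<subseteq> I \<Longrightarrow> inj (fold t w)"
proof (induction w)
  case (Cons k w)
  then have "inj (fold t w \<circ> t k)" by (intro inj_compose inj) auto
  then show ?case by (simp add: comp_def)
qed simp

text \<open>The equation says that the formal quotient of w by v carries a to b. Cross-multiplying
  makes \<open>w @ v'\<close> and \<open>w' @ v\<close> permutations of each other, and injectivity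
  cancels the extra words.\<close>

lemma fold_eq_iff_of_letter_count_diff:
  assumes "set w \<subseteq> I" "set v \<subseteq> I" "set w' \<subseteq> I" "set v' \<subseteq> I"
    and eq: "letter_count w - letter_count v = letter_count w' - letter_count v'"
  shows "fold t w a = fold t v b \<longleftrightarrow> fold t w' a = fold t v' b"
proof -
  have "letter_count (w @ v') = letter_count (w' @ v)"
    using eq unfolding diff_eq_eq by (simp add: algebra_simps)
  then have ww: "fold t (w @ v') = fold t (w' @ v)"
    using assms(1,4) unfolding letter_count_eq_iff by (intro fold_mset_cong) auto
  have "fold t w a = fold t v b \<longleftrightarrow> fold t v' (fold t w a) = fold t v' (fold t v b)"
    using inj_eq[OF inj_fold[OF assms(4)]] by simp
  also have "\<dots> \<longleftrightarrow> fold t v (fold t w' a) = fold t v (fold t v' b)"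
    using ww fold_append_commute[OF assms(4,2), of b] by (simp add: fun_eq_iff)
  also have "\<dots> \<longleftrightarrow> fold t w' a = fold t v' b"
    using inj_eq[OF inj_fold[OF assms(2)]] by simp
  finally show ?thesis .
qed

end

section \<open>Cosets in quotients of a free abelian group\<close>

lemma free_Abelian_group_rcoset_eq_iff:
  assumes "subgroup L (free_Abelian_group S)" "Poly_Mapping.keys x \<subseteq> S" "Poly_Mapping.keys y \<subseteq> S"
  shows "L #>\<^bsub>free_Abelian_group S\<^esub> x = L #>\<^bsub>free_Abelian_group S\<^esub> y \<longleftrightarrow> x - y \<in> L"
proof -
  interpret comm_group "free_Abelian_group S" by (rule abelian_free_Abelian_group)
  have "L #>\<^bsub>free_Abelian_group S\<^esub> x = L #>\<^bsub>free_Abelian_group S\<^esub> y \<longleftrightarrow>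
      x \<in> L #>\<^bsub>free_Abelian_group S\<^esub> y"
    using assms by (metis carrier_free_Abelian_group_iff rcos_self repr_independence)
  also have "\<dots> \<longleftrightarrow> x - y \<in> L"
    by (auto simp: r_coset_def intro!: bexI[of _ "x - y"])
  finally show ?thesis .
qed

lemma free_Abelian_group_rcoset_mult:
  assumes "subgroup L (free_Abelian_group S)" "Poly_Mapping.keys x \<subseteq> S" "Poly_Mapping.keys y \<subseteq> S"
  shows "(L #>\<^bsub>free_Abelian_group S\<^esub> x) \<otimes>\<^bsub>free_Abelian_group S Mod L\<^esub> (L #>\<^bsub>free_Abelian_group S\<^esub> y)
    = L #>\<^bsub>free_Abelian_group S\<^esub> (x + y)"
proof -
  interpret comm_group "free_Abelian_group S" by (rule abelian_free_Abelian_group)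
  interpret normal L "free_Abelian_group S" using assms(1) by (rule subgroup_imp_normal)
  show ?thesis using rcos_sum[of x y] assms by simp
qed

lemma carrier_free_Abelian_group_Mod:
  "carrier (free_Abelian_group S Mod L) =
    (\<lambda>x. L #>\<^bsub>free_Abelian_group S\<^esub> x) ` {x. Poly_Mapping.keys x \<subseteq> S}"
  by (auto simp: carrier_FactGroup)

context commuting_injections
begin

text \<open>The stabilizer of p in the free abelian group on I, phrased without inverses: w - v
  fixes p when w and v send p to the same point.\<close>

definition stabilizer_lattice :: "'a \<Rightarrow> ('k \<Rightarrow>\<^sub>0 int) set" where
  "stabilizer_lattice p = {letter_count w - letter_count v | w v.
     set w \<subseteq> I \<and> set v \<subseteq> I \<and> fold t w p = fold t v p}"

lemma letter_count_diff_in_stabilizer_lattice_iff: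
  assumes "set w \<subseteq> I" "set v \<subseteq> I"
  shows "letter_count w - letter_count v \<in> stabilizer_lattice p \<longleftrightarrow> fold t w p = fold t v p"
proof
  assume "letter_count w - letter_count v \<in> stabilizer_lattice p"
  then obtain w' v' where *: "set w' \<subseteq> I" "set v' \<subseteq> I" "fold t w' p = fold t v' p"
    "letter_count w - letter_count v = letter_count w' - letter_count v'"
    unfolding stabilizer_lattice_def by auto
  then show "fold t w p = fold t v p"
    using fold_eq_iff_of_letter_count_diff[OF assms *(1,2,4)] by blast
next
  assume "fold t w p = fold t v p"
  with assms show "letter_count w - letter_count v \<in> stabilizer_lattice p"
    unfolding stabilizer_lattice_def by blast
qed

lemma subgroup_stabilizer_lattice: "subgroup (stabilizer_lattice p) (free_Abelian_group I)"
proof (rule frag_subgroupI)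
  fix x assume "x \<in> stabilizer_lattice p"
  then show "Poly_Mapping.keys x \<subseteq> I"
    by (auto simp: stabilizer_lattice_def keys_letter_count dest!: subsetD[OF keys_diff])
next
  show "0 \<in> stabilizer_lattice p"
    using letter_count_diff_in_stabilizer_lattice_iff[of "[]" "[]"] by simp
next
  fix x y assume "x \<in> stabilizer_lattice p" "y \<in> stabilizer_lattice p"
  then obtain w v w' v' where *: "set w \<subseteq> I" "set v \<subseteq> I" "x = letter_count w - letter_count v" "fold t w p = fold t v p"
    "set w' \<subseteq> I" "set v' \<subseteq> I" "y = letter_count w' - letter_count v'" "fold t w' p = fold t v' p"
    by (auto simp: stabilizer_lattice_def)
  then have "fold t (w @ v') p = fold t (v @ w') p"
  proof -
    have "fold t v' (fold t w p) = fold t v (fold t v' p)"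
      unfolding *(4) by (rule fold_append_commute[OF *(6,2)])
    also have "\<dots> = fold t w' (fold t v p)"
      unfolding *(8)[symmetric] by (rule fold_append_commute[OF *(2,5)])
    finally show ?thesis by simp
  qed
  then have "letter_count (w @ v') - letter_count (v @ w') \<in> stabilizer_lattice p"
    using letter_count_diff_in_stabilizer_lattice_iff[of "w @ v'" "v @ w'"] * by simp
  moreover have "x - y = letter_count (w @ v') - letter_count (v @ w')" using * by simp
  ultimately show "x - y \<in> stabilizer_lattice p" by simp
qed

lemma fold_in_orbit: "\<lbrakk>\<And>k x. \<lbrakk>k \<in> I; x \<in> A\<rbrakk> \<Longrightarrow> t k x \<in> A; set w \<subseteq> I; x \<in> A\<rbrakk> \<Longrightarrow> fold t w x \<in> A"
  by (induction w arbitrary: x) auto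

lemma stabilizer_lattice_torsion:
  assumes "finite A" "\<And>k x. \<lbrakk>k \<in> I; x \<in> A\<rbrakk> \<Longrightarrow> t k x \<in> A" "p \<in> A" "set w \<subseteq> I"
  shows "\<exists>N>0. frag_cmul (int N) (letter_count w) \<in> stabilizer_lattice p"
proof -
  have "fold t w x \<in> A" if "x \<in> A" for x
    by (rule fold_in_orbit) (use assms that in auto)
  then obtain N where N: "N > 0" "(fold t w ^^ N) p = p"
    using funpow_returns[of A "fold t w" p] assms(1,3) inj_fold[OF assms(4)] by auto
  have "letter_count (concat (replicate N w)) - letter_count [] \<in> stabilizer_lattice p"
  proof (rule letter_count_diff_in_stabilizer_lattice_iff[THEN iffD2])
    show "set (concat (replicate N w)) \<subseteq> I" using assms(4) by auto
    show "fold t (concat (replicate N w)) p = fold t [] p"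
      unfolding fold_concat_replicate N(2) by simp
  qed simp
  then show ?thesis using N(1) by (intro exI[of _ N]) (simp add: letter_count_concat_replicate)
qed

text \<open>Orbit and stabilizer: a point goes to the coset of the count of any word leading to it
  from p, and appending a letter adds its generator.\<close>

proposition transitive_action_coset_model:
  assumes "finite A" and closed: "\<And>k x. \<lbrakk>k \<in> I; x \<in> A\<rbrakk> \<Longrightarrow> t k x \<in> A" and "p \<in> A"
    and trans: "\<And>x. x \<in> A \<Longrightarrow> \<exists>w. set w \<subseteq> I \<and> fold t w p = x"
  defines "F \<equiv> free_Abelian_group I" and "L \<equiv> stabilizer_lattice p"
  shows "\<exists>f. bij_betw f A (carrier (F Mod L)) \<and>
    (\<forall>x\<in>A. \<forall>k\<in>I. f (t k x) = f x \<otimes>\<^bsub>F Mod L\<^esub> (L #>\<^bsub>F\<^esub> frag_of k))"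
proof -
  have L: "subgroup L (free_Abelian_group I)" unfolding L_def by (rule subgroup_stabilizer_lattice)
  define word where "word = (\<lambda>x. SOME w. set w \<subseteq> I \<and> fold t w p = x)"
  have word: "set (word x) \<subseteq> I" "fold t (word x) p = x" if "x \<in> A" for x
    using someI_ex[OF trans[OF that]] unfolding word_def by simp_all
  define f where "f = (\<lambda>x. L #>\<^bsub>F\<^esub> letter_count (word x))"
  have cos: "L #>\<^bsub>F\<^esub> letter_count w = L #>\<^bsub>F\<^esub> letter_count v \<longleftrightarrow> fold t w p = fold t v p"
    if "set w \<subseteq> I" "set v \<subseteq> I" for w v
    unfolding F_def using that L
    by (subst free_Abelian_group_rcoset_eq_iff)
      (auto simp: keys_letter_count letter_count_diff_in_stabilizer_lattice_iff L_def)
  have f: "f (fold t w p) = L #>\<^bsub>F\<^esub> letter_count w" if "set w \<subseteq> I" for w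
  proof -
    have "fold t w p \<in> A" by (rule fold_in_orbit) (use closed that assms(3) in auto)
    then show ?thesis unfolding f_def using that word by (subst cos) auto
  qed
  have "f (t k x) = f x \<otimes>\<^bsub>F Mod L\<^esub> (L #>\<^bsub>F\<^esub> frag_of k)" if "x \<in> A" "k \<in> I" for x k
  proof -
    have "f (t k x) = L #>\<^bsub>F\<^esub> letter_count (word x @ [k])"
      using f[of "word x @ [k]"] word that by simp
    also have "\<dots> = (L #>\<^bsub>F\<^esub> letter_count (word x)) \<otimes>\<^bsub>F Mod L\<^esub> (L #>\<^bsub>F\<^esub> frag_of k)"
      unfolding F_def using word that
      by (subst free_Abelian_group_rcoset_mult[OF L]) (auto simp: keys_letter_count)
    finally show ?thesis by (simp add: f_def)
  qed
  moreover have "bij_betw f A (carrier (F Mod L))"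
  proof (rule bij_betw_imageI)
    show "inj_on f A"
    proof (rule inj_onI)
      fix x y assume "x \<in> A" "y \<in> A" "f x = f y"
      then show "x = y" using cos[of "word x" "word y"] word by (simp add: f_def)
    qed
    \<comment> \<open>For surjectivity every coset must contain the count of a genuine word. Modulo
      L the negative of the count of v equals N - 1 times that count, because N times it lies in
      L.\<close>
    have pos: "\<exists>u. set u \<subseteq> I \<and> x - letter_count u \<in> L" if kx: "Poly_Mapping.keys x \<subseteq> I" for x
    proof -
      obtain w v where wv: "set w \<subseteq> I" "set v \<subseteq> I" "x = letter_count w - letter_count v"
        using frag_eq_letter_count_diff[OF kx] by blast
      obtain N where N: "N > 0" "frag_cmul (int N) (letter_count v) \<in> L"
        using stabilizer_lattice_torsion[OF assms(1) closed assms(3) wv(2)] unfolding L_def by blast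
      have "frag_cmul (int N) (letter_count v) =
          frag_cmul (int (N - 1)) (letter_count v) + letter_count v"
        using N(1) frag_cmul_distrib[of "int (N - 1)" 1 "letter_count v"] by (simp add: of_nat_diff)
      then have "x - letter_count (w @ concat (replicate (N - 1) v)) = - frag_cmul (int N) (letter_count v)"
        by (simp add: wv(3) letter_count_concat_replicate algebra_simps del: minus_frag_cmul)
      then have "x - letter_count (w @ concat (replicate (N - 1) v)) \<in> L"
        using frag_subgroup_minus[OF L N(2)] by simp
      then show ?thesis using wv by (intro exI[of _ "w @ concat (replicate (N - 1) v)"]) (auto split: if_splits)
    qed
    show "f ` A = carrier (F Mod L)"
    proof
      show "f ` A \<subseteq> carrier (F Mod L)"
        unfolding F_def f_def carrier_free_Abelian_group_Mod using word by (auto simp: keys_letter_count)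
      show "carrier (F Mod L) \<subseteq> f ` A"
      proof
        fix X assume "X \<in> carrier (F Mod L)"
        then obtain x where x: "Poly_Mapping.keys x \<subseteq> I" "X = L #>\<^bsub>F\<^esub> x"
          unfolding F_def carrier_free_Abelian_group_Mod by blast
        then obtain u where u: "set u \<subseteq> I" "x - letter_count u \<in> L" using pos by blast
        then have "X = L #>\<^bsub>F\<^esub> letter_count u"
          unfolding x(2) F_def using x(1) by (subst free_Abelian_group_rcoset_eq_iff[OF L]) (auto simp: keys_letter_count)
        then have "X = f (fold t u p)" using f u by simp
        moreover have "fold t u p \<in> A" by (rule fold_in_orbit) (use closed u(1) assms(3) in auto)
        ultimately show "X \<in> f ` A" by blast
      qed
    qed
  qed
  ultimately show ?thesis by (intro exI[of _ f]) simp
qed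

end

section \<open>Orbits of a finite abelian quandle\<close>

locale finite_abelian_quandle = abelian_quandle +
  assumes finite_Q: "finite Q"
begin

text \<open>Extended by the identity outside Q, since \<open>commuting_injections\<close> asks for
  commutation and injectivity on the whole type.\<close>

definition translation :: "'a \<Rightarrow> 'a \<Rightarrow> 'a" where
  "translation b = (\<lambda>a. if a \<in> Q then a \<triangleleft> b else a)"

definition reachable :: "'a \<Rightarrow> 'a set" where
  "reachable x = {fold translation w x | w. set w \<subseteq> Q}"

lemma op_closed [simp]: "\<lbrakk>a \<in> Q; b \<in> Q\<rbrakk> \<Longrightarrow> a \<triangleleft> b \<in> Q"
  using bij_right_translation[of b] by (auto simp: bij_betw_def)

lemma op_cancel: "\<lbrakk>a \<in> Q; a' \<in> Q; b \<in> Q; a \<triangleleft> b = a' \<triangleleft> b\<rbrakk> \<Longrightarrow> a = a'"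
  using bij_right_translation[of b] by (auto simp: bij_betw_def dest: inj_onD)

lemma translation_closed: "\<lbrakk>b \<in> Q; a \<in> Q\<rbrakk> \<Longrightarrow> translation b a \<in> Q"
  by (simp add: translation_def)

sublocale perms: commuting_injections Q translation
proof
  fix k l assume "k \<in> Q" "l \<in> Q"
  then show "translation k \<circ> translation l = translation l \<circ> translation k"
    by (simp add: fun_eq_iff translation_def abelian)
next
  fix k assume k: "k \<in> Q"
  show "inj (translation k)"
  proof (rule injI)
    fix x y assume "translation k x = translation k y"
    then show "x = y" using k op_cancel[of x y k] by (metis op_closed translation_def)
  qed
qed

lemma fold_translation_closed: "\<lbrakk>set w \<subseteq> Q; a \<in> Q\<rbrakk> \<Longrightarrow> fold translation w a \<in> Q"
  by (rule perms.fold_in_orbit) (auto simp: translation_closed)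

text \<open>Writing a as a' \<triangleleft> c, self-distributivity turns the left side into (a'
  \<triangleleft> b) \<triangleleft> c, and the abelian law exchanges b and c. Iterated, this makes
  a translation depend only on the orbit of the translating element.\<close>

lemma op_op_right:
  assumes "a \<in> Q" "b \<in> Q" "c \<in> Q"
  shows "a \<triangleleft> (b \<triangleleft> c) = a \<triangleleft> b"
proof -
  obtain a' where a': "a' \<in> Q" "a = a' \<triangleleft> c"
    using bij_right_translation[OF assms(3)] assms(1) by (auto simp: bij_betw_def)
  then have "a \<triangleleft> (b \<triangleleft> c) = (a' \<triangleleft> b) \<triangleleft> c" using self_distrib[of a' b c] assms by simp
  then show ?thesis using abelian[of a' b c] a' assms by simp
qed

lemma translation_fold: "\<lbrakk>set w \<subseteq> Q; b \<in> Q\<rbrakk> \<Longrightarrow> translation (fold translation w b) = translation b"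
proof (induction w arbitrary: b)
  case (Cons c w)
  then have "translation (fold translation w (translation c b)) = translation (translation c b)"
    using translation_closed by simp
  also have "\<dots> = translation b"
    using Cons.prems by (auto simp: translation_def op_op_right)
  finally show ?case by simp
qed simp

lemma reachable_refl: "x \<in> reachable x"
  unfolding reachable_def by (rule CollectI, rule exI[of _ "[]"]) simp

lemma reachable_trans: "\<lbrakk>y \<in> reachable x; z \<in> reachable y\<rbrakk> \<Longrightarrow> z \<in> reachable x"
proof -
  assume "y \<in> reachable x" "z \<in> reachable y"
  then obtain w v where "set w \<subseteq> Q" "y = fold translation w x" "set v \<subseteq> Q" "z = fold translation v y"
    by (auto simp: reachable_def)
  then show ?thesis unfolding reachable_def by (intro CollectI exI[of _ "w @ v"]) simp
qed

text \<open>If w leads from x to y and N rounds of w return to x, then N - 1 further rounds lead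
  from y back to x.\<close>

lemma reachable_sym:
  assumes "x \<in> Q" "y \<in> reachable x"
  shows "x \<in> reachable y"
proof -
  obtain w where w: "set w \<subseteq> Q" "y = fold translation w x"
    using assms(2) by (auto simp: reachable_def)
  obtain N where N: "N > 0" "(fold translation w ^^ N) x = x"
    using funpow_returns[OF finite_Q perms.inj_fold[OF w(1)] fold_translation_closed[OF w(1)] assms(1)]
    by blast
  have "fold translation (concat (replicate (N - 1) w)) y = (fold translation w ^^ (Suc (N - 1))) x"
    unfolding fold_concat_replicate w(2) funpow_Suc_right by simp
  then have "fold translation (concat (replicate (N - 1) w)) y = x" using N by simp
  then show ?thesis
    unfolding reachable_def using w(1)
    by (intro CollectI exI[of _ "concat (replicate (N - 1) w)"]) auto
qed

lemma reachable_eq_iff: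
  assumes "x \<in> Q" shows "reachable x = reachable y \<longleftrightarrow> y \<in> reachable x"
proof
  assume "y \<in> reachable x"
  with reachable_sym[OF assms this] show "reachable x = reachable y"
    by (blast intro: reachable_trans)
qed (use reachable_refl in blast)

lemma reachable_subset: "x \<in> Q \<Longrightarrow> reachable x \<subseteq> Q"
  by (auto simp: reachable_def fold_translation_closed)

lemma restrict_translation_Bij: "b \<in> Q \<Longrightarrow> restrict (\<lambda>a. a \<triangleleft> b) Q \<in> Bij Q"
  using bij_right_translation[of b] by (simp add: Bij_def bij_betw_def inj_on_def)

text \<open>The generated group contains inverses, whereas \<open>reachable\<close> uses positive
  words; symmetry of reachability absorbs the inverse generators. Conversely, a word is a product of
  generators.\<close>

lemma orbit_eq_reachable:
  assumes x: "x \<in> Q"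
  shows "orbit (subgroup_generated (BijGroup Q) ((\<lambda>b. restrict (\<lambda>a. a \<triangleleft> b) Q) ` Q)) (\<lambda>g. g) x = reachable x"
proof -
  define S where "S = (\<lambda>b. restrict (\<lambda>a. a \<triangleleft> b) Q) ` Q"
  have S: "S \<subseteq> carrier (BijGroup Q)" unfolding S_def BijGroup_def using restrict_translation_Bij by auto
  have carr: "carrier (subgroup_generated (BijGroup Q) S) = generate (BijGroup Q) S"
    using S by (simp add: carrier_subgroup_generated Int_absorb1)
  have genB: "g \<in> Bij Q" if "g \<in> generate (BijGroup Q) S" for g
    using group.generate_in_carrier[OF group_BijGroup S that] by (simp add: BijGroup_def)
  have gen: "\<forall>y\<in>Q. g y \<in> reachable y" if "g \<in> generate (BijGroup Q) S" for g
    using that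
  proof (induction rule: generate.induct)
    case one
    then show ?case by (simp add: BijGroup_def reachable_refl)
  next
    case (incl h)
    then obtain b where b: "b \<in> Q" "h = restrict (\<lambda>a. a \<triangleleft> b) Q" by (auto simp: S_def)
    show ?case
    proof
      fix y assume "y \<in> Q"
      then have "h y = fold translation [b] y" using b by (simp add: translation_def)
      then show "h y \<in> reachable y" unfolding reachable_def using b(1) by (intro CollectI exI[of _ "[b]"]) simp
    qed
  next
    case (inv h)
    then obtain b where b: "b \<in> Q" "h = restrict (\<lambda>a. a \<triangleleft> b) Q" by (auto simp: S_def)
    have hB: "h \<in> Bij Q" unfolding b(2) by (rule restrict_translation_Bij[OF b(1)])
    show ?case
    proof
      fix y assume y: "y \<in> Q"
      define z where "z = inv_into Q h y"
      have hQ: "h ` Q = Q" using hB by (simp add: Bij_def bij_betw_def)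
      have z: "z \<in> Q" "h z = y"
        unfolding z_def using y hQ by (auto intro: inv_into_into f_inv_into_f)
      have "y = fold translation [b] z" using b z by (simp add: translation_def)
      then have "y \<in> reachable z" unfolding reachable_def using b(1) by (intro CollectI exI[of _ "[b]"]) simp
      then have "z \<in> reachable y" using reachable_sym z(1) by blast
      then show "(inv\<^bsub>BijGroup Q\<^esub> h) y \<in> reachable y"
        unfolding inv_BijGroup[OF hB] using y by (simp add: z_def)
    qed
  next
    case (eng g h)
    show ?case
    proof
      fix y assume y: "y \<in> Q"
      have "h y \<in> Q" using Bij_imp_funcset[OF genB[OF eng.hyps(2)]] y by auto
      then have "g (h y) \<in> reachable y" using eng.IH y reachable_trans by blast
      then show "(g \<otimes>\<^bsub>BijGroup Q\<^esub> h) y \<in> reachable y"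
        using genB[OF eng.hyps(1)] genB[OF eng.hyps(2)] y by (simp add: BijGroup_def compose_def)
    qed
  qed
  have "\<exists>g\<in>generate (BijGroup Q) S. g x = fold translation w x" if "set w \<subseteq> Q" for w
    using that
  \<comment> \<open>The product in \<open>BijGroup\<close> applies its right factor first, so the
    word is taken apart at its end.\<close>
  proof (induction w rule: rev_induct)
    case Nil
    show ?case by (rule bexI[OF _ generate.one]) (simp add: BijGroup_def x)
  next
    case (snoc b w)
    then obtain g where g: "g \<in> generate (BijGroup Q) S" "g x = fold translation w x" by auto
    define h where "h = restrict (\<lambda>a. a \<triangleleft> b) Q"
    have h: "h \<in> generate (BijGroup Q) S"
      by (rule generate.incl) (use snoc.prems in \<open>simp add: S_def h_def\<close>)
    have "(h \<otimes>\<^bsub>BijGroup Q\<^esub> g) x = h (g x)"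
      using genB[OF g(1)] genB[OF h] x by (simp add: BijGroup_def compose_def)
    also have "\<dots> = fold translation (w @ [b]) x"
      using g(2) fold_translation_closed[of w x] snoc.prems x by (simp add: h_def translation_def)
    finally show ?case by (intro bexI[OF _ generate.eng[OF h g(1)]])
  qed
  then show ?thesis
    unfolding S_def[symmetric] orbit_def carr reachable_def[of x]
    using gen x unfolding reachable_def by (auto; metis)
qed

lemma quandle_orbits_eq: "quandle_orbits Q (\<triangleleft>) = reachable ` Q"
  unfolding quandle_orbits_def orbits_def using orbit_eq_reachable by (auto simp: image_def)

end

section \<open>Orbit indices and translations labelled by orbits\<close>

locale ordered_abelian_quandle = finite_abelian_quandle +
  fixes r :: nat and Orb :: "nat \<Rightarrow> 'a set"
  assumes bij_Orb: "bij_betw Orb {1..r} (quandle_orbits Q (\<triangleleft>))"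
begin

definition idx :: "'a \<Rightarrow> nat" where
  "idx a = inv_into {1..r} Orb (reachable a)"

lemma idx_in [simp]: "a \<in> Q \<Longrightarrow> idx a \<in> {1..r}"
  and Orb_idx: "a \<in> Q \<Longrightarrow> Orb (idx a) = reachable a"
proof -
  assume "a \<in> Q"
  then have "reachable a \<in> Orb ` {1..r}"
    using bij_Orb by (simp add: bij_betw_def quandle_orbits_eq)
  then show "idx a \<in> {1..r}" "Orb (idx a) = reachable a"
    unfolding idx_def by (rule inv_into_into, rule f_inv_into_f)
qed

lemma idx_bounds [simp]: "a \<in> Q \<Longrightarrow> Suc 0 \<le> idx a" "a \<in> Q \<Longrightarrow> idx a \<le> r"
  using idx_in[of a] by simp_all

lemma idx_eq_iff: "\<lbrakk>a \<in> Q; b \<in> Q\<rbrakk> \<Longrightarrow> idx a = idx b \<longleftrightarrow> b \<in> reachable a"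
  by (metis Orb_idx idx_def reachable_eq_iff)

lemma Orb_eq:
  assumes "i \<in> {1..r}" shows "Orb i = {a \<in> Q. idx a = i}"
proof -
  have "Orb i \<in> reachable ` Q"
    using bij_betwE[OF bij_Orb] assms by (simp add: quandle_orbits_eq)
  then obtain p where p: "p \<in> Q" "Orb i = reachable p" by blast
  have "inj_on Orb {1..r}" using bij_Orb by (simp add: bij_betw_def)
  then have ip: "idx p = i" using p assms unfolding idx_def by (metis inv_into_f_f)
  have "a \<in> reachable p \<longleftrightarrow> a \<in> Q \<and> idx a = i" for a
    using idx_eq_iff[OF p(1), of a] reachable_subset[OF p(1)] ip by auto
  then show ?thesis unfolding p(2) by blast
qed

lemma Orb_nonempty: "i \<in> {1..r} \<Longrightarrow> Orb i \<noteq> {}"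
  using bij_betwE[OF bij_Orb] reachable_refl by (force simp: quandle_orbits_eq)

definition base :: "nat \<Rightarrow> 'a" where
  "base i = (SOME a. a \<in> Orb i)"

lemma base [simp]: "i \<in> {1..r} \<Longrightarrow> base i \<in> Q" "i \<in> {1..r} \<Longrightarrow> idx (base i) = i"
  using some_in_eq[of "Orb i"] Orb_nonempty[of i] Orb_eq[of i] unfolding base_def by auto

lemma idx_op [simp]:
  assumes "a \<in> Q" "b \<in> Q" shows "idx (a \<triangleleft> b) = idx a"
proof -
  have "a \<triangleleft> b \<in> reachable a"
    unfolding reachable_def using assms by (intro CollectI exI[of _ "[b]"]) (simp add: translation_def)
  then show ?thesis using idx_eq_iff[of a "a \<triangleleft> b"] assms by simp
qed

lemma translation_idx_cong:
  assumes "b \<in> Q" "b' \<in> Q" "idx b = idx b'" shows "translation b = translation b'"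
proof -
  obtain w where "set w \<subseteq> Q" "b' = fold translation w b"
    using assms idx_eq_iff[of b b'] by (auto simp: reachable_def)
  then show ?thesis using translation_fold assms by simp
qed

lemma op_idx_cong: "\<lbrakk>a \<in> Q; b \<in> Q; b' \<in> Q; idx b = idx b'\<rbrakk> \<Longrightarrow> a \<triangleleft> b = a \<triangleleft> b'"
  using translation_idx_cong[of b b'] by (simp add: translation_def fun_eq_iff) metis

text \<open>Translation by orbit j as a whole; \<open>step_eq\<close> shows that the chosen
  representative does not matter.\<close>

definition step :: "nat \<Rightarrow> 'a \<Rightarrow> 'a" where
  "step j = translation (base j)"

lemma step_eq: "\<lbrakk>a \<in> Q; b \<in> Q\<rbrakk> \<Longrightarrow> step (idx b) a = a \<triangleleft> b"
  unfolding step_def translation_def using op_idx_cong[of a "base (idx b)" b] by simp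

lemma step_op: "a \<in> Q \<Longrightarrow> step j a = a \<triangleleft> base j"
  by (simp add: step_def translation_def)

lemma step_closed [simp]: "\<lbrakk>j \<in> {1..r}; a \<in> Q\<rbrakk> \<Longrightarrow> step j a \<in> Q"
  by (simp add: step_op)

lemma idx_step [simp]: "\<lbrakk>j \<in> {1..r}; a \<in> Q\<rbrakk> \<Longrightarrow> idx (step j a) = idx a"
  by (simp add: step_op)

text \<open>Idempotence makes an orbit act trivially on itself, which is why each orbit is described
  by r - 1 generators and not r.\<close>

lemma step_idx_self [simp]: "a \<in> Q \<Longrightarrow> step (idx a) a = a"
  using step_eq[of a a] idem by simp

sublocale steps: commuting_injections "{1..r}" step
  unfolding step_def using perms.commute perms.inj by unfold_locales auto

lemma connected:
  assumes "a \<in> Q" "b \<in> Q" "idx a = idx b"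
  shows "\<exists>w. set w \<subseteq> {1..r} \<and> fold step w a = b"
proof -
  obtain w where w: "set w \<subseteq> Q" "b = fold translation w a"
    using assms idx_eq_iff[of a b] by (auto simp: reachable_def)
  have "fold step (map idx w) x = fold translation w x" if "x \<in> Q" for x
    using w(1) that
    by (induction w arbitrary: x) (auto simp: step_eq translation_def)
  then show ?thesis using w assms(1) by (intro exI[of _ "map idx w"]) auto
qed

end

section \<open>Parameters of a finite abelian quandle\<close>

text \<open>Inverse to \<open>cyc_diff\<close> for fixed i: the index i + k modulo r with
  representatives in {1..r}, so the value r itself is not reduced.\<close>

definition cyc_shift :: "nat \<Rightarrow> nat \<Rightarrow> nat \<Rightarrow> nat" where
  "cyc_shift r i k = (if i + k \<le> r then i + k else i + k - r)"

lemma cyc_diff_eq: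
  assumes "i \<in> {1..r}" "j \<in> {1..r}"
  shows "cyc_diff r j i = (if i \<le> j then j - i else j + r - i)"
proof (cases "i \<le> j")
  case True
  then have "(int j - int i) mod int r = int (j - i)" using assms by (simp add: of_nat_diff)
  then show ?thesis using True by (simp add: cyc_diff_def)
next
  case False
  have "(int j - int i) mod int r = (int j - int i + int r) mod int r" by simp
  also have "\<dots> = int j - int i + int r" using False assms by (intro mod_pos_pos_trivial) auto
  also have "\<dots> = int (j + r - i)" using assms by (simp add: of_nat_diff)
  finally show ?thesis using False by (simp add: cyc_diff_def)
qed

lemma cyc_diff_self: "cyc_diff r i i = 0"
  by (simp add: cyc_diff_def)

lemma cyc_diff_in: "\<lbrakk>i \<in> {1..r}; j \<in> {1..r}; i \<noteq> j\<rbrakk> \<Longrightarrow> cyc_diff r j i \<in> {1..<r}"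
  by (auto simp: cyc_diff_eq)

lemma cyc_shift_cyc_diff: "\<lbrakk>i \<in> {1..r}; j \<in> {1..r}\<rbrakk> \<Longrightarrow> cyc_shift r i (cyc_diff r j i) = j"
  by (auto simp: cyc_diff_eq cyc_shift_def)

lemma cyc_shift_in: "\<lbrakk>i \<in> {1..r}; k \<in> {1..<r}\<rbrakk> \<Longrightarrow> cyc_shift r i k \<in> {1..r}"
  by (auto simp: cyc_shift_def)

lemma cyc_diff_cyc_shift: "\<lbrakk>i \<in> {1..r}; k \<in> {1..<r}\<rbrakk> \<Longrightarrow> cyc_diff r (cyc_shift r i k) i = k"
  using cyc_diff_eq[of i r "cyc_shift r i k"] cyc_shift_in[of i r k] by (auto simp: cyc_shift_def)

lemma is_quandle_parametersE:
  assumes "is_quandle_parameters Q tri r Orb M"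
  obtains f where "bij_betw f Q (param_quandle_carrier r M)"
    "\<And>a b. \<lbrakk>a \<in> Q; b \<in> Q\<rbrakk> \<Longrightarrow> f (tri a b) = param_quandle_op r M (f a) (f b)"
    "\<And>j. j \<in> {1..r} \<Longrightarrow> f ` Orb j = {j} \<times> carrier (param_grp r (M j))"
proof -
  from assms obtain f where 1: "bij_betw f Q (param_quandle_carrier r M)"
    and 2: "\<forall>a\<in>Q. \<forall>b\<in>Q. f (tri a b) = param_quandle_op r M (f a) (f b)"
    and 3: "\<forall>i\<in>{1..r}. f ` Orb i = {i} \<times> carrier (param_grp r (M i))"
    unfolding is_quandle_parameters_def by (elim conjE exE)
  show thesis by (rule that[OF 1 bspec[OF bspec[OF 2]] bspec[OF 3]])
qed

lemma comm_group_param_grp: "comm_group (param_grp r m)"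
  unfolding param_grp_def
  by (rule comm_group.abelian_FactGroup[OF abelian_free_Abelian_group subgroup_param_relations])

lemma group_param_grp [simp]: "group (param_grp r m)"
  using comm_group_param_grp comm_group.axioms(2) by blast

lemma param_gen_in_carrier:
  assumes "k < r" shows "param_gen r m k \<in> carrier (param_grp r m)"
proof (cases "k = 0")
  case True
  then show ?thesis using group.is_monoid[OF group_param_grp] by (simp add: param_gen_def monoid.one_closed)
next
  case False
  then show ?thesis using assms
    by (auto simp: param_gen_def param_grp_def carrier_free_Abelian_group_Mod intro!: imageI)
qed

context ordered_abelian_quandle
begin

lemma commuting_injections_shifted:
  assumes "i \<in> {1..r}"
  shows "commuting_injections {1..<r} (\<lambda>k. step (cyc_shift r i k))"
proof
  fix k l assume "k \<in> {1..<r}" "l \<in> {1..<r}"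
  then show "step (cyc_shift r i k) \<circ> step (cyc_shift r i l) = step (cyc_shift r i l) \<circ> step (cyc_shift r i k)"
    by (intro steps.commute cyc_shift_in assms)
next
  fix k assume "k \<in> {1..<r}"
  then show "inj (step (cyc_shift r i k))" by (intro steps.inj cyc_shift_in assms)
qed

definition param_lattice :: "nat \<Rightarrow> (nat \<Rightarrow>\<^sub>0 int) set" where
  "param_lattice i = commuting_injections.stabilizer_lattice {1..<r} (\<lambda>k. step (cyc_shift r i k)) (base i)"

lemma base_in_Orb: "i \<in> {1..r} \<Longrightarrow> base i \<in> Orb i"
  using base[of i] by (simp add: Orb_eq)

lemma step_cyc_shift_Orb: "\<lbrakk>i \<in> {1..r}; k \<in> {1..<r}; a \<in> Orb i\<rbrakk> \<Longrightarrow> step (cyc_shift r i k) a \<in> Orb i"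
  using step_closed[of "cyc_shift r i k" a] idx_step[of "cyc_shift r i k" a] cyc_shift_in[of i r k]
  by (simp only: Orb_eq mem_Collect_eq)

lemma finite_Orb: "i \<in> {1..r} \<Longrightarrow> finite (Orb i)"
  using finite_Q by (simp add: Orb_eq)

text \<open>Letters equal to i act trivially on orbit i and are dropped from a connecting word; the
  others are renamed by their cyclic distance from i.\<close>

lemma Orb_connected:
  assumes i: "i \<in> {1..r}" and a: "a \<in> Orb i"
  shows "\<exists>w. set w \<subseteq> {1..<r} \<and> fold (\<lambda>k. step (cyc_shift r i k)) w (base i) = a"
proof -
  have drop_self: "\<exists>v. set v \<subseteq> {1..<r} \<and> fold (\<lambda>k. step (cyc_shift r i k)) v x = fold step w x"
    if "set w \<subseteq> {1..r}" "x \<in> Q" "idx x = i" for w x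
    using that
  proof (induction w arbitrary: x)
    case Nil
    show ?case by (rule exI[of _ "[]"]) simp
  next
    case (Cons j w)
    then have j: "j \<in> {1..r}" by simp
    have x: "step j x \<in> Q" "idx (step j x) = i" using step_closed[OF j] idx_step[OF j] Cons.prems by auto
    obtain v where v: "set v \<subseteq> {1..<r}" "fold (\<lambda>k. step (cyc_shift r i k)) v (step j x) = fold step w (step j x)"
      using Cons.IH[OF _ x] Cons.prems by auto
    show ?case
    proof (cases "j = i")
      case True
      then show ?thesis using v Cons.prems by auto
    next
      case False
      then show ?thesis using v cyc_diff_in[OF i j] cyc_shift_cyc_diff[OF i j]
        by (intro exI[of _ "cyc_diff r j i # v"]) auto
    qed
  qed
  have "a \<in> Q" "idx a = i" using a by (simp_all add: Orb_eq[OF i])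
  then obtain w where "set w \<subseteq> {1..r}" "fold step w (base i) = a"
    using connected[of "base i" a] base[OF i] by auto
  then show ?thesis using drop_self[of w "base i"] base[OF i] by auto
qed

lemma subgroup_param_lattice: "i \<in> {1..r} \<Longrightarrow> subgroup (param_lattice i) (free_Abelian_group {1..<r})"
  unfolding param_lattice_def
  by (rule commuting_injections.subgroup_stabilizer_lattice[OF commuting_injections_shifted])

lemma param_lattice_torsion:
  assumes i: "i \<in> {1..r}" and k: "k \<in> {1..<r}"
  shows "\<exists>N>0. frag_cmul N (frag_of k) \<in> param_lattice i"
proof -
  obtain N :: nat where "N > 0" "frag_cmul (int N) (letter_count [k]) \<in> param_lattice i"
    unfolding param_lattice_def
    using commuting_injections.stabilizer_lattice_torsion[OF commuting_injections_shifted[OF i]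
        finite_Orb[OF i] step_cyc_shift_Orb[OF i] base_in_Orb[OF i], of "[k]"] k by auto
  then show ?thesis by (intro exI[of _ "int N"]) simp
qed

lemma param_gen_relations:
  "k \<in> {1..<r} \<Longrightarrow> param_gen r m k = param_relations r m #>\<^bsub>free_Abelian_group {1..<r}\<^esub> frag_of k"
  by (simp add: param_gen_def)

text \<open>Each orbit is modelled on the cosets of its own \<open>param_lattice\<close>, and the
  isomorphism is glued from these bijections. The operation is respected across orbits because a
  \<triangleleft> b depends on b only through its orbit; within one orbit the offset is 0, whose
  generator is the identity.\<close>

lemma quandle_parameters_existence: "\<exists>M. is_quandle_parameters Q (\<triangleleft>) r Orb M"
proof -
  define model where "model = (\<lambda>i m f. param_collection r m \<and> bij_betw f (Orb i) (carrier (param_grp r m)) \<and>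
      (\<forall>a\<in>Orb i. \<forall>k\<in>{1..<r}. f (step (cyc_shift r i k) a) = f a \<otimes>\<^bsub>param_grp r m\<^esub> param_gen r m k))"
  have "\<exists>m f. model i m f"
    if i: "i \<in> {1..r}" for i
  proof -
    obtain m where m: "param_collection r m" "param_relations r m = param_lattice i"
      using param_collection_exists[OF subgroup_param_lattice[OF i]] param_lattice_torsion[OF i] by auto
    obtain f where "bij_betw f (Orb i) (carrier (free_Abelian_group {1..<r} Mod param_lattice i))"
      "\<forall>a\<in>Orb i. \<forall>k\<in>{1..<r}. f (step (cyc_shift r i k) a) =
        f a \<otimes>\<^bsub>free_Abelian_group {1..<r} Mod param_lattice i\<^esub> (param_lattice i #>\<^bsub>free_Abelian_group {1..<r}\<^esub> frag_of k)"
      using commuting_injections.transitive_action_coset_model[OF commuting_injections_shifted[OF i]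
          finite_Orb[OF i] step_cyc_shift_Orb[OF i] base_in_Orb[OF i] Orb_connected[OF i]]
      unfolding param_lattice_def[symmetric] by blast
    then have "model i m f"
      unfolding model_def m(2)[symmetric] param_grp_def[symmetric] using m(1) param_gen_relations by auto
    then show ?thesis by blast
  qed
  then obtain M f where model: "\<And>i. i \<in> {1..r} \<Longrightarrow> model i (M i) (f i)"
    by metis
  have M: "param_collection r (M i)" and f: "bij_betw (f i) (Orb i) (carrier (param_grp r (M i)))"
    if "i \<in> {1..r}" for i
    using model[OF that] by (simp_all add: model_def)
  have fstep: "f i (step (cyc_shift r i k) a) = f i a \<otimes>\<^bsub>param_grp r (M i)\<^esub> param_gen r (M i) k"
    if "i \<in> {1..r}" "a \<in> Orb i" "k \<in> {1..<r}" for i a k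
    using model[OF that(1)] that(2,3) unfolding model_def by blast
  define M' where "M' = restrict M {1..r}"
  define F where "F = (\<lambda>a. (idx a, f (idx a) a))"
  have "bij_betw F Q (param_quandle_carrier r M')"
  proof (rule bij_betw_imageI)
    show "inj_on F Q"
    proof (rule inj_onI)
      fix x y assume xy: "x \<in> Q" "y \<in> Q" "F x = F y"
      from xy(3) have e: "idx x = idx y" and "f (idx x) x = f (idx y) y"
        unfolding F_def prod.inject by blast+
      then have "f (idx x) x = f (idx x) y" by simp
      with e show "x = y"
        using inj_onD[OF bij_betw_imp_inj_on[OF f[OF idx_in[OF xy(1)]]], of x y] xy(1,2)
          Orb_eq[OF idx_in[OF xy(1)]] by simp
    qed
    show "F ` Q = param_quandle_carrier r M'"
    proof
      show "F ` Q \<subseteq> param_quandle_carrier r M'"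
      proof (rule image_subsetI)
        fix a assume a: "a \<in> Q"
        then have "a \<in> Orb (idx a)" using Orb_eq[OF idx_in[OF a]] by simp
        then have "f (idx a) a \<in> carrier (param_grp r (M (idx a)))"
          using bij_betwE[OF f[OF idx_in[OF a]]] by blast
        then show "F a \<in> param_quandle_carrier r M'"
          using a by (simp add: F_def param_quandle_carrier_def M'_def)
      qed
      show "param_quandle_carrier r M' \<subseteq> F ` Q"
      proof
        fix z assume "z \<in> param_quandle_carrier r M'"
        then obtain i X where z: "z = (i, X)" "i \<in> {1..r}" "X \<in> carrier (param_grp r (M i))"
          by (auto simp: param_quandle_carrier_def M'_def)
        then obtain a where "a \<in> Orb i" "X = f i a"
          using bij_betw_imp_surj_on[OF f[OF z(2)]] by blast
        then show "z \<in> F ` Q" using z Orb_eq[OF z(2)] by (auto simp: F_def)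
      qed
    qed
  qed
  moreover have "F (a \<triangleleft> b) = param_quandle_op r M' (F a) (F b)" if a: "a \<in> Q" and b: "b \<in> Q" for a b
  proof (cases "idx a = idx b")
    case True
    have aO: "a \<in> Orb (idx a)" using a Orb_eq[OF idx_in[OF a]] by simp
    have "f (idx a) a \<in> carrier (param_grp r (M (idx a)))"
      using bij_betwE[OF f[OF idx_in[OF a]]] aO by blast
    moreover have "a \<triangleleft> b = a" using step_eq[OF a b] True step_idx_self[OF a] by simp
    ultimately show ?thesis
      using True a b monoid.r_one[OF group.is_monoid[OF group_param_grp]]
      by (simp add: F_def param_quandle_op_def cyc_diff_self param_gen_def M'_def)
  next
    case False
    have aO: "a \<in> Orb (idx a)" using a Orb_eq[OF idx_in[OF a]] by simp
    define k where "k = cyc_diff r (idx b) (idx a)"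
    have k: "k \<in> {1..<r}" "cyc_shift r (idx a) k = idx b"
      unfolding k_def using cyc_diff_in[OF idx_in[OF a] idx_in[OF b] False]
        cyc_shift_cyc_diff[OF idx_in[OF a] idx_in[OF b]] by auto
    have "f (idx a) (a \<triangleleft> b) = f (idx a) a \<otimes>\<^bsub>param_grp r (M (idx a))\<^esub> param_gen r (M (idx a)) k"
      using fstep[OF idx_in[OF a] aO k(1)] unfolding k(2) step_eq[OF a b] .
    then show ?thesis using a b by (simp add: F_def param_quandle_op_def k_def M'_def)
  qed
  moreover have "F ` Orb i = {i} \<times> carrier (param_grp r (M' i))" if i: "i \<in> {1..r}" for i
  proof -
    have "F ` Orb i = Pair i ` (f i ` Orb i)"
      unfolding image_image by (rule image_cong) (auto simp: Orb_eq[OF i] F_def)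
    also have "\<dots> = {i} \<times> carrier (param_grp r (M' i))"
      unfolding bij_betw_imp_surj_on[OF f[OF i]] using i by (auto simp: M'_def)
    finally show ?thesis .
  qed
  moreover have "M' \<in> {1..r} \<rightarrow>\<^sub>E {m. param_collection r m}" using M by (auto simp: M'_def)
  ultimately show ?thesis unfolding is_quandle_parameters_def by blast
qed

text \<open>The relation lattice of the \<open>i\<close>-th parameter group is determined by the quandle, so that
  uniqueness of the Hermite normal form gives uniqueness of the parameters.\<close>

lemma param_relations_eq_param_lattice:
  assumes M: "is_quandle_parameters Q (\<triangleleft>) r Orb M" and i: "i \<in> {1..r}"
  shows "param_relations r (M i) = param_lattice i"
proof -
  interpret shifted: commuting_injections "{1..<r}" "\<lambda>k. step (cyc_shift r i k)"
    by (rule commuting_injections_shifted[OF i])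
  define F where "F = free_Abelian_group {1..<r}"
  define L where "L = param_relations r (M i)"
  have L: "subgroup L (free_Abelian_group {1..<r})" unfolding L_def by (rule subgroup_param_relations)
  obtain f where f: "bij_betw f Q (param_quandle_carrier r M)"
    "\<And>a b. \<lbrakk>a \<in> Q; b \<in> Q\<rbrakk> \<Longrightarrow> f (a \<triangleleft> b) = param_quandle_op r M (f a) (f b)"
    "\<And>j. j \<in> {1..r} \<Longrightarrow> f ` Orb j = {j} \<times> carrier (param_grp r (M j))"
    by (rule is_quandle_parametersE[OF M], rule that)
  have fstep: "f (step (cyc_shift r i k) a) = (i, L #>\<^bsub>F\<^esub> (x + frag_of k))"
    if k: "k \<in> {1..<r}" and a: "a \<in> Orb i" and fa: "f a = (i, L #>\<^bsub>F\<^esub> x)"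
      and x: "Poly_Mapping.keys x \<subseteq> {1..<r}" for k a x
  proof -
    define j where "j = cyc_shift r i k"
    have j: "j \<in> {1..r}" "cyc_diff r j i = k"
      unfolding j_def using cyc_shift_in[OF i k] cyc_diff_cyc_shift[OF i k] by auto
    have "f (base j) \<in> {j} \<times> carrier (param_grp r (M j))"
      unfolding f(3)[OF j(1), symmetric] by (rule imageI[OF base_in_Orb[OF j(1)]])
    then obtain Y where Y: "f (base j) = (j, Y)" by blast
    have "f (step j a) = param_quandle_op r M (f a) (f (base j))"
      using f(2)[of a "base j"] a base[OF j(1)] by (simp add: step_op Orb_eq[OF i])
    also have "\<dots> = (i, (L #>\<^bsub>F\<^esub> x) \<otimes>\<^bsub>param_grp r (M i)\<^esub> (L #>\<^bsub>F\<^esub> frag_of k))"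
      unfolding fa Y param_quandle_op_def using j(2) k
      by (simp add: param_gen_relations F_def L_def)
    also have "\<dots> = (i, L #>\<^bsub>F\<^esub> (x + frag_of k))"
      using free_Abelian_group_rcoset_mult[OF L x, of "frag_of k"] k
      by (simp add: param_grp_def F_def L_def)
    finally show ?thesis unfolding j_def .
  qed
  have fold: "f (fold (\<lambda>k. step (cyc_shift r i k)) w a) = (i, L #>\<^bsub>F\<^esub> (x + letter_count w))"
    if "set w \<subseteq> {1..<r}" "a \<in> Orb i" "f a = (i, L #>\<^bsub>F\<^esub> x)" "Poly_Mapping.keys x \<subseteq> {1..<r}" for w a x
    using that
  proof (induction w arbitrary: a x)
    case (Cons k w)
    have "f (fold (\<lambda>k. step (cyc_shift r i k)) w (step (cyc_shift r i k) a)) =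
        (i, L #>\<^bsub>F\<^esub> ((x + frag_of k) + letter_count w))"
      using Cons.prems by (intro Cons.IH fstep step_cyc_shift_Orb[OF i] keys_add_subset) auto
    then show ?case by (simp add: add.assoc)
  qed simp
  \<comment> \<open>An isomorphism may send \<open>base i\<close> to any coset; its representative x
    is a common shift that cancels in differences.\<close>
  obtain x where x: "Poly_Mapping.keys x \<subseteq> {1..<r}" "f (base i) = (i, L #>\<^bsub>F\<^esub> x)"
  proof -
    have "f (base i) \<in> {i} \<times> carrier (param_grp r (M i))"
      unfolding f(3)[OF i, symmetric] by (rule imageI[OF base_in_Orb[OF i]])
    then obtain x where "Poly_Mapping.keys x \<subseteq> {1..<r}" "f (base i) = (i, L #>\<^bsub>F\<^esub> x)"
      unfolding param_grp_def carrier_free_Abelian_group_Mod F_def L_def by auto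
    then show ?thesis by (rule that)
  qed
  have "letter_count w - letter_count v \<in> L \<longleftrightarrow> letter_count w - letter_count v \<in> param_lattice i"
    if wv: "set w \<subseteq> {1..<r}" "set v \<subseteq> {1..<r}" for w v
  proof -
    let ?g = "fold (\<lambda>k. step (cyc_shift r i k))"
    have inQ: "?g u (base i) \<in> Q" if "set u \<subseteq> {1..<r}" for u
    proof -
      have "?g u (base i) \<in> Orb i"
        by (rule shifted.fold_in_orbit) (use step_cyc_shift_Orb[OF i] that base_in_Orb[OF i] in auto)
      then show ?thesis by (simp add: Orb_eq[OF i])
    qed
    have inj: "inj_on f Q" using f(1) by (simp add: bij_betw_def)
    have "letter_count w - letter_count v \<in> L \<longleftrightarrow>
        L #>\<^bsub>F\<^esub> (x + letter_count w) = L #>\<^bsub>F\<^esub> (x + letter_count v)"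
      unfolding F_def using wv x(1)
      by (subst free_Abelian_group_rcoset_eq_iff[OF L]) (simp_all add: keys_add_subset keys_letter_count)
    also have "\<dots> \<longleftrightarrow> f (?g w (base i)) = f (?g v (base i))"
      using fold[OF wv(1) base_in_Orb[OF i] x(2,1)] fold[OF wv(2) base_in_Orb[OF i] x(2,1)] by simp
    also have "\<dots> \<longleftrightarrow> ?g w (base i) = ?g v (base i)"
      by (rule inj_on_eq_iff[OF inj inQ[OF wv(1)] inQ[OF wv(2)]])
    also have "\<dots> \<longleftrightarrow> letter_count w - letter_count v \<in> param_lattice i"
      unfolding param_lattice_def
      using shifted.letter_count_diff_in_stabilizer_lattice_iff[OF wv] by simp
    finally show ?thesis .
  qed
  then have iff: "y \<in> L \<longleftrightarrow> y \<in> param_lattice i" if "Poly_Mapping.keys y \<subseteq> {1..<r}" for y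
    using frag_eq_letter_count_diff[OF that] by auto
  have "y \<in> L \<longleftrightarrow> y \<in> param_lattice i" for y
  proof (cases "Poly_Mapping.keys y \<subseteq> {1..<r}")
    case False
    then show ?thesis
      using frag_subgroup_keys[OF L, of y] frag_subgroup_keys[OF subgroup_param_lattice[OF i], of y] by auto
  qed (rule iff)
  then show ?thesis unfolding L_def[symmetric] by blast
qed

text \<open>\<open>param_lattice\<close> does not mention M, so any two parameter families have the
  same relation lattices and hence coincide; this makes the definite description meaningful.\<close>

lemma is_quandle_parameters_quandle_parameters:
  "is_quandle_parameters Q (\<triangleleft>) r Orb (quandle_parameters Q (\<triangleleft>) r Orb)"
proof -
  have "M = M'" if M: "is_quandle_parameters Q (\<triangleleft>) r Orb M" and M': "is_quandle_parameters Q (\<triangleleft>) r Orb M'" for M M'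
  proof (rule extensionalityI)
    show "M \<in> extensional {1..r}" "M' \<in> extensional {1..r}"
      using M M' by (auto simp: is_quandle_parameters_def PiE_def)
    fix i assume i: "i \<in> {1..r}"
    show "M i = M' i"
    proof (rule param_collection_unique)
      show "param_collection r (M i)" "param_collection r (M' i)"
        using M M' i by (auto simp: is_quandle_parameters_def)
      show "param_relations r (M i) = param_relations r (M' i)"
        using param_relations_eq_param_lattice[OF M i] param_relations_eq_param_lattice[OF M' i] by simp
    qed
  qed
  then have "\<exists>!M. is_quandle_parameters Q (\<triangleleft>) r Orb M"
    using quandle_parameters_existence by (intro ex_ex1I) auto
  then show ?thesis unfolding quandle_parameters_def by (rule theI')
qed

end

section \<open>Rack chains of low degree\<close>

lemma rack_boundary_0 [simp]: "rack_boundary tri k 0 = 0"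
  and rack_boundary_add: "rack_boundary tri k (x + y) = rack_boundary tri k x + rack_boundary tri k y"
  and rack_boundary_diff: "rack_boundary tri k (x - y) = rack_boundary tri k x - rack_boundary tri k y"
  by (simp_all add: rack_boundary_def frag_extend_add frag_extend_diff)

lemma rack_boundary_2: "rack_boundary tri 2 (frag_of [a, b]) = frag_of [tri a b] - frag_of [a]"
  by (simp add: rack_boundary_def numeral_2_eq_2)

lemma rack_boundary_3:
  "rack_boundary tri 3 (frag_of [a, b, c]) =
    (frag_of [tri a b, c] - frag_of [a, c]) - (frag_of [tri a c, tri b c] - frag_of [a, b])"
proof -
  have "{2..3::nat} = {2, 3}" by auto
  then show ?thesis by (simp add: rack_boundary_def)
qed

lemma length_2_iff: "length xs = 2 \<longleftrightarrow> (\<exists>a b. xs = [a, b])"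
  by (auto simp: numeral_2_eq_2 length_Suc_conv)

lemma length_3_iff: "length xs = 3 \<longleftrightarrow> (\<exists>a b c. xs = [a, b, c])"
  by (auto simp: numeral_3_eq_3 length_Suc_conv)

context ordered_abelian_quandle
begin

definition pairs :: "'a list set" where
  "pairs = {xs. length xs = 2 \<and> set xs \<subseteq> Q}"

abbreviation d2 :: "('a list \<Rightarrow>\<^sub>0 int) \<Rightarrow> ('a list \<Rightarrow>\<^sub>0 int)" where
  "d2 \<equiv> rack_boundary (\<triangleleft>) 2"

abbreviation d3 :: "('a list \<Rightarrow>\<^sub>0 int) \<Rightarrow> ('a list \<Rightarrow>\<^sub>0 int)" where
  "d3 \<equiv> rack_boundary (\<triangleleft>) 3"

definition bd :: "('a list \<Rightarrow>\<^sub>0 int) set" where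
  "bd = d3 ` carrier (rack_chain Q 3)"

definition cyc :: "('a list \<Rightarrow>\<^sub>0 int) set" where
  "cyc = {z. Poly_Mapping.keys z \<subseteq> pairs \<and> d2 z = 0}"

abbreviation e :: "'a \<Rightarrow> 'a \<Rightarrow> ('a list \<Rightarrow>\<^sub>0 int)" where
  "e a b \<equiv> frag_of [a, b]"

lemma pair_in_pairs [simp]: "[a, b] \<in> pairs \<longleftrightarrow> a \<in> Q \<and> b \<in> Q"
  by (simp add: pairs_def)

lemma pairsE:
  assumes "xs \<in> pairs" obtains a b where "xs = [a, b]" "a \<in> Q" "b \<in> Q"
  using assms by (auto simp: pairs_def length_2_iff)

lemma keys_e: "\<lbrakk>a \<in> Q; b \<in> Q\<rbrakk> \<Longrightarrow> Poly_Mapping.keys (e a b) \<subseteq> pairs"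
  by simp

lemma keys_e_diff: "\<lbrakk>a \<in> Q; b \<in> Q; a' \<in> Q; b' \<in> Q\<rbrakk> \<Longrightarrow> Poly_Mapping.keys (e a b - e a' b') \<subseteq> pairs"
  by (intro keys_diff_subset keys_e)

lemma triple_chain_induct [consumes 1, case_names zero triple diff]:
  assumes "c \<in> carrier (rack_chain Q 3)" "P 0"
    "\<And>a b c. \<lbrakk>a \<in> Q; b \<in> Q; c \<in> Q\<rbrakk> \<Longrightarrow> P (frag_of [a, b, c])" "\<And>x y. \<lbrakk>P x; P y\<rbrakk> \<Longrightarrow> P (x - y)"
  shows "P c"
proof -
  have "Poly_Mapping.keys c \<subseteq> {xs. length xs = 3 \<and> set xs \<subseteq> Q}"
    using assms(1) by (simp add: rack_chain_def)
  then show ?thesis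
    by (induction c rule: frag_induction) (use assms(2-4) in \<open>auto simp: length_3_iff\<close>)
qed

lemma pair_chain_induct [consumes 1, case_names zero pair diff]:
  assumes "Poly_Mapping.keys c \<subseteq> pairs" "P 0"
    "\<And>a b. \<lbrakk>a \<in> Q; b \<in> Q\<rbrakk> \<Longrightarrow> P (e a b)" "\<And>x y. \<lbrakk>P x; P y\<rbrakk> \<Longrightarrow> P (x - y)"
  shows "P c"
  using assms(1)
  by (induction c rule: frag_induction) (use assms(2-4) in \<open>auto elim!: pairsE\<close>)

lemma boundary_in_bd:
  assumes "a \<in> Q" "b \<in> Q" "c \<in> Q"
  shows "(e (a \<triangleleft> b) c - e a c) - (e (a \<triangleleft> c) (b \<triangleleft> c) - e a b) \<in> bd"
  unfolding bd_def
  by (rule image_eqI[of _ _ "frag_of [a, b, c]"])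
    (use assms in \<open>simp_all add: rack_boundary_3 rack_chain_def\<close>)

lemma bd_induct [consumes 1, case_names zero triple diff]:
  assumes "x \<in> bd" "P 0"
    "\<And>a b c. \<lbrakk>a \<in> Q; b \<in> Q; c \<in> Q\<rbrakk> \<Longrightarrow> P ((e (a \<triangleleft> b) c - e a c) - (e (a \<triangleleft> c) (b \<triangleleft> c) - e a b))"
    "\<And>x y. \<lbrakk>P x; P y\<rbrakk> \<Longrightarrow> P (x - y)"
  shows "P x"
proof -
  obtain c where c: "c \<in> carrier (rack_chain Q 3)" "x = d3 c"
    using assms(1) by (auto simp: bd_def)
  from c(1) have "P (d3 c)"
    by (induction c rule: triple_chain_induct)
      (simp_all add: rack_boundary_diff rack_boundary_3 assms(2-4))
  then show ?thesis using c(2) by simp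
qed

lemma subgroup_bd: "subgroup bd (free_Abelian_group pairs)"
proof (rule frag_subgroupI)
  show "Poly_Mapping.keys x \<subseteq> pairs" if "x \<in> bd" for x
    using that by (induction x rule: bd_induct) (simp_all add: keys_diff_subset)
  show "0 \<in> bd" unfolding bd_def by (rule image_eqI[of _ _ 0]) (simp_all add: rack_chain_def)
  fix x y assume "x \<in> bd" "y \<in> bd"
  then obtain c c' where "c \<in> carrier (rack_chain Q 3)" "x = d3 c" "c' \<in> carrier (rack_chain Q 3)" "y = d3 c'"
    by (auto simp: bd_def)
  then show "x - y \<in> bd"
    unfolding bd_def
    by (intro image_eqI[of _ _ "c - c'"]) (simp_all add: rack_boundary_diff rack_chain_def keys_diff_subset)
qed

lemmas bd_zero = frag_subgroup_zero[OF subgroup_bd]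
  and bd_add = frag_subgroup_add[OF subgroup_bd]
  and bd_diff = frag_subgroup_diff[OF subgroup_bd]
  and bd_minus = frag_subgroup_minus[OF subgroup_bd]
  and bd_keys = frag_subgroup_keys[OF subgroup_bd]

lemma bd_subset_cyc: "bd \<subseteq> cyc"
proof
  fix x assume x: "x \<in> bd"
  then have "d2 x = 0"
  proof (induction x rule: bd_induct)
    case (triple a b c)
    then show ?case
      by (simp add: rack_boundary_diff rack_boundary_2 self_distrib[of a b c] abelian[of a b c] op_op_right)
  qed (simp_all add: rack_boundary_diff)
  then show "x \<in> cyc" using bd_keys[OF x] by (simp add: cyc_def)
qed

lemma subgroup_cyc: "subgroup cyc (free_Abelian_group pairs)"
  by (rule frag_subgroupI) (simp_all add: cyc_def rack_boundary_diff keys_diff_subset)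

text \<open>In degree two the boundary relation separates: one side does not depend on \<open>b\<close>, the other
  one not on \<open>c\<close>, within their orbits.\<close>

lemma first_diff_cong:
  assumes "a \<in> Q" "b \<in> Q" "c \<in> Q" "c' \<in> Q" "idx c = idx c'"
  shows "(e (a \<triangleleft> b) c - e a c) - (e (a \<triangleleft> b) c' - e a c') \<in> bd"
proof -
  have "a \<triangleleft> c' = a \<triangleleft> c" "b \<triangleleft> c' = b \<triangleleft> c" using op_idx_cong assms by metis+
  then show ?thesis
    using bd_diff[OF boundary_in_bd[OF assms(1,2,3)] boundary_in_bd[OF assms(1,2,4)]] by simp
qed

text \<open>Adding and subtracting \<open>e (a \<triangleleft> c) b\<close> in the boundary of (a,
  b, c) isolates a change of the second entry. What it equals changes sign when b and c are
  exchanged, and both of its terms fall under \<open>first_diff_cong\<close>.\<close>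

lemma second_diff_eq:
  assumes "a \<in> Q" "b \<in> Q" "c \<in> Q"
  shows "(e (a \<triangleleft> c) (b \<triangleleft> c) - e (a \<triangleleft> c) b) - ((e (a \<triangleleft> b) c - e a c) - (e (a \<triangleleft> c) b - e a b)) \<in> bd"
  using bd_minus[OF boundary_in_bd[OF assms]] by (simp add: algebra_simps)

text \<open>This is \<open>first_diff_cong\<close> regrouped: b \<triangleleft> c and b lie in one
  orbit, so the change between them is unaffected by translating the first entry.\<close>

lemma second_diff_step:
  assumes "a \<in> Q" "b \<in> Q" "c \<in> Q" "d \<in> Q"
  shows "(e (a \<triangleleft> d) (b \<triangleleft> c) - e (a \<triangleleft> d) b) - (e a (b \<triangleleft> c) - e a b) \<in> bd"
  using first_diff_cong[of a d "b \<triangleleft> c" b] assms by (simp add: algebra_simps)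

lemma second_diff_cong_first:
  assumes "a \<in> Q" "a' \<in> Q" "idx a = idx a'" "b \<in> Q" "c \<in> Q"
  shows "(e a' (b \<triangleleft> c) - e a' b) - (e a (b \<triangleleft> c) - e a b) \<in> bd"
proof -
  have "(e (fold step w x) (b \<triangleleft> c) - e (fold step w x) b) - (e x (b \<triangleleft> c) - e x b) \<in> bd"
    if "set w \<subseteq> {1..r}" "x \<in> Q" for w x
    using that
  proof (induction w arbitrary: x)
    case Nil
    then show ?case by (simp add: bd_zero)
  next
    case (Cons j w)
    then have j: "j \<in> {1..r}" by simp
    have sx: "step j x \<in> Q" using step_closed[OF j] Cons.prems by simp
    have "(e (step j x) (b \<triangleleft> c) - e (step j x) b) - (e x (b \<triangleleft> c) - e x b) \<in> bd"
      using second_diff_step[of x b c "base j"] Cons.prems assms base[OF j] by (simp add: step_op)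
    from bd_add[OF Cons.IH[OF _ sx] this] show ?case using Cons.prems by (simp add: algebra_simps)
  qed
  then show ?thesis using connected[OF assms(1,2,3)] assms(1) by blast
qed

text \<open>Moving the first entry by c is free modulo \<open>bd\<close> and brings the change into
  the antisymmetric form of \<open>second_diff_eq\<close>. There b and c are replaced one at a time
  by \<open>first_diff_cong\<close>, and the first entry is moved back.\<close>

lemma second_diff_cong:
  assumes "a \<in> Q" "a' \<in> Q" "idx a = idx a'" "b \<in> Q" "b' \<in> Q" "idx b = idx b'"
    "c \<in> Q" "c' \<in> Q" "idx c = idx c'"
  shows "(e a (b \<triangleleft> c) - e a b) - (e a' (b' \<triangleleft> c') - e a' b') \<in> bd"
proof -
  have 1: "(e (a \<triangleleft> c) (b \<triangleleft> c) - e (a \<triangleleft> c) b) - (e a (b \<triangleleft> c) - e a b) \<in> bd"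
    by (rule second_diff_step) (use assms in auto)
  have 2: "(e (a \<triangleleft> c) (b \<triangleleft> c) - e (a \<triangleleft> c) b) - ((e (a \<triangleleft> b) c - e a c) - (e (a \<triangleleft> c) b - e a b)) \<in> bd"
    by (rule second_diff_eq) (use assms in auto)
  have 3: "(e (a \<triangleleft> c') (b' \<triangleleft> c') - e (a \<triangleleft> c') b') - ((e (a \<triangleleft> b') c' - e a c') - (e (a \<triangleleft> c') b' - e a b')) \<in> bd"
    by (rule second_diff_eq) (use assms in auto)
  have 4: "(e (a \<triangleleft> c') (b' \<triangleleft> c') - e (a \<triangleleft> c') b') - (e a' (b' \<triangleleft> c') - e a' b') \<in> bd"
    by (rule second_diff_cong_first) (use assms in auto)
  have 5: "(e (a \<triangleleft> b) c - e a c) - (e (a \<triangleleft> b) c' - e a c') \<in> bd"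
    by (rule first_diff_cong) (use assms in auto)
  have 6: "(e (a \<triangleleft> c) b - e a b) - (e (a \<triangleleft> c) b' - e a b') \<in> bd"
    by (rule first_diff_cong) (use assms in auto)
  have eq: "a \<triangleleft> b' = a \<triangleleft> b" "a \<triangleleft> c' = a \<triangleleft> c"
    using op_idx_cong[of a b' b] op_idx_cong[of a c' c] assms by auto
  show ?thesis
    using bd_add[OF bd_diff[OF bd_add[OF bd_diff[OF 2 1] 5] 6] bd_diff[OF 4 3]] unfolding eq
    by (simp add: algebra_simps)
qed

text \<open>The expressions that \<open>second_diff_eq\<close> gives for (b, c) and for (c, b) add
  up to zero. This is where the relators of the parameter group come from.\<close>

lemma second_diff_antisym:
  assumes "a \<in> Q" "b \<in> Q" "c \<in> Q"
  shows "(e a (b \<triangleleft> c) - e a b) + (e a (c \<triangleleft> b) - e a c) \<in> bd"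
proof -
  have 1: "(e (a \<triangleleft> c) (b \<triangleleft> c) - e (a \<triangleleft> c) b) - (e a (b \<triangleleft> c) - e a b) \<in> bd"
    by (rule second_diff_step) (use assms in auto)
  have 2: "(e (a \<triangleleft> b) (c \<triangleleft> b) - e (a \<triangleleft> b) c) - (e a (c \<triangleleft> b) - e a c) \<in> bd"
    by (rule second_diff_step) (use assms in auto)
  show ?thesis
    using bd_diff[OF bd_add[OF second_diff_eq[OF assms] second_diff_eq[OF assms(1,3,2)]] bd_add[OF 1 2]]
    by (simp add: algebra_simps)
qed

text \<open>Sums \<open>second_diff_cong\<close> along w: the effect of a word on the second entry
  does not depend on where in the orbit it starts. Additivity of \<open>\<Phi>\<close> rests on
  this.\<close>

lemma translation_diff_cong:
  assumes "a \<in> Q" "a' \<in> Q" "idx a = idx a'" and "b \<in> Q" "b' \<in> Q" "idx b = idx b'" and "set w \<subseteq> {1..r}"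
  shows "(e a (fold step w b) - e a b) - (e a' (fold step w b') - e a' b') \<in> bd"
  using assms(4-)
proof (induction w arbitrary: b b')
  case Nil
  then show ?case by (simp add: bd_zero)
next
  case (Cons j w)
  then have j: "j \<in> {1..r}" by simp
  have 1: "(e a (step j b) - e a b) - (e a' (step j b') - e a' b') \<in> bd"
    using second_diff_cong[of a a' b b' "base j" "base j"] Cons.prems assms(1-3) base[OF j] by (simp add: step_op)
  have 2: "(e a (fold step w (step j b)) - e a (step j b)) - (e a' (fold step w (step j b')) - e a' (step j b')) \<in> bd"
    by (rule Cons.IH) (use Cons.prems step_closed[OF j] idx_step[OF j] in auto)
  show ?case using bd_add[OF 2 1] by (simp add: algebra_simps)
qed

section \<open>Paths and loops in the orbits\<close>

text \<open>The walk spelled by a word, with \<open>base j\<close> as the fixed label for orbit j. A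
  pair with another second entry agrees with such an edge only modulo changes within that
  orbit.\<close>

primrec path :: "nat list \<Rightarrow> 'a \<Rightarrow> ('a list \<Rightarrow>\<^sub>0 int)" where
  "path [] a = 0"
| "path (j # w) a = e a (base j) + path w (step j a)"

lemma path_append: "path (w @ v) a = path w a + path v (fold step w a)"
  by (induction w arbitrary: a) (simp_all add: add.assoc)

lemma fold_step_closed: "\<lbrakk>set w \<subseteq> {1..r}; a \<in> Q\<rbrakk> \<Longrightarrow> fold step w a \<in> Q"
  by (rule steps.fold_in_orbit) auto

lemma idx_fold_step: "\<lbrakk>set w \<subseteq> {1..r}; a \<in> Q\<rbrakk> \<Longrightarrow> idx (fold step w a) = idx a"
proof (induction w arbitrary: a)
  case (Cons j w)
  then have j: "j \<in> {1..r}" by simp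
  show ?case using Cons.IH[of "step j a"] Cons.prems step_closed[OF j] idx_step[OF j] by simp
qed simp

lemma keys_path: "\<lbrakk>set w \<subseteq> {1..r}; a \<in> Q\<rbrakk> \<Longrightarrow> Poly_Mapping.keys (path w a) \<subseteq> pairs"
proof (induction w arbitrary: a)
  case (Cons j w)
  then have j: "j \<in> {1..r}" by simp
  have "Poly_Mapping.keys (path w (step j a)) \<subseteq> pairs"
    using Cons.IH[of "step j a"] Cons.prems step_closed[OF j] by simp
  then show ?case using Cons.prems base[OF j] by (simp add: keys_add_subset)
qed simp

lemma d2_path: "\<lbrakk>set w \<subseteq> {1..r}; a \<in> Q\<rbrakk> \<Longrightarrow> d2 (path w a) = frag_of [fold step w a] - frag_of [a]"
proof (induction w arbitrary: a)
  case (Cons j w)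
  then have j: "j \<in> {1..r}" by simp
  have "d2 (path w (step j a)) = frag_of [fold step w (step j a)] - frag_of [step j a]"
    using Cons.IH[of "step j a"] Cons.prems step_closed[OF j] by simp
  then show ?case using Cons.prems by (simp add: rack_boundary_add rack_boundary_2 step_op)
qed simp

definition orbit_pairs :: "nat \<Rightarrow> 'a list set" where
  "orbit_pairs i = {xs \<in> pairs. idx (hd xs) = i}"

definition second_count :: "('a list \<Rightarrow>\<^sub>0 int) \<Rightarrow> (nat \<Rightarrow>\<^sub>0 int)" where
  "second_count = frag_extend (\<lambda>xs. frag_of (idx (xs ! 1)))"

section \<open>Commuting labels modulo a subgroup that identifies second entries of one
  orbit\<close>

context
  fixes K
  assumes K: "subgroup K (free_Abelian_group pairs)" and bd_K: "bd \<subseteq> K"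
    and same_orbit: "\<And>a b b'. \<lbrakk>a \<in> Q; b \<in> Q; b' \<in> Q; idx b = idx b'\<rbrakk> \<Longrightarrow> e a b - e a b' \<in> K"
begin

text \<open>The boundary of (a, \<open>base j\<close>, \<open>base k\<close>) is the square formed
  by the two routes, except that one edge carries the label
  \<open>base j \<triangleleft> base k\<close>; \<open>same_orbit\<close> restores
  \<open>base j\<close>.\<close>

lemma path_swap:
  assumes "a \<in> Q" "j \<in> {1..r}" "k \<in> {1..r}"
  shows "path (j # k # w) a - path (k # j # w) a \<in> K"
proof -
  have b: "base j \<in> Q" "base k \<in> Q" using base assms by auto
  have ss: "step j (step k a) = step k (step j a)"
    using steps.commute[OF assms(2,3)] by (simp add: fun_eq_iff)
  have "(e (step j a) (base k) - e a (base k)) - (e (step k a) (base j \<triangleleft> base k) - e a (base j)) \<in> K"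
    using boundary_in_bd[OF assms(1) b] bd_K assms(1) by (auto simp: step_op)
  moreover have "e (step k a) (base j \<triangleleft> base k) - e (step k a) (base j) \<in> K"
    by (rule same_orbit) (use b assms step_closed[of k a] in auto)
  ultimately show ?thesis
    using frag_subgroup_add[OF K] by (fastforce simp: ss algebra_simps)
qed

lemma path_move:
  assumes "a \<in> Q" "set (v @ [j]) \<subseteq> {1..r}"
  shows "path (v @ j # w) a - path (j # v @ w) a \<in> K"
  using assms
proof (induction v arbitrary: a)
  case Nil
  then show ?case by (simp add: frag_subgroup_zero[OF K])
next
  case (Cons k v)
  then have jk: "j \<in> {1..r}" "k \<in> {1..r}" by auto
  have 1: "path (v @ j # w) (step k a) - path (j # v @ w) (step k a) \<in> K"
    by (rule Cons.IH) (use Cons.prems step_closed[OF jk(2)] in auto)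
  have 2: "path (k # j # v @ w) a - path (j # k # v @ w) a \<in> K"
    by (rule path_swap) (use Cons.prems jk in auto)
  show ?case using frag_subgroup_add[OF K 1 2] by (simp add: algebra_simps)
qed

text \<open>Sorting by swaps: the first letter of w is moved to the front of v, and the remaining
  words are compared from the next vertex.\<close>

lemma path_mset_cong:
  assumes "a \<in> Q" "set w \<subseteq> {1..r}" "mset w = mset v"
  shows "path w a - path v a \<in> K"
  using assms
proof (induction w arbitrary: a v)
  case Nil
  then show ?case by (simp add: frag_subgroup_zero[OF K])
next
  case (Cons j w)
  then have j: "j \<in> {1..r}" by simp
  have "j \<in> set v" using Cons.prems(3) by (metis list.set_intros(1) set_mset_mset)
  then obtain v1 v2 where v: "v = v1 @ j # v2" by (meson split_list)
  have sv: "set v \<subseteq> {1..r}" using Cons.prems(2,3) by (metis set_mset_mset)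
  have 1: "path w (step j a) - path (v1 @ v2) (step j a) \<in> K"
    by (rule Cons.IH) (use Cons.prems step_closed[OF j] v in auto)
  have 2: "path (v1 @ j # v2) a - path (j # v1 @ v2) a \<in> K"
    by (rule path_move) (use Cons.prems j sv v in auto)
  show ?case using frag_subgroup_diff[OF K 1 2] unfolding v by (simp add: algebra_simps)
qed

text \<open>Closing up every edge along a fixed path from the base point, a chain becomes a difference of
  two loops plus a term depending on its boundary only.\<close>

lemma chain_eq_loops:
  assumes z: "Poly_Mapping.keys z \<subseteq> orbit_pairs i" and i: "i \<in> {1..r}"
    and s: "\<And>a. \<lbrakk>a \<in> Q; idx a = i\<rbrakk> \<Longrightarrow> set (s a) \<subseteq> {1..r} \<and> fold step (s a) (base i) = a"
  defines "\<sigma> \<equiv> frag_extend (\<lambda>xs. path (s (hd xs)) (base i))"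
    and "\<tau> \<equiv> frag_extend (\<lambda>xs. letter_count (s (hd xs)))"
  shows "\<exists>w v. set w \<subseteq> {1..r} \<and> set v \<subseteq> {1..r} \<and> fold step w (base i) = base i \<and> fold step v (base i) = base i \<and>
    z - (path w (base i) - path v (base i) + \<sigma> (d2 z)) \<in> K \<and>
    second_count z = letter_count w - letter_count v + \<tau> (d2 z)"
  using z
proof (induction z rule: frag_induction)
  case zero
  show ?case
    by (intro exI[of _ "[]"]) (simp add: second_count_def \<sigma>_def \<tau>_def frag_subgroup_zero[OF K])
next
  case (one xs)
  then obtain a b where xs: "xs = [a, b]" "a \<in> Q" "b \<in> Q" "idx a = i"
    by (auto simp: orbit_pairs_def elim!: pairsE)
  define j where "j = idx b"
  have j: "j \<in> {1..r}" unfolding j_def by (rule idx_in[OF xs(3)])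
  have ab: "a \<triangleleft> b \<in> Q" "idx (a \<triangleleft> b) = i" using xs by auto
  have bi: "base i \<in> Q" "idx (base i) = i" using base[OF i] by auto
  obtain u where u: "set u \<subseteq> {1..r}" "fold step u (a \<triangleleft> b) = base i"
    using connected[OF ab(1) bi(1)] ab bi by auto
  note sa = s[OF xs(2,4)] and sab = s[OF ab]
  have sj: "step j a = a \<triangleleft> b" unfolding j_def using step_eq xs by blast
  \<comment> \<open>The loop w walks to a, crosses the edge and returns along u; v walks to the end
    of the edge and returns along the same u. The parts along u cancel, and the outgoing parts are
    compensated by \<open>\<sigma>\<close> of the boundary.\<close>
  define w where "w = s a @ j # u"
  define v where "v = s (a \<triangleleft> b) @ u"
  have "path w (base i) - path v (base i) + \<sigma> (d2 (e a b)) = e a (base j)"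
    using sa sab sj by (simp add: w_def v_def path_append rack_boundary_2 \<sigma>_def frag_extend_diff)
  moreover have "e a b - e a (base j) \<in> K"
    by (rule same_orbit) (use xs base[OF j] j_def in auto)
  ultimately have "e a b - (path w (base i) - path v (base i) + \<sigma> (d2 (e a b))) \<in> K" by simp
  moreover have "second_count (e a b) = letter_count w - letter_count v + \<tau> (d2 (e a b))"
    by (simp add: second_count_def w_def v_def rack_boundary_2 \<tau>_def frag_extend_diff j_def)
  moreover have "fold step w (base i) = base i" "fold step v (base i) = base i"
    using sa sab sj u by (simp_all add: w_def v_def)
  moreover have "set w \<subseteq> {1..r}" "set v \<subseteq> {1..r}" using sa sab j u by (auto simp: w_def v_def)
  ultimately show ?case unfolding xs(1) by blast
next
  case (diff x y)
  then obtain w v w' v' where wv: "set w \<subseteq> {1..r}" "set v \<subseteq> {1..r}" "fold step w (base i) = base i"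
      "fold step v (base i) = base i" "set w' \<subseteq> {1..r}" "set v' \<subseteq> {1..r}"
      "fold step w' (base i) = base i" "fold step v' (base i) = base i"
    and x: "x - (path w (base i) - path v (base i) + \<sigma> (d2 x)) \<in> K"
      "second_count x = letter_count w - letter_count v + \<tau> (d2 x)"
    and y: "y - (path w' (base i) - path v' (base i) + \<sigma> (d2 y)) \<in> K"
      "second_count y = letter_count w' - letter_count v' + \<tau> (d2 y)"
    by auto
  have "(x - y) - (path (w @ v') (base i) - path (v @ w') (base i) + \<sigma> (d2 (x - y))) =
      (x - (path w (base i) - path v (base i) + \<sigma> (d2 x))) - (y - (path w' (base i) - path v' (base i) + \<sigma> (d2 y)))"
    using wv by (simp add: path_append rack_boundary_diff \<sigma>_def frag_extend_diff algebra_simps)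
  then have "(x - y) - (path (w @ v') (base i) - path (v @ w') (base i) + \<sigma> (d2 (x - y))) \<in> K"
    using frag_subgroup_diff[OF K x(1) y(1)] by (simp only:)
  moreover have "second_count (x - y) = letter_count (w @ v') - letter_count (v @ w') + \<tau> (d2 (x - y))"
  proof -
    have "second_count (x - y) = second_count x - second_count y" "\<tau> (d2 (x - y)) = \<tau> (d2 x) - \<tau> (d2 y)"
      by (simp_all add: second_count_def rack_boundary_diff \<tau>_def frag_extend_diff)
    then show ?thesis unfolding x(2) y(2) letter_count_simps by simp
  qed
  moreover have "fold step (w @ v') (base i) = base i" "fold step (v @ w') (base i) = base i"
    using wv by simp_all
  moreover have "set (w @ v') \<subseteq> {1..r}" "set (v @ w') \<subseteq> {1..r}" using wv by auto
  ultimately show ?case by blast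
qed

text \<open>For a cycle the boundary terms vanish, leaving two loops with equal letter counts; since
  labels commute modulo K, their paths agree modulo K.\<close>

lemma cycle_without_letters:
  assumes z: "Poly_Mapping.keys z \<subseteq> orbit_pairs i" and i: "i \<in> {1..r}"
    and "d2 z = 0" "second_count z = 0"
  shows "z \<in> K"
proof -
  define s where "s = (\<lambda>a. SOME w. set w \<subseteq> {1..r} \<and> fold step w (base i) = a)"
  have s: "set (s a) \<subseteq> {1..r} \<and> fold step (s a) (base i) = a" if "a \<in> Q" "idx a = i" for a
    unfolding s_def by (rule someI_ex) (use connected[of "base i" a] base[OF i] that in auto)
  obtain w v where wv: "set w \<subseteq> {1..r}" "z - (path w (base i) - path v (base i)) \<in> K"
    "letter_count w = letter_count v"
    using chain_eq_loops[OF z i s] assms(3,4) by auto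
  have "path w (base i) - path v (base i) \<in> K"
    using wv by (intro path_mset_cong) (auto simp: letter_count_eq_iff base[OF i])
  from frag_subgroup_add[OF K wv(2) this] show ?thesis by simp
qed

end

end

section \<open>The torsion part\<close>

lemma (in group_hom) kernel_quotient_mono:
  "\<exists>\<beta>\<in>hom (G Mod kernel G H h) H.
    (\<forall>x\<in>carrier G. \<beta> (kernel G H h #> x) = h x) \<and>
    (\<forall>t\<in>carrier (G Mod kernel G H h). \<beta> t = \<one>\<^bsub>H\<^esub> \<longrightarrow> t = \<one>\<^bsub>G Mod kernel G H h\<^esub>)"
proof -
  obtain \<beta> where \<beta>: "\<beta> \<in> hom (G Mod kernel G H h) H" "\<And>x. x \<in> carrier G \<Longrightarrow> \<beta> (kernel G H h #> x) = h x"
    by (rule FactGroup_universal_kernel[OF normal_kernel subset_refl], rule that)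
  have "t = \<one>\<^bsub>G Mod kernel G H h\<^esub>" if t: "t \<in> carrier (G Mod kernel G H h)" "\<beta> t = \<one>\<^bsub>H\<^esub>" for t
  proof -
    obtain x where x: "x \<in> carrier G" "t = kernel G H h #> x"
      using t(1) by (auto simp: carrier_FactGroup)
    then have "x \<in> kernel G H h" using \<beta>(2)[OF x(1)] t(2) by (simp add: kernel_def)
    then show ?thesis using G.coset_join2[OF x(1) subgroup_kernel] x(2) by simp
  qed
  then show ?thesis using \<beta> by (intro bexI[of _ \<beta>]) auto
qed

lemma (in normal) finite_FactGroup: "finite (carrier G) \<Longrightarrow> finite (carrier (G Mod H))"
  by (simp add: carrier_FactGroup)

lemma comm_group_product_group:
  assumes "\<And>i. i \<in> I \<Longrightarrow> comm_group (G i)"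
  shows "comm_group (product_group I G)"
proof (rule group.group_comm_groupI)
  show "group (product_group I G)" using assms comm_group.axioms(2) by (intro product_group) blast
  fix x y assume "x \<in> carrier (product_group I G)" "y \<in> carrier (product_group I G)"
  then show "x \<otimes>\<^bsub>product_group I G\<^esub> y = y \<otimes>\<^bsub>product_group I G\<^esub> x"
    using assms by (auto simp: fun_eq_iff restrict_def PiE_iff comm_monoid.m_comm[OF comm_group.axioms(1)])
qed

locale parametrized_quandle = ordered_abelian_quandle +
  fixes M :: "nat \<Rightarrow> nat \<Rightarrow> nat \<Rightarrow> int" and f :: "'a \<Rightarrow> nat \<times> (nat \<Rightarrow>\<^sub>0 int) set"
  assumes bij_f: "bij_betw f Q (param_quandle_carrier r M)"
    and f_op: "\<lbrakk>a \<in> Q; b \<in> Q\<rbrakk> \<Longrightarrow> f (a \<triangleleft> b) = param_quandle_op r M (f a) (f b)"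
    and f_Orb: "j \<in> {1..r} \<Longrightarrow> f ` Orb j = {j} \<times> carrier (param_grp r (M j))"
begin

abbreviation G :: "nat \<Rightarrow> (nat \<Rightarrow>\<^sub>0 int) set monoid" where
  "G j \<equiv> param_grp r (M j)"

definition coord :: "'a \<Rightarrow> (nat \<Rightarrow>\<^sub>0 int) set" where
  "coord a = snd (f a)"

definition elt :: "nat \<Rightarrow> (nat \<Rightarrow>\<^sub>0 int) set \<Rightarrow> 'a" where
  "elt j X = inv_into Q f (j, X)"

abbreviation origin :: "nat \<Rightarrow> 'a" where
  "origin j \<equiv> elt j \<one>\<^bsub>G j\<^esub>"

lemma inj_f: "inj_on f Q"
  using bij_f by (rule bij_betw_imp_inj_on)

lemma in_Orb_idx: "a \<in> Q \<Longrightarrow> a \<in> Orb (idx a)"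
  using Orb_eq[OF idx_in] by simp

lemma f_eq: "a \<in> Q \<Longrightarrow> f a = (idx a, coord a)" and coord_in: "a \<in> Q \<Longrightarrow> coord a \<in> carrier (G (idx a))"
proof -
  assume "a \<in> Q"
  then have "f a \<in> {idx a} \<times> carrier (G (idx a))"
    unfolding f_Orb[OF idx_in[OF \<open>a \<in> Q\<close>], symmetric] by (intro imageI in_Orb_idx)
  then show "f a = (idx a, coord a)" "coord a \<in> carrier (G (idx a))" by (auto simp: coord_def)
qed

lemma elt_coord: "a \<in> Q \<Longrightarrow> elt (idx a) (coord a) = a"
  unfolding elt_def using f_eq[of a] inv_into_f_f[OF inj_f] by metis

lemma elt:
  assumes "j \<in> {1..r}" "X \<in> carrier (G j)"
  shows elt_in: "elt j X \<in> Q" and idx_elt: "idx (elt j X) = j" and coord_elt: "coord (elt j X) = X"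
proof -
  have "(j, X) \<in> f ` Orb j" using f_Orb[OF assms(1)] assms(2) by simp
  then obtain a where a: "a \<in> Q" "idx a = j" "f a = (j, X)" using Orb_eq[OF assms(1)] by auto
  then have "elt j X = a" unfolding elt_def using inv_into_f_f[OF inj_f a(1)] by simp
  then show "elt j X \<in> Q" "idx (elt j X) = j" "coord (elt j X) = X" using a by (simp_all add: coord_def)
qed

lemma one_in_G: "\<one>\<^bsub>G j\<^esub> \<in> carrier (G j)"
  using group.is_monoid[OF group_param_grp] by (rule monoid.one_closed)

lemma gen_in_G: "\<lbrakk>i \<in> {1..r}; j \<in> {1..r}\<rbrakk> \<Longrightarrow> param_gen r (M j) (cyc_diff r i j) \<in> carrier (G j)"
  by (rule param_gen_in_carrier) (auto simp: cyc_diff_eq)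

lemma coord_op:
  assumes "a \<in> Q" "b \<in> Q"
  shows "coord (a \<triangleleft> b) = coord a \<otimes>\<^bsub>G (idx a)\<^esub> param_gen r (M (idx a)) (cyc_diff r (idx b) (idx a))"
proof -
  have "f (a \<triangleleft> b) = (idx a, coord a \<otimes>\<^bsub>G (idx a)\<^esub> param_gen r (M (idx a)) (cyc_diff r (idx b) (idx a)))"
    unfolding f_op[OF assms] f_eq[OF assms(1)] f_eq[OF assms(2)] by (simp add: param_quandle_op_def)
  then show ?thesis by (simp add: coord_def)
qed

text \<open>The group element is the product of the generators attached to the letters of w; it
  depends on the orbit but not on the point b.\<close>

lemma coord_fold_step:
  assumes "j \<in> {1..r}" "set w \<subseteq> {1..r}"
  shows "\<exists>W\<in>carrier (G j). \<forall>b\<in>Q. idx b = j \<longrightarrow> coord (fold step w b) = coord b \<otimes>\<^bsub>G j\<^esub> W"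
  using assms(2)
proof (induction w)
  case Nil
  have "coord b = coord b \<otimes>\<^bsub>G j\<^esub> \<one>\<^bsub>G j\<^esub>" if "b \<in> Q" "idx b = j" for b
    using coord_in[OF that(1)] that(2) monoid.r_one[OF group.is_monoid[OF group_param_grp]] by simp
  then show ?case by (intro bexI[OF _ one_in_G]) simp
next
  case (Cons k w)
  then obtain W where W: "W \<in> carrier (G j)"
    "\<And>b. \<lbrakk>b \<in> Q; idx b = j\<rbrakk> \<Longrightarrow> coord (fold step w b) = coord b \<otimes>\<^bsub>G j\<^esub> W" by auto
  have k: "k \<in> {1..r}" using Cons.prems by simp
  define g where "g = param_gen r (M j) (cyc_diff r k j)"
  have g: "g \<in> carrier (G j)" unfolding g_def by (rule gen_in_G[OF k assms(1)])
  interpret G: group "G j" by simp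
  have "coord (fold step w (step k b)) = coord b \<otimes>\<^bsub>G j\<^esub> (g \<otimes>\<^bsub>G j\<^esub> W)" if b: "b \<in> Q" "idx b = j" for b
  proof -
    have "coord (fold step w (step k b)) = coord (step k b) \<otimes>\<^bsub>G j\<^esub> W"
      by (rule W(2)) (use step_closed[OF k b(1)] idx_step[OF k b(1)] b(2) in auto)
    also have "coord (step k b) = coord b \<otimes>\<^bsub>G j\<^esub> g"
      using coord_op[OF b(1), of "base k"] base[OF k] b by (simp add: step_op g_def)
    finally show ?thesis using coord_in[OF b(1)] b(2) W(1) g by (simp add: G.m_assoc)
  qed
  then show ?case using g W(1) by (intro bexI[of _ "g \<otimes>\<^bsub>G j\<^esub> W"]) auto
qed

text \<open>A word from the origin to \<open>elt j Y\<close> exists by transitivity. It multiplies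
  by one fixed element, and its effect on the origin identifies that element as Y.\<close>

lemma translation_word:
  assumes j: "j \<in> {1..r}" and Y: "Y \<in> carrier (G j)"
  shows "\<exists>w. set w \<subseteq> {1..r} \<and> (\<forall>X\<in>carrier (G j). fold step w (elt j X) = elt j (X \<otimes>\<^bsub>G j\<^esub> Y))"
proof -
  interpret G: group "G j" by simp
  note o = elt[OF j one_in_G] and y = elt[OF j Y]
  obtain w where w: "set w \<subseteq> {1..r}" "fold step w (origin j) = elt j Y"
    using connected[OF o(1) y(1)] o y by auto
  obtain W where W: "W \<in> carrier (G j)"
    "\<And>b. \<lbrakk>b \<in> Q; idx b = j\<rbrakk> \<Longrightarrow> coord (fold step w b) = coord b \<otimes>\<^bsub>G j\<^esub> W"
    using coord_fold_step[OF j w(1)] by auto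
  have WY: "W = Y" using W(2)[OF o(1,2)] W(1) unfolding w(2) o(3) y(3) by simp
  have "fold step w (elt j X) = elt j (X \<otimes>\<^bsub>G j\<^esub> Y)" if X: "X \<in> carrier (G j)" for X
  proof -
    note x = elt[OF j X]
    have "elt (idx (fold step w (elt j X))) (coord (fold step w (elt j X))) = fold step w (elt j X)"
      by (rule elt_coord[OF fold_step_closed[OF w(1) x(1)]])
    then show ?thesis unfolding idx_fold_step[OF w(1) x(1)] W(2)[OF x(1,2)] WY x(2,3) by simp
  qed
  with w(1) show ?thesis by blast
qed

text \<open>The map behind the torsion summand: in each orbit the second entry changes from the
  origin to the point with coordinate \<open>g j\<close>, while the first entry stays at
  \<open>base i\<close>. It is additive modulo boundaries.\<close>

definition \<Phi> :: "nat \<Rightarrow> (nat \<Rightarrow> (nat \<Rightarrow>\<^sub>0 int) set) \<Rightarrow> ('a list \<Rightarrow>\<^sub>0 int)" where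
  "\<Phi> i g = (\<Sum>j\<in>{1..r}. e (base i) (elt j (g j)) - e (base i) (origin j))"

lemma parameter_product_in: "\<lbrakk>g \<in> carrier (parameter_product r M); j \<in> {1..r}\<rbrakk> \<Longrightarrow> g j \<in> carrier (G j)"
  by (auto simp: parameter_product_def)

text \<open>A word translating by \<open>h j\<close> takes the origin to \<open>h j\<close> and
  \<open>g j\<close> to the product; by \<open>translation_diff_cong\<close> both changes have the
  same class.\<close>

lemma \<Phi>_mult:
  assumes i: "i \<in> {1..r}" and g: "g \<in> carrier (parameter_product r M)" and h: "h \<in> carrier (parameter_product r M)"
  shows "\<Phi> i (g \<otimes>\<^bsub>parameter_product r M\<^esub> h) - (\<Phi> i g + \<Phi> i h) \<in> bd"
proof -
  have "(e (base i) (elt j (g j \<otimes>\<^bsub>G j\<^esub> h j)) - e (base i) (origin j)) -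
      ((e (base i) (elt j (g j)) - e (base i) (origin j)) + (e (base i) (elt j (h j)) - e (base i) (origin j))) \<in> bd"
    if j: "j \<in> {1..r}" for j
  proof -
    interpret G: group "G j" by simp
    note gj = parameter_product_in[OF g j] and hj = parameter_product_in[OF h j]
    obtain w where w: "set w \<subseteq> {1..r}" "\<And>X. X \<in> carrier (G j) \<Longrightarrow> fold step w (elt j X) = elt j (X \<otimes>\<^bsub>G j\<^esub> h j)"
      using translation_word[OF j hj] by auto
    have w1: "fold step w (origin j) = elt j (h j)" using w(2)[OF one_in_G] hj by simp
    have "(e (base i) (fold step w (elt j (g j))) - e (base i) (elt j (g j))) -
      (e (base i) (fold step w (origin j)) - e (base i) (origin j)) \<in> bd"
      by (rule translation_diff_cong) (use w(1) elt[OF j gj] elt[OF j one_in_G] base[OF i] in auto)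
    then show ?thesis unfolding w(2)[OF gj] w1 by (simp add: algebra_simps)
  qed
  then have "(\<Sum>j\<in>{1..r}. (e (base i) (elt j (g j \<otimes>\<^bsub>G j\<^esub> h j)) - e (base i) (origin j)) -
      ((e (base i) (elt j (g j)) - e (base i) (origin j)) + (e (base i) (elt j (h j)) - e (base i) (origin j)))) \<in> bd"
    by (rule frag_subgroup_sum[OF subgroup_bd])
  moreover have "\<Phi> i (g \<otimes>\<^bsub>parameter_product r M\<^esub> h) =
      (\<Sum>j\<in>{1..r}. e (base i) (elt j (g j \<otimes>\<^bsub>G j\<^esub> h j)) - e (base i) (origin j))"
    unfolding \<Phi>_def by (rule sum.cong) (simp_all add: parameter_product_def)
  ultimately show ?thesis unfolding \<Phi>_def by (simp add: sum.distrib sum_subtractf)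
qed

lemma \<Phi>_in_cyc:
  assumes i: "i \<in> {1..r}" and g: "g \<in> carrier (parameter_product r M)"
  shows "\<Phi> i g \<in> cyc"
  unfolding \<Phi>_def
proof (rule frag_subgroup_sum[OF subgroup_cyc])
  fix j assume j: "j \<in> {1..r}"
  note a = elt[OF j parameter_product_in[OF g j]] and o = elt[OF j one_in_G]
  have "base i \<triangleleft> elt j (g j) = base i \<triangleleft> origin j"
    by (rule op_idx_cong) (use base[OF i] a o in auto)
  then show "e (base i) (elt j (g j)) - e (base i) (origin j) \<in> cyc"
    unfolding cyc_def using base[OF i] a o by (simp add: rack_boundary_diff rack_boundary_2 keys_e_diff)
qed

lemma parameter_relator_in:
  assumes "i \<in> {1..r}" "j \<in> {1..r}"
  shows "parameter_relator r M i j \<in> carrier (parameter_product r M)"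
  unfolding parameter_relator_def parameter_product_def using assms gen_in_G one_in_G
  by (simp add: PiE_iff)

text \<open>In coordinates, the generator of the j-th group that belongs to orbit k is the point
  \<open>origin j \<triangleleft> origin k\<close>, so the two nontrivial components of the relator
  give exactly the sum in \<open>second_diff_antisym\<close>.\<close>

lemma \<Phi>_relator:
  assumes i: "i \<in> {1..r}" and jk: "j \<in> {1..r}" "k \<in> {1..r}" "j \<noteq> k"
  shows "\<Phi> i (parameter_relator r M j k) \<in> bd"
proof -
  have op: "elt j (param_gen r (M j) (cyc_diff r k j)) = origin j \<triangleleft> origin k"
    if jk: "j \<in> {1..r}" "k \<in> {1..r}" for j k
  proof -
    interpret G: group "G j" by simp
    note oj = elt[OF jk(1) one_in_G] and ok = elt[OF jk(2) one_in_G]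
    have "coord (origin j \<triangleleft> origin k) = param_gen r (M j) (cyc_diff r k j)"
      unfolding coord_op[OF oj(1) ok(1)] oj(2,3) ok(2) using gen_in_G[OF jk(2,1)] by simp
    then show ?thesis using elt_coord[of "origin j \<triangleleft> origin k"] oj ok by simp
  qed
  let ?t = "\<lambda>l. e (base i) (elt l (parameter_relator r M j k l)) - e (base i) (origin l)"
  have "\<Phi> i (parameter_relator r M j k) = sum ?t {j, k}"
    unfolding \<Phi>_def
    by (rule sum.mono_neutral_right) (use jk in \<open>auto simp: parameter_relator_def\<close>)
  also have "\<dots> = (e (base i) (origin j \<triangleleft> origin k) - e (base i) (origin j)) +
      (e (base i) (origin k \<triangleleft> origin j) - e (base i) (origin k))"
    using jk op[OF jk(1,2)] op[OF jk(2,1)] by (simp add: parameter_relator_def)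
  also have "\<dots> \<in> bd"
    by (rule second_diff_antisym) (use base[OF i] elt_in[OF jk(1) one_in_G] elt_in[OF jk(2) one_in_G] in auto)
  finally show ?thesis .
qed

section \<open>The second homology group\<close>

abbreviation H where "H \<equiv> rack_homology 2 Q (\<triangleleft>)"

definition cycle_group :: "('a list \<Rightarrow>\<^sub>0 int) monoid" where
  "cycle_group = (free_Abelian_group pairs)\<lparr>carrier := cyc\<rparr>"

definition cls :: "('a list \<Rightarrow>\<^sub>0 int) \<Rightarrow> ('a list \<Rightarrow>\<^sub>0 int) set" where
  "cls z = bd #>\<^bsub>cycle_group\<^esub> z"

lemma H_eq: "H = cycle_group Mod bd"
proof -
  have "kernel (rack_chain Q 2) (rack_chain Q (2 - 1)) d2 = cyc"
    by (auto simp: kernel_def rack_chain_def cyc_def pairs_def)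
  then show ?thesis
    unfolding rack_homology_def cycle_group_def bd_def by (simp add: rack_chain_def pairs_def)
qed

lemma cycle_group_simps [simp]:
  "carrier cycle_group = cyc" "x \<otimes>\<^bsub>cycle_group\<^esub> y = x + y" "\<one>\<^bsub>cycle_group\<^esub> = 0"
  by (simp_all add: cycle_group_def)

lemma comm_group_cycle_group: "comm_group cycle_group"
proof (rule group.group_comm_groupI)
  show "group cycle_group"
    unfolding cycle_group_def by (rule subgroup.subgroup_is_group[OF subgroup_cyc]) simp
qed (simp add: add.commute)

lemma subgroup_bd_cycle_group: "subgroup bd cycle_group"
  unfolding cycle_group_def
  by (rule group.subgroup_incl[OF _ subgroup_bd subgroup_cyc bd_subset_cyc]) simp

lemma normal_bd: "bd \<lhd> cycle_group"
  using comm_group.subgroup_imp_normal[OF comm_group_cycle_group subgroup_bd_cycle_group] .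

lemma comm_group_H: "comm_group H"
  unfolding H_eq by (rule comm_group.abelian_FactGroup[OF comm_group_cycle_group subgroup_bd_cycle_group])

lemma group_H: "group H"
  using comm_group_H by (rule comm_group.axioms(2))

lemma carrier_H: "carrier H = cls ` cyc"
  by (simp add: H_eq carrier_FactGroup cls_def)

lemma cls_in_H: "z \<in> cyc \<Longrightarrow> cls z \<in> carrier H"
  by (simp add: carrier_H)

lemma cls_add: "\<lbrakk>x \<in> cyc; y \<in> cyc\<rbrakk> \<Longrightarrow> cls (x + y) = cls x \<otimes>\<^bsub>H\<^esub> cls y"
  unfolding H_eq cls_def using normal.rcos_sum[OF normal_bd, of x y] by simp

lemma cls_eq_iff:
  assumes "x \<in> cyc" "y \<in> cyc" shows "cls x = cls y \<longleftrightarrow> x - y \<in> bd"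
proof -
  interpret Z: comm_group cycle_group by (rule comm_group_cycle_group)
  have "cls x = cls y \<longleftrightarrow> x \<in> cls y"
    unfolding cls_def using assms Z.rcos_self[OF _ subgroup_bd_cycle_group] Z.repr_independence[OF _ _ subgroup_bd_cycle_group]
    by (metis cycle_group_simps(1))
  also have "\<dots> \<longleftrightarrow> x - y \<in> bd"
    by (auto simp: cls_def r_coset_def intro!: bexI[of _ "x - y"])
  finally show ?thesis .
qed

lemmas cyc_zero = frag_subgroup_zero[OF subgroup_cyc]
  and cyc_add = frag_subgroup_add[OF subgroup_cyc]
  and cyc_diff = frag_subgroup_diff[OF subgroup_cyc]

lemma cls_zero: "cls 0 = \<one>\<^bsub>H\<^esub>"
proof -
  interpret comm_group H by (rule comm_group_H)
  have "cls 0 \<otimes>\<^bsub>H\<^esub> cls 0 = cls 0" using cls_add[OF cyc_zero cyc_zero] by simp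
  then show ?thesis using cls_in_H[OF cyc_zero] by simp
qed

lemma cls_eq_one_iff: "z \<in> cyc \<Longrightarrow> cls z = \<one>\<^bsub>H\<^esub> \<longleftrightarrow> z \<in> bd"
  using cls_eq_iff[OF _ cyc_zero] cls_zero by simp

lemma cls_sum:
  assumes "finite I" "\<And>i. i \<in> I \<Longrightarrow> z i \<in> cyc"
  shows "finprod H (\<lambda>i. cls (z i)) I = cls (\<Sum>i\<in>I. z i)"
proof -
  interpret comm_group H by (rule comm_group_H)
  show ?thesis
    using assms
    by (induction I rule: finite_induct)
      (simp_all add: cls_zero cls_add cls_in_H frag_subgroup_sum[OF subgroup_cyc] Pi_I)
qed

definition relators where
  "relators = generate (parameter_product r M) {parameter_relator r M i j | i j. 1 \<le> i \<and> i < j \<and> j \<le> r}"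

abbreviation P where "P \<equiv> parameter_product r M"

lemma comm_group_P: "comm_group P"
  unfolding parameter_product_def by (rule comm_group_product_group) (rule comm_group_param_grp)

lemma relators_normal: "relators \<lhd> P"
proof -
  interpret comm_group P by (rule comm_group_P)
  show ?thesis
    unfolding relators_def
    by (rule subgroup_imp_normal, rule generate_is_subgroup) (use parameter_relator_in in auto)
qed

text \<open>Additivity of \<open>\<Phi> i\<close> modulo boundaries and its vanishing on the
  relators let its class descend to the parameter group.\<close>

lemma torsion_hom:
  assumes i: "i \<in> {1..r}"
  shows "\<exists>\<phi>\<in>hom (P Mod relators) H. \<forall>g\<in>carrier P. \<phi> (relators #>\<^bsub>P\<^esub> g) = cls (\<Phi> i g)"
proof -
  interpret P: comm_group P by (rule comm_group_P)
  interpret H: comm_group H by (rule comm_group_H)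
  have hom: "(\<lambda>g. cls (\<Phi> i g)) \<in> hom P H"
  proof (rule homI)
    fix g h assume gh: "g \<in> carrier P" "h \<in> carrier P"
    show "cls (\<Phi> i g) \<in> carrier H" by (rule cls_in_H[OF \<Phi>_in_cyc[OF i gh(1)]])
    have "g \<otimes>\<^bsub>P\<^esub> h \<in> carrier P" using gh by simp
    then show "cls (\<Phi> i (g \<otimes>\<^bsub>P\<^esub> h)) = cls (\<Phi> i g) \<otimes>\<^bsub>H\<^esub> cls (\<Phi> i h)"
      using \<Phi>_mult[OF i gh] \<Phi>_in_cyc[OF i] gh
      by (subst cls_add[symmetric]) (simp_all add: cls_eq_iff cyc_add)
  qed
  interpret h: group_hom P H "\<lambda>g. cls (\<Phi> i g)"
    by unfold_locales (rule hom)
  have sub: "relators \<subseteq> kernel P H (\<lambda>g. cls (\<Phi> i g))"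
    unfolding relators_def
  proof (rule P.generate_subgroup_incl[OF _ h.subgroup_kernel])
    show "{parameter_relator r M i j |i j. 1 \<le> i \<and> i < j \<and> j \<le> r} \<subseteq> kernel P H (\<lambda>g. cls (\<Phi> i g))"
    proof clarify
      fix j k assume "1 \<le> j" "j < k" "k \<le> r"
      then have jk: "j \<in> {1..r}" "k \<in> {1..r}" "j \<noteq> k" by auto
      have R: "parameter_relator r M j k \<in> carrier P" by (rule parameter_relator_in[OF jk(1,2)])
      then have "cls (\<Phi> i (parameter_relator r M j k)) = \<one>\<^bsub>H\<^esub>"
        using \<Phi>_relator[OF i jk] cls_eq_one_iff[OF \<Phi>_in_cyc[OF i R]] by simp
      then show "parameter_relator r M j k \<in> kernel P H (\<lambda>g. cls (\<Phi> i g))"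
        using R by (simp add: kernel_def)
    qed
  qed
  obtain \<phi> where "\<phi> \<in> hom (P Mod relators) H" "\<And>g. g \<in> carrier P \<Longrightarrow> \<phi> (relators #>\<^bsub>P\<^esub> g) = cls (\<Phi> i g)"
    by (rule h.FactGroup_universal_kernel[OF relators_normal sub], rule that)
  then show ?thesis by blast
qed

text \<open>Each factor is the image of a finite orbit under f. This is what makes the torsion
  summands finite.\<close>

lemma finite_carrier_P: "finite (carrier P)"
proof -
  have "finite (carrier (G j))" if j: "j \<in> {1..r}" for j
  proof -
    have "carrier (G j) = snd ` f ` Orb j" unfolding f_Orb[OF j] by force
    then show ?thesis using finite_Orb[OF j] by simp
  qed
  then show ?thesis unfolding parameter_product_def by (auto intro!: finite_PiE)
qed

end

section \<open>Splitting off the free part\<close>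

context ordered_abelian_quandle
begin

definition proj :: "nat \<Rightarrow> ('a list \<Rightarrow>\<^sub>0 int) \<Rightarrow> ('a list \<Rightarrow>\<^sub>0 int)" where
  "proj i = frag_extend (\<lambda>xs. if idx (hd xs) = i then frag_of xs else 0)"

lemma proj_frag_of [simp]: "proj i (frag_of (a # xs)) = (if idx a = i then frag_of (a # xs) else 0)"
  by (simp add: proj_def)

lemma proj_zero [simp]: "proj i 0 = 0"
  and proj_diff: "proj i (x - y) = proj i x - proj i y"
  by (simp_all add: proj_def frag_extend_diff)

lemma proj_sum: "finite I \<Longrightarrow> proj i (\<Sum>k\<in>I. x k) = (\<Sum>k\<in>I. proj i (x k))"
  by (simp add: proj_def frag_extend_sum comp_def)

lemma d2_proj: "Poly_Mapping.keys z \<subseteq> pairs \<Longrightarrow> d2 (proj i z) = proj i (d2 z)"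
  by (induction z rule: pair_chain_induct) (simp_all add: proj_diff rack_boundary_diff rack_boundary_2)

text \<open>All four pairs in the boundary of (a, b, c) begin in the orbit of a, so the projection
  keeps or kills that boundary as a whole.\<close>

lemma proj_bd: "x \<in> bd \<Longrightarrow> proj i x \<in> bd"
proof (induction x rule: bd_induct)
  case (triple a b c)
  then show ?case
    using boundary_in_bd[of a b c] by (cases "idx a = i") (simp_all add: proj_diff bd_zero)
qed (simp_all add: proj_diff bd_zero bd_diff)

lemma keys_proj: "Poly_Mapping.keys z \<subseteq> pairs \<Longrightarrow> Poly_Mapping.keys (proj i z) \<subseteq> orbit_pairs i"
  by (induction z rule: pair_chain_induct) (simp_all add: proj_diff keys_diff_subset orbit_pairs_def)

lemma sum_proj: "Poly_Mapping.keys z \<subseteq> pairs \<Longrightarrow> (\<Sum>i\<in>{1..r}. proj i z) = z"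
proof (induction z rule: pair_chain_induct)
  case (pair a b)
  then show ?case using idx_in[OF pair(1)] by simp
qed (simp_all add: proj_diff sum_subtractf)

text \<open>The \<open>r\<^sup>2\<close> pairs of orbits are numbered from \<open>1\<close>, matching the index set of
  the Hermite normal form.\<close>

definition pair_index :: "nat \<Rightarrow> nat \<Rightarrow> nat" where
  "pair_index i j = (i - 1) * r + j"

definition orbit_count :: "('a list \<Rightarrow>\<^sub>0 int) \<Rightarrow> (nat \<Rightarrow>\<^sub>0 int)" where
  "orbit_count = frag_extend (\<lambda>xs. frag_of (pair_index (idx (xs ! 0)) (idx (xs ! 1))))"

text \<open>Reads off row i of the numbering: a pair number in that row becomes the generator of its
  column, any other number becomes 0.\<close>

definition block :: "nat \<Rightarrow> nat \<Rightarrow> (nat \<Rightarrow>\<^sub>0 int)" where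
  "block i n = (if (i - 1) * r < n \<and> n \<le> i * r then frag_of (n - (i - 1) * r) else 0)"

lemma pair_index_in: "\<lbrakk>i \<in> {1..r}; j \<in> {1..r}\<rbrakk> \<Longrightarrow> pair_index i j \<in> {1..<Suc (r\<^sup>2)}"
proof -
  assume ij: "i \<in> {1..r}" "j \<in> {1..r}"
  have "(i - 1) * r + j \<le> (i - 1) * r + r" using ij by simp
  also have "\<dots> = i * r" using ij by (cases i) auto
  also have "\<dots> \<le> r * r" using ij by (intro mult_right_mono) auto
  finally show ?thesis using ij by (simp add: pair_index_def power2_eq_square)
qed

lemma pair_index_surj:
  assumes "n \<in> {1..<Suc (r\<^sup>2)}"
  shows "\<exists>i\<in>{1..r}. \<exists>j\<in>{1..r}. n = pair_index i j"
proof -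
  have n: "1 \<le> n" "n \<le> r * r" using assms by (simp_all add: power2_eq_square)
  then have r: "r > 0" by (cases r) auto
  \<comment> \<open>Rows and columns start at 1, hence division with remainder is applied to n -
    1.\<close>
  define q where "q = (n - 1) div r"
  define s where "s = (n - 1) mod r"
  have "q < r" unfolding q_def using n r by (simp add: less_mult_imp_div_less)
  moreover have "s < r" unfolding s_def using r by simp
  moreover have "n - 1 = q * r + s" by (simp add: q_def s_def)
  ultimately show ?thesis
    using n(1) by (intro bexI[of _ "q + 1"] bexI[of _ "s + 1"]) (auto simp: pair_index_def)
qed

lemma block_pair_index:
  assumes "i \<in> {1..r}" "k \<in> {1..r}" "j \<in> {1..r}"
  shows "block i (pair_index k j) = (if k = i then frag_of j else 0)"
proof -
  have m: "(m - 1) * r + r = m * r" if "m \<in> {1..r}" for m using that by (cases m) auto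
  consider "k = i" | "k < i" | "i < k" by linarith
  then show ?thesis
  proof cases
    case 1
    then show ?thesis using assms m[of i] by (simp add: block_def pair_index_def)
  next
    case 2
    then have "k * r \<le> (i - 1) * r" by (intro mult_right_mono) auto
    moreover have "pair_index k j \<le> (k - 1) * r + r" using assms(3) by (simp add: pair_index_def)
    ultimately have "pair_index k j \<le> (i - 1) * r" unfolding m[OF assms(2)] by (rule order_trans[rotated])
    then show ?thesis using 2 by (simp add: block_def)
  next
    case 3
    then have "i * r \<le> (k - 1) * r" by (intro mult_right_mono) auto
    moreover have "(k - 1) * r < pair_index k j" using assms(3) by (simp add: pair_index_def)
    ultimately have "i * r < pair_index k j" by (rule le_less_trans)
    then show ?thesis using 3 by (simp add: block_def)
  qed
qed

lemma orbit_count_zero [simp]: "orbit_count 0 = 0"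
  and orbit_count_add: "orbit_count (x + y) = orbit_count x + orbit_count y"
  and orbit_count_diff: "orbit_count (x - y) = orbit_count x - orbit_count y"
  and orbit_count_pair [simp]: "orbit_count (e a b) = frag_of (pair_index (idx a) (idx b))"
  by (simp_all add: orbit_count_def frag_extend_diff frag_extend_add)

lemma keys_orbit_count: "Poly_Mapping.keys z \<subseteq> pairs \<Longrightarrow> Poly_Mapping.keys (orbit_count z) \<subseteq> {1..<Suc (r\<^sup>2)}"
proof (induction z rule: pair_chain_induct)
  case (pair a b)
  then show ?case using pair_index_in[OF idx_in[OF pair(1)] idx_in[OF pair(2)]] by (simp del: One_nat_def)
next
  case (diff x y)
  then show ?case by (simp only: orbit_count_diff keys_diff_subset)
qed simp

text \<open>Translation preserves orbits, so the four terms cancel in pairs; counting is therefore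
  well defined on homology classes.\<close>

lemma orbit_count_bd: "x \<in> bd \<Longrightarrow> orbit_count x = 0"
  by (induction x rule: bd_induct) (simp_all add: orbit_count_diff)

lemma second_count_proj:
  assumes "i \<in> {1..r}" "Poly_Mapping.keys z \<subseteq> pairs"
  shows "second_count (proj i z) = frag_extend (block i) (orbit_count z)"
  using assms(2)
proof (induction z rule: pair_chain_induct)
  case (pair a b)
  then show ?case
    using block_pair_index[OF assms(1) idx_in[OF pair(1)] idx_in[OF pair(2)]] by (simp add: second_count_def)
next
  case (diff x y)
  then show ?case
    by (simp add: orbit_count_diff proj_diff frag_extend_diff second_count_def)
qed (simp add: second_count_def)

text \<open>Repeating label j from \<open>base i\<close> closes up after N steps; the resulting loop
  is a cycle that counts the pair (i, j) exactly N times. The count lattice thus has full rank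
  r^2.\<close>

lemma orbit_count_torsion:
  assumes "n \<in> {1..<Suc (r\<^sup>2)}"
  shows "\<exists>N>0. frag_cmul N (frag_of n) \<in> orbit_count ` cyc"
proof -
  obtain i j where ij: "i \<in> {1..r}" "j \<in> {1..r}" "n = pair_index i j"
    using pair_index_surj[OF assms] by blast
  have p: "base i \<in> Q" "idx (base i) = i" using base[OF ij(1)] by auto
  obtain N where N: "N > 0" "(step j ^^ N) (base i) = base i"
    using funpow_returns[OF finite_Q steps.inj[OF ij(2)] step_closed[OF ij(2)] p(1)] by blast
  have fold: "fold step (replicate N j) = step j ^^ N"
    using fold_concat_replicate[of step N "[j]"] by simp
  have "orbit_count (path (replicate m j) a) = frag_cmul (int m) (frag_of (pair_index (idx a) j))" if "a \<in> Q" for a m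
    using that
  proof (induction m arbitrary: a)
    case (Suc m)
    then show ?case
      using base[OF ij(2)] step_closed[OF ij(2) Suc.prems] idx_step[OF ij(2) Suc.prems]
      by (simp add: orbit_count_add frag_cmul_distrib)
  qed simp
  then have "frag_cmul (int N) (frag_of n) = orbit_count (path (replicate N j) (base i))" using p ij(3) by simp
  moreover have "path (replicate N j) (base i) \<in> cyc"
    using keys_path[of "replicate N j" "base i"] d2_path[of "replicate N j" "base i"] p ij(2) N
    by (simp add: cyc_def fold)
  ultimately show ?thesis using N(1) by (intro exI[of _ "int N"]) auto
qed

lemma subgroup_orbit_count_cyc: "subgroup (orbit_count ` cyc) (free_Abelian_group {1..<Suc (r\<^sup>2)})"
proof (rule frag_subgroupI)
  show "Poly_Mapping.keys x \<subseteq> {1..<Suc (r\<^sup>2)}" if "x \<in> orbit_count ` cyc" for x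
    using that keys_orbit_count by (auto simp: cyc_def simp del: One_nat_def)
  show "0 \<in> orbit_count ` cyc"
    using frag_subgroup_zero[OF subgroup_cyc] by (intro image_eqI[of _ _ 0]) simp_all
  fix x y assume "x \<in> orbit_count ` cyc" "y \<in> orbit_count ` cyc"
  then obtain u v where "u \<in> cyc" "v \<in> cyc" "x = orbit_count u" "y = orbit_count v" by blast
  then show "x - y \<in> orbit_count ` cyc"
    using frag_subgroup_diff[OF subgroup_cyc, of u v] by (intro image_eqI[of _ _ "u - v"]) (simp_all add: orbit_count_diff)
qed

end

section \<open>Torsion summands as abstract groups embedded in homology\<close>

locale torsion_model = parametrized_quandle +
  fixes T :: "nat \<Rightarrow> 'b monoid" and \<beta> :: "nat \<Rightarrow> 'b \<Rightarrow> ('a list \<Rightarrow>\<^sub>0 int) set"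
  assumes group_T: "i \<in> {1..r} \<Longrightarrow> group (T i)"
    and \<beta>_hom: "i \<in> {1..r} \<Longrightarrow> \<beta> i \<in> hom (T i) H"
    and \<beta>_mono: "\<lbrakk>i \<in> {1..r}; t \<in> carrier (T i); \<beta> i t = \<one>\<^bsub>H\<^esub>\<rbrakk> \<Longrightarrow> t = \<one>\<^bsub>T i\<^esub>"
    and \<beta>_range: "\<lbrakk>i \<in> {1..r}; t \<in> carrier (T i)\<rbrakk> \<Longrightarrow> \<exists>g\<in>carrier P. \<beta> i t = cls (\<Phi> i g)"
    and \<beta>_onto: "\<lbrakk>i \<in> {1..r}; g \<in> carrier P\<rbrakk> \<Longrightarrow> \<exists>t\<in>carrier (T i). \<beta> i t = cls (\<Phi> i g)"
begin

abbreviation S where "S \<equiv> sum_group {1..r} T"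

text \<open>Combines the embeddings of the summands. By the locale assumptions
  \<open>\<beta> i\<close> is an injective homomorphism onto the classes of \<open>\<Phi> i\<close>,
  whatever model of the summand is supplied.\<close>

definition \<Psi> :: "(nat \<Rightarrow> 'b) \<Rightarrow> ('a list \<Rightarrow>\<^sub>0 int) set" where
  "\<Psi> t = finprod H (\<lambda>i. \<beta> i (t i)) {1..r}"

lemma carrier_S: "carrier S = (\<Pi>\<^sub>E i\<in>{1..r}. carrier (T i))"
  using group_T by (subst carrier_sum_group) auto

lemma component_in: "\<lbrakk>t \<in> carrier S; i \<in> {1..r}\<rbrakk> \<Longrightarrow> t i \<in> carrier (T i)"
  unfolding carrier_S by (rule PiE_mem)

lemma group_S: "group S"
  using group_T by (rule sum_group)

lemma \<beta>_in_H: "\<lbrakk>i \<in> {1..r}; t \<in> carrier (T i)\<rbrakk> \<Longrightarrow> \<beta> i t \<in> carrier H"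
  using hom_in_carrier[OF \<beta>_hom] .

lemma \<Psi>_hom: "\<Psi> \<in> hom S H"
proof -
  interpret comm_group H by (rule comm_group_H)
  have 1: "(\<lambda>x. gfinprod H (\<lambda>i. \<beta> i (x i)) {1..r}) \<in> hom S H"
    by (rule hom_group_sum[OF \<beta>_hom group_T])
  have 2: "gfinprod H (\<lambda>i. \<beta> i (t i)) {1..r} = \<Psi> t" if "t \<in> carrier S" for t
    unfolding \<Psi>_def by (rule gfinprod_eq_finprod, simp) (rule Pi_I, rule \<beta>_in_H, assumption, rule component_in[OF that])
  show ?thesis
  proof (rule homI)
    fix x y assume xy: "x \<in> carrier S" "y \<in> carrier S"
    then have "x \<otimes>\<^bsub>S\<^esub> y \<in> carrier S" using group.is_monoid[OF group_S] by (simp only: monoid.m_closed)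
    then show "\<Psi> (x \<otimes>\<^bsub>S\<^esub> y) = \<Psi> x \<otimes>\<^bsub>H\<^esub> \<Psi> y"
      using hom_mult[OF 1 xy] 2 xy by metis
    show "\<Psi> x \<in> carrier H" using hom_in_carrier[OF 1 xy(1)] 2[OF xy(1)] by simp
  qed
qed

lemma \<Psi>_eq_cls:
  assumes "\<And>i. i \<in> {1..r} \<Longrightarrow> g i \<in> carrier P" "\<And>i. i \<in> {1..r} \<Longrightarrow> \<beta> i (t i) = cls (\<Phi> i (g i))"
  shows "\<Psi> t = cls (\<Sum>i\<in>{1..r}. \<Phi> i (g i))"
proof -
  interpret comm_group H by (rule comm_group_H)
  have "\<Psi> t = finprod H (\<lambda>i. cls (\<Phi> i (g i))) {1..r}"
    unfolding \<Psi>_def by (rule finprod_cong) (use assms \<Phi>_in_cyc cls_in_H in \<open>auto simp: simp_implies_def\<close>)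
  also have "\<dots> = cls (\<Sum>i\<in>{1..r}. \<Phi> i (g i))"
    by (rule cls_sum) (use assms \<Phi>_in_cyc in auto)
  finally show ?thesis .
qed

lemma \<Psi>_obtain:
  assumes "t \<in> carrier S"
  obtains g where "\<And>i. i \<in> {1..r} \<Longrightarrow> g i \<in> carrier P" "\<And>i. i \<in> {1..r} \<Longrightarrow> \<beta> i (t i) = cls (\<Phi> i (g i))"
    "\<Psi> t = cls (\<Sum>i\<in>{1..r}. \<Phi> i (g i))"
proof -
  have "\<forall>i\<in>{1..r}. \<exists>g. g \<in> carrier P \<and> \<beta> i (t i) = cls (\<Phi> i g)"
    using \<beta>_range component_in[OF assms] by blast
  then obtain g where g: "\<forall>i\<in>{1..r}. g i \<in> carrier P \<and> \<beta> i (t i) = cls (\<Phi> i (g i))"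
    by (rule bchoice[THEN exE])
  show thesis
    by (rule that[of g]) (use g \<Psi>_eq_cls[of g t] in auto)
qed

lemma sum_\<Phi>_in_cyc: "(\<And>i. i \<in> {1..r} \<Longrightarrow> g i \<in> carrier P) \<Longrightarrow> (\<Sum>i\<in>{1..r}. \<Phi> i (g i)) \<in> cyc"
  by (rule frag_subgroup_sum[OF subgroup_cyc]) (rule \<Phi>_in_cyc)

lemma proj_\<Phi>:
  assumes "i \<in> {1..r}"
  shows "proj k (\<Phi> i g) = (if k = i then \<Phi> i g else 0)"
  unfolding \<Phi>_def using base[OF assms] by (simp add: proj_sum proj_diff)

text \<open>Chains \<open>\<Phi> i g\<close> begin in orbit i, so projecting to orbit k isolates one
  summand of a boundary and keeps it a boundary; injectivity of \<open>\<beta> k\<close> then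
  applies.\<close>

lemma \<Psi>_mono:
  assumes t: "t \<in> carrier S" and 1: "\<Psi> t = \<one>\<^bsub>H\<^esub>"
  shows "t = \<one>\<^bsub>S\<^esub>"
proof -
  obtain g where g: "\<And>i. i \<in> {1..r} \<Longrightarrow> g i \<in> carrier P" "\<And>i. i \<in> {1..r} \<Longrightarrow> \<beta> i (t i) = cls (\<Phi> i (g i))"
    "\<Psi> t = cls (\<Sum>i\<in>{1..r}. \<Phi> i (g i))"
    by (rule \<Psi>_obtain[OF t], rule that)
  have "(\<Sum>i\<in>{1..r}. \<Phi> i (g i)) \<in> bd"
    using cls_eq_one_iff[OF sum_\<Phi>_in_cyc[of g]] g(1) 1 g(3) by simp
  then have "\<Phi> k (g k) \<in> bd" if k: "k \<in> {1..r}" for k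
  proof -
    have "proj k (\<Sum>i\<in>{1..r}. \<Phi> i (g i)) = (\<Sum>i\<in>{1..r}. if k = i then \<Phi> i (g i) else 0)"
      by (subst proj_sum) (auto intro!: sum.cong simp: proj_\<Phi>)
    also have "\<dots> = \<Phi> k (g k)" using k by simp
    finally show ?thesis using proj_bd[OF \<open>(\<Sum>i\<in>{1..r}. \<Phi> i (g i)) \<in> bd\<close>, of k] by simp
  qed
  then have \<beta>1: "\<beta> k (t k) = \<one>\<^bsub>H\<^esub>" if k: "k \<in> {1..r}" for k
    using g(2)[OF k] cls_eq_one_iff[OF \<Phi>_in_cyc[OF k g(1)[OF k]]] k by simp
  show ?thesis
  proof (rule extensionalityI)
    show "t \<in> extensional {1..r}" using t unfolding carrier_S PiE_def by blast
    show "\<one>\<^bsub>S\<^esub> \<in> extensional {1..r}" by simp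
    fix k assume k: "k \<in> {1..r}"
    have "t k = \<one>\<^bsub>T k\<^esub>" by (rule \<beta>_mono[OF k component_in[OF t k] \<beta>1[OF k]])
    then show "t k = \<one>\<^bsub>S\<^esub> k" using k by simp
  qed
qed

text \<open>The preimage of the torsion part among the cycles; it plays the role of K in the results
  on commuting labels.\<close>

definition torsion_cycles :: "('a list \<Rightarrow>\<^sub>0 int) set" where
  "torsion_cycles = {z \<in> cyc. cls z \<in> \<Psi> ` carrier S}"

lemma subgroup_torsion_cycles: "subgroup torsion_cycles (free_Abelian_group pairs)"
proof -
  interpret H: comm_group H by (rule comm_group_H)
  interpret h: group_hom S H \<Psi>
    using \<Psi>_hom group_S by (simp add: group_hom_def group_hom_axioms_def group_H)
  note img = h.img_is_subgroup
  show ?thesis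
  proof (rule frag_subgroupI)
    show "Poly_Mapping.keys x \<subseteq> pairs" if "x \<in> torsion_cycles" for x
      using that by (simp add: torsion_cycles_def cyc_def)
    show "0 \<in> torsion_cycles"
      using subgroup.one_closed[OF img] by (simp add: torsion_cycles_def cyc_zero cls_zero)
    fix x y assume "x \<in> torsion_cycles" "y \<in> torsion_cycles"
    then have xy: "x \<in> cyc" "y \<in> cyc" "cls x \<in> \<Psi> ` carrier S" "cls y \<in> \<Psi> ` carrier S"
      by (simp_all add: torsion_cycles_def)
    have "cls (x - y) \<otimes>\<^bsub>H\<^esub> cls y = cls x"
      using cls_add[OF cyc_diff[OF xy(1,2)] xy(2)] by simp
    then have "cls (x - y) = cls x \<otimes>\<^bsub>H\<^esub> inv\<^bsub>H\<^esub> (cls y)"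
      using H.inv_solve_right[OF cls_in_H[OF cyc_diff[OF xy(1,2)]] cls_in_H[OF xy(1)] cls_in_H[OF xy(2)]] by simp
    then show "x - y \<in> torsion_cycles"
      using subgroup.m_closed[OF img xy(3) subgroup.m_inv_closed[OF img xy(4)]] cyc_diff[OF xy(1,2)]
      by (simp add: torsion_cycles_def)
  qed
qed

lemma bd_torsion_cycles: "bd \<subseteq> torsion_cycles"
proof
  interpret h: group_hom S H \<Psi>
    using \<Psi>_hom group_S by (simp add: group_hom_def group_hom_axioms_def group_H)
  fix x assume x: "x \<in> bd"
  then have "cls x = \<one>\<^bsub>H\<^esub>" using cls_eq_one_iff bd_subset_cyc by blast
  then show "x \<in> torsion_cycles"
    using x bd_subset_cyc subgroup.one_closed[OF h.img_is_subgroup] by (auto simp: torsion_cycles_def)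
qed

lemma \<Phi>_torsion_cycles:
  assumes i: "i \<in> {1..r}" and g: "g \<in> carrier P"
  shows "\<Phi> i g \<in> torsion_cycles"
proof -
  interpret H: comm_group H by (rule comm_group_H)
  obtain u where u: "u \<in> carrier (T i)" "\<beta> i u = cls (\<Phi> i g)" using \<beta>_onto[OF i g] by blast
  define t where "t = (\<lambda>k\<in>{1..r}. if k = i then u else \<one>\<^bsub>T k\<^esub>)"
  have t: "t \<in> carrier S"
    unfolding carrier_S t_def
    using u(1) monoid.one_closed[OF group.is_monoid[OF group_T]] by (intro restrict_PiE_iff[THEN iffD2] ballI) simp
  have \<beta>t: "\<beta> k (t k) = (if i = k then cls (\<Phi> i g) else \<one>\<^bsub>H\<^esub>)" if k: "k \<in> {1..r}" for k
    using k u(2) hom_one[OF \<beta>_hom[OF k] group_T[OF k] group_H] by (auto simp: t_def)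
  have "\<Psi> t = finprod H (\<lambda>k. if i = k then cls (\<Phi> i g) else \<one>\<^bsub>H\<^esub>) {1..r}"
    unfolding \<Psi>_def
    by (rule H.finprod_cong) (use \<beta>t cls_in_H[OF \<Phi>_in_cyc[OF i g]] in \<open>auto simp: simp_implies_def\<close>)
  also have "\<dots> = cls (\<Phi> i g)"
    by (rule H.finprod_singleton[OF i]) (use cls_in_H[OF \<Phi>_in_cyc[OF i g]] in auto)
  finally have "cls (\<Phi> i g) \<in> \<Psi> ` carrier S" using t by (metis imageI)
  then show ?thesis using \<Phi>_in_cyc[OF i g] by (simp add: torsion_cycles_def)
qed

text \<open>A word from the origin of the orbit to c changes the second entry by the same class at a
  and at \<open>base i\<close>; at \<open>base i\<close> this change is \<open>\<Phi> i g\<close>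
  with g concentrated in one coordinate.\<close>

lemma same_orbit_torsion_cycles:
  assumes "a \<in> Q" "b \<in> Q" "b' \<in> Q" "idx b = idx b'"
  shows "e a b - e a b' \<in> torsion_cycles"
proof -
  define i where "i = idx a"
  have i: "i \<in> {1..r}" unfolding i_def by (rule idx_in[OF assms(1)])
  define j where "j = idx b"
  have j: "j \<in> {1..r}" unfolding j_def by (rule idx_in[OF assms(2)])
  note o = elt[OF j one_in_G]
  have "e a c - e a (origin j) \<in> torsion_cycles" if c: "c \<in> Q" "idx c = j" for c
  proof -
    obtain w where w: "set w \<subseteq> {1..r}" "fold step w (origin j) = c" using connected[OF o(1) c(1)] o c by auto
    define g where "g = (\<lambda>k\<in>{1..r}. if k = j then coord c else \<one>\<^bsub>G k\<^esub>)"
    have g: "g \<in> carrier P"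
      unfolding g_def parameter_product_def using coord_in[OF c(1)] c(2) one_in_G by (simp add: PiE_iff)
    have ec: "elt j (coord c) = c" using elt_coord[OF c(1)] c(2) by simp
    have "\<Phi> i g = (\<Sum>k\<in>{j}. e (base i) (elt k (g k)) - e (base i) (origin k))"
      unfolding \<Phi>_def by (rule sum.mono_neutral_right) (use j in \<open>auto simp: g_def\<close>)
    also have "\<dots> = e (base i) c - e (base i) (origin j)" using j by (simp add: g_def ec)
    finally have \<Phi>: "\<Phi> i g = e (base i) c - e (base i) (origin j)" .
    have "(e a (fold step w (origin j)) - e a (origin j)) -
        (e (base i) (fold step w (origin j)) - e (base i) (origin j)) \<in> bd"
      by (rule translation_diff_cong) (use assms base[OF i] o w i_def in auto)
    then have "(e a c - e a (origin j)) - \<Phi> i g \<in> torsion_cycles"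
      unfolding w(2) \<Phi> using bd_torsion_cycles by blast
    from frag_subgroup_add[OF subgroup_torsion_cycles this \<Phi>_torsion_cycles[OF i g]] show ?thesis by simp
  qed
  from frag_subgroup_diff[OF subgroup_torsion_cycles
      this[OF assms(2) j_def[symmetric]] this[OF assms(3) trans[OF assms(4)[symmetric] j_def[symmetric]]]]
  show ?thesis by simp
qed

text \<open>Boundaries and all \<open>\<Phi> i g\<close> have zero count. Conversely, zero count
  makes each projection to one first orbit a cycle without letters. Hence counting embeds homology
  modulo its torsion part in a free group.\<close>

lemma torsion_cycles_iff:
  assumes "z \<in> cyc"
  shows "z \<in> torsion_cycles \<longleftrightarrow> orbit_count z = 0"
proof
  assume "z \<in> torsion_cycles"
  then obtain t where t: "t \<in> carrier S" "cls z = \<Psi> t" by (auto simp: torsion_cycles_def)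
  obtain g where g: "\<And>i. i \<in> {1..r} \<Longrightarrow> g i \<in> carrier P" "\<And>i. i \<in> {1..r} \<Longrightarrow> \<beta> i (t i) = cls (\<Phi> i (g i))"
    "\<Psi> t = cls (\<Sum>i\<in>{1..r}. \<Phi> i (g i))"
    by (rule \<Psi>_obtain[OF t(1)], rule that)
  have "orbit_count (\<Phi> i (g i)) = 0" if i: "i \<in> {1..r}" for i
    unfolding \<Phi>_def orbit_count_def using elt[OF _ parameter_product_in[OF g(1)[OF i]]] elt[OF _ one_in_G]
    by (subst frag_extend_sum) (auto simp: frag_extend_diff intro!: sum.neutral)
  then have 0: "orbit_count (\<Sum>i\<in>{1..r}. \<Phi> i (g i)) = 0"
    unfolding orbit_count_def by (subst frag_extend_sum) (auto intro!: sum.neutral)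
  have "z - (\<Sum>i\<in>{1..r}. \<Phi> i (g i)) \<in> bd"
    using cls_eq_iff[OF assms sum_\<Phi>_in_cyc[of g]] g(1) t(2) g(3) by simp
  from orbit_count_bd[OF this] show "orbit_count z = 0" using 0 by (simp add: orbit_count_diff)
next
  assume 0: "orbit_count z = 0"
  have z: "Poly_Mapping.keys z \<subseteq> pairs" "d2 z = 0" using assms by (simp_all add: cyc_def)
  have "proj i z \<in> torsion_cycles" if i: "i \<in> {1..r}" for i
    by (rule cycle_without_letters[OF subgroup_torsion_cycles bd_torsion_cycles same_orbit_torsion_cycles
          keys_proj[OF z(1)] i])
      (simp_all add: d2_proj[OF z(1)] z(2) second_count_proj[OF i z(1)] 0)
  then have "(\<Sum>i\<in>{1..r}. proj i z) \<in> torsion_cycles"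
    by (rule frag_subgroup_sum[OF subgroup_torsion_cycles])
  then show "z \<in> torsion_cycles" by (simp only: sum_proj[OF z(1)])
qed

text \<open>The count lattice has a basis of r^2 triangular rows. Choosing a cycle over each row
  gives a section of the counting map, which splits homology into a free part and the image of
  \<open>\<Psi>\<close>.\<close>

proposition second_homology_iso: "H \<cong> sum_group {1..r^2} (\<lambda>_. integer_group) \<times>\<times> sum_group {1..r} T"
proof -
  interpret H: comm_group H by (rule comm_group_H)
  interpret S: group S by (rule group_S)
  define F where "F = free_Abelian_group {1..<Suc (r\<^sup>2)}"
  have tors: "\<exists>N>0. frag_cmul N (frag_of k) \<in> orbit_count ` cyc" if "1 \<le> k" "k < Suc (r\<^sup>2)" for k
    using orbit_count_torsion[of k] that by simp
  \<comment> \<open>\<open>param_collection n\<close> describes n - 1 generators, so r^2 pairs of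
    orbits require the argument \<open>Suc (r\<^sup>2)\<close>.\<close>
  obtain m where m: "param_collection (Suc (r\<^sup>2)) m" "param_relations (Suc (r\<^sup>2)) m = orbit_count ` cyc"
    using param_collection_exists[OF subgroup_orbit_count_cyc tors] by auto
  have "\<forall>n\<in>{1..<Suc (r\<^sup>2)}. \<exists>z. z \<in> cyc \<and> orbit_count z = hnf_row m n"
    using hnf_row_in_param_relations[of _ "Suc (r\<^sup>2)" m] unfolding m(2) by (metis imageE)
  then obtain \<zeta> where \<zeta>: "\<forall>n\<in>{1..<Suc (r\<^sup>2)}. \<zeta> n \<in> cyc \<and> orbit_count (\<zeta> n) = hnf_row m n"
    by (rule bchoice[THEN exE])
  define lift where "lift = frag_extend \<zeta>"
  have lift_in: "lift c \<in> cyc" if "Poly_Mapping.keys c \<subseteq> {1..<Suc (r\<^sup>2)}" for c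
    unfolding lift_def using \<zeta> by (intro frag_subgroup_extend[OF subgroup_cyc that]) blast
  have count_lift: "orbit_count (lift c) = frag_extend (hnf_row m) c" if "Poly_Mapping.keys c \<subseteq> {1..<Suc (r\<^sup>2)}" for c
    using that
  proof (induction c rule: frag_induction)
    case (one n)
    then show ?case using \<zeta> by (simp only: lift_def frag_extend_of)
  next
    case (diff x y)
    then show ?case by (simp add: lift_def frag_extend_diff orbit_count_diff)
  qed (simp add: lift_def)
  define \<Theta> where "\<Theta> = (\<lambda>(c, t). cls (lift c) \<otimes>\<^bsub>H\<^esub> \<Psi> t)"
  have \<Psi>_in: "\<Psi> t \<in> carrier H" if "t \<in> carrier S" for t using hom_in_carrier[OF \<Psi>_hom that] .
  have hom: "\<Theta> \<in> hom (F \<times>\<times> S) H"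
  proof (rule homI)
    fix x assume "x \<in> carrier (F \<times>\<times> S)"
    then show "\<Theta> x \<in> carrier H"
      using lift_in cls_in_H \<Psi>_in by (auto simp: F_def \<Theta>_def simp del: One_nat_def)
  next
    fix x y assume "x \<in> carrier (F \<times>\<times> S)" "y \<in> carrier (F \<times>\<times> S)"
    then obtain c s d t where xy: "x = (c, s)" "y = (d, t)"
      "Poly_Mapping.keys c \<subseteq> {1..<Suc (r\<^sup>2)}" "s \<in> carrier S"
      "Poly_Mapping.keys d \<subseteq> {1..<Suc (r\<^sup>2)}" "t \<in> carrier S"
      unfolding F_def by (auto simp del: One_nat_def)
    have 1: "cls (lift (c + d)) = cls (lift c) \<otimes>\<^bsub>H\<^esub> cls (lift d)"
      unfolding lift_def frag_extend_add using cls_add lift_in[OF xy(3)] lift_in[OF xy(5)] by (simp add: lift_def)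
    have 2: "\<Psi> (s \<otimes>\<^bsub>S\<^esub> t) = \<Psi> s \<otimes>\<^bsub>H\<^esub> \<Psi> t" by (rule hom_mult[OF \<Psi>_hom xy(4,6)])
    have 3: "(c, s) \<otimes>\<^bsub>F \<times>\<times> S\<^esub> (d, t) = (c + d, s \<otimes>\<^bsub>S\<^esub> t)" by (simp add: F_def)
    show "\<Theta> (x \<otimes>\<^bsub>F \<times>\<times> S\<^esub> y) = \<Theta> x \<otimes>\<^bsub>H\<^esub> \<Theta> y"
      unfolding xy(1,2) 3 unfolding \<Theta>_def prod.case 1 2
      using cls_in_H[OF lift_in[OF xy(3)]] cls_in_H[OF lift_in[OF xy(5)]] \<Psi>_in[OF xy(4)] \<Psi>_in[OF xy(6)]
      by (simp only: H.m_ac H.m_closed)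
  qed
  have gFS: "group (F \<times>\<times> S)" unfolding F_def by (rule DirProd_group[OF group_free_Abelian_group group_S])
  \<comment> \<open>Counting kills boundaries and the torsion part, so independence of the rows
    gives c = 0; what remains is injectivity of \<open>\<Psi>\<close>.\<close>
  have ker: "c = 0 \<and> t = \<one>\<^bsub>S\<^esub>"
    if c: "Poly_Mapping.keys c \<subseteq> {1..<Suc (r\<^sup>2)}" and t: "t \<in> carrier S" and 1: "\<Theta> (c, t) = \<one>\<^bsub>H\<^esub>" for c t
  proof -
    obtain g where g: "\<And>i. i \<in> {1..r} \<Longrightarrow> g i \<in> carrier P" "\<And>i. i \<in> {1..r} \<Longrightarrow> \<beta> i (t i) = cls (\<Phi> i (g i))"
      "\<Psi> t = cls (\<Sum>i\<in>{1..r}. \<Phi> i (g i))"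
      by (rule \<Psi>_obtain[OF t], rule that)
    define k where "k = (\<Sum>i\<in>{1..r}. \<Phi> i (g i))"
    have k: "k \<in> cyc" unfolding k_def by (rule sum_\<Phi>_in_cyc[OF g(1)])
    have \<Psi>k: "\<Psi> t = cls k" unfolding k_def by (rule g(3))
    have "k \<in> torsion_cycles" unfolding torsion_cycles_def using k \<Psi>k t by auto
    then have k0: "orbit_count k = 0" using torsion_cycles_iff[OF k] by simp
    have "cls (lift c + k) = \<one>\<^bsub>H\<^esub>" using 1 unfolding \<Theta>_def prod.case \<Psi>k cls_add[OF lift_in[OF c] k] .
    then have "lift c + k \<in> bd" using cls_eq_one_iff[OF cyc_add[OF lift_in[OF c] k]] by simp
    from orbit_count_bd[OF this] have "frag_extend (hnf_row m) c = 0"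
      by (simp add: orbit_count_add k0 count_lift[OF c])
    then have "c = 0"
      using hnf_leading_coefficient(1)[OF c, of m] param_collection_diag[OF m(1)] by blast
    moreover have "\<Psi> t = \<one>\<^bsub>H\<^esub>"
      using 1 \<Psi>_in[OF t] \<open>c = 0\<close> by (simp add: \<Theta>_def lift_def cls_zero)
    ultimately show ?thesis using \<Psi>_mono[OF t] by simp
  qed
  have "\<Theta> \<in> iso (F \<times>\<times> S) H"
    unfolding iso_kernel_image[OF gFS group_H]
  proof (intro conjI hom)
    have "\<Theta> (0, \<one>\<^bsub>S\<^esub>) = \<one>\<^bsub>H\<^esub>"
      using hom_one[OF \<Psi>_hom group_S group_H] by (simp add: \<Theta>_def lift_def cls_zero del: one_sum_group)
    then show "kernel (F \<times>\<times> S) H \<Theta> = {\<one>\<^bsub>F \<times>\<times> S\<^esub>}"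
      using ker unfolding kernel_def F_def by (auto simp del: One_nat_def one_sum_group)
    show "\<Theta> ` carrier (F \<times>\<times> S) = carrier H"
    proof
      show "\<Theta> ` carrier (F \<times>\<times> S) \<subseteq> carrier H" using hom_carrier[OF hom] .
      show "carrier H \<subseteq> \<Theta> ` carrier (F \<times>\<times> S)"
      proof
        fix x assume "x \<in> carrier H"
        then obtain z where z: "z \<in> cyc" "x = cls z" by (auto simp: carrier_H)
        then have "orbit_count z \<in> param_relations (Suc (r\<^sup>2)) m" unfolding m(2) by blast
        \<comment> \<open>The coefficients of the count of z tell which lift to subtract; the
          remainder has zero count and hence lies in the torsion part.\<close>
        then obtain c where c: "Poly_Mapping.keys c \<subseteq> {1..<Suc (r\<^sup>2)}" "orbit_count z = frag_extend (hnf_row m) c"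
          unfolding param_relations_eq_image by blast
        have zc: "z - lift c \<in> cyc" by (rule cyc_diff[OF z(1) lift_in[OF c(1)]])
        have "orbit_count (z - lift c) = 0" using c by (simp add: orbit_count_diff count_lift)
        then have "z - lift c \<in> torsion_cycles" using torsion_cycles_iff[OF zc] by simp
        then obtain t where t: "t \<in> carrier S" "cls (z - lift c) = \<Psi> t" by (auto simp: torsion_cycles_def)
        have "x = \<Theta> (c, t)"
          unfolding \<Theta>_def prod.case t(2)[symmetric] z(2) cls_add[OF lift_in[OF c(1)] zc, symmetric] by simp
        moreover have "(c, t) \<in> carrier (F \<times>\<times> S)" using c t by (simp add: F_def del: One_nat_def)
        ultimately show "x \<in> \<Theta> ` carrier (F \<times>\<times> S)" by blast
      qed
    qed
  qed
  then have "H \<cong> F \<times>\<times> S" using group.iso_sym[OF gFS] by (auto simp: is_iso_def)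
  moreover have "F \<cong> sum_group {1..r^2} (\<lambda>_. integer_group)"
  proof -
    have "{1..<Suc (r\<^sup>2)} = {1..r\<^sup>2}" by auto
    then show ?thesis
      unfolding F_def using group.iso_sym[OF sum_group isomorphic_sum_integer_group[of "{1..r\<^sup>2}"]]
      by (simp add: comm_group.axioms(2)[OF abelian_integer_group])
  qed
  then have "F \<times>\<times> S \<cong> sum_group {1..r^2} (\<lambda>_. integer_group) \<times>\<times> S"
    using group.DirProd_iso_trans[of F _ S S] group_free_Abelian_group iso_refl unfolding F_def by blast
  ultimately show ?thesis by (rule iso_trans)
qed

end

theorem theorem7p1:
  fixes Q :: "'a set" and tri :: "'a \<Rightarrow> 'a \<Rightarrow> 'a" and r :: nat and Orb :: "nat \<Rightarrow> 'a set"
  assumes "abelian_quandle Q tri"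
    and "finite Q"
    and "bij_betw Orb {1..r} (quandle_orbits Q tri)"
  shows "\<exists>T :: nat \<Rightarrow> (nat \<Rightarrow> (nat \<Rightarrow>\<^sub>0 int) set) set set monoid.
    (\<forall>i\<in>{1..r}. finite (carrier (T i)) \<and>
       (\<exists>N. N \<lhd> parameter_group Q tri r Orb \<and> T i = parameter_group Q tri r Orb Mod N)) \<and>
    rack_homology 2 Q tri \<cong>
      sum_group {1..r^2} (\<lambda>_. integer_group) \<times>\<times> sum_group {1..r} T"
proof -
  interpret ordered_abelian_quandle Q tri r Orb
    using assms by (simp add: ordered_abelian_quandle_def ordered_abelian_quandle_axioms_def
        finite_abelian_quandle_def finite_abelian_quandle_axioms_def)
  define M where "M = quandle_parameters Q tri r Orb"
  have M: "is_quandle_parameters Q tri r Orb M"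
    unfolding M_def by (rule is_quandle_parameters_quandle_parameters)
  obtain f where f: "bij_betw f Q (param_quandle_carrier r M)"
    "\<And>a b. \<lbrakk>a \<in> Q; b \<in> Q\<rbrakk> \<Longrightarrow> f (tri a b) = param_quandle_op r M (f a) (f b)"
    "\<And>j. j \<in> {1..r} \<Longrightarrow> f ` Orb j = {j} \<times> carrier (param_grp r (M j))"
    by (rule is_quandle_parametersE[OF M], rule that)
  interpret parametrized_quandle Q tri r Orb M f
    by unfold_locales (fact f)+
  define G' where "G' = parameter_group Q tri r Orb"
  have G': "G' = P Mod relators"
    unfolding G'_def parameter_group_def Let_def M_def[symmetric] relators_def ..
  have groupG': "group G'" unfolding G' by (rule normal.factorgroup_is_group[OF relators_normal])
  have finG': "finite (carrier G')"
    unfolding G' by (rule normal.finite_FactGroup[OF relators_normal finite_carrier_P])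
  have "\<forall>i\<in>{1..r}. \<exists>\<phi>. \<phi> \<in> hom G' H \<and> (\<forall>g\<in>carrier P. \<phi> (relators #>\<^bsub>P\<^esub> g) = cls (\<Phi> i g))"
    unfolding G' using torsion_hom by blast
  then obtain \<phi> where \<phi>: "\<forall>i\<in>{1..r}. \<phi> i \<in> hom G' H \<and> (\<forall>g\<in>carrier P. \<phi> i (relators #>\<^bsub>P\<^esub> g) = cls (\<Phi> i g))"
    by (rule bchoice[THEN exE])
  have ghom: "group_hom G' H (\<phi> i)" if "i \<in> {1..r}" for i
    using \<phi> that groupG' group_H by (simp add: group_hom_def group_hom_axioms_def)
  \<comment> \<open>Dividing the parameter group by the kernel makes the summand embed in homology
    with image the classes of \<open>\<Phi> i\<close>.\<close>
  define N where "N = (\<lambda>i. kernel G' H (\<phi> i))"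
  define T where "T = (\<lambda>i. G' Mod N i)"
  have normalN: "N i \<lhd> G'" if "i \<in> {1..r}" for i
    unfolding N_def by (rule group_hom.normal_kernel[OF ghom[OF that]])
  have "\<forall>i\<in>{1..r}. \<exists>\<beta>. \<beta> \<in> hom (T i) H \<and> (\<forall>x\<in>carrier G'. \<beta> (N i #>\<^bsub>G'\<^esub> x) = \<phi> i x) \<and>
    (\<forall>t\<in>carrier (T i). \<beta> t = \<one>\<^bsub>H\<^esub> \<longrightarrow> t = \<one>\<^bsub>T i\<^esub>)"
    unfolding T_def N_def using group_hom.kernel_quotient_mono[OF ghom] unfolding Bex_def by (rule ballI)
  then obtain \<beta> where \<beta>: "\<forall>i\<in>{1..r}. \<beta> i \<in> hom (T i) H \<and> (\<forall>x\<in>carrier G'. \<beta> i (N i #>\<^bsub>G'\<^esub> x) = \<phi> i x) \<and>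
    (\<forall>t\<in>carrier (T i). \<beta> i t = \<one>\<^bsub>H\<^esub> \<longrightarrow> t = \<one>\<^bsub>T i\<^esub>)"
    by (rule bchoice[THEN exE])
  have rel_in: "relators #>\<^bsub>P\<^esub> g \<in> carrier G'" if "g \<in> carrier P" for g
    unfolding G' carrier_FactGroup using that by (rule imageI)
  have coset: "\<beta> i (N i #>\<^bsub>G'\<^esub> (relators #>\<^bsub>P\<^esub> g)) = cls (\<Phi> i g)" if "i \<in> {1..r}" "g \<in> carrier P" for i g
  proof -
    have "\<beta> i (N i #>\<^bsub>G'\<^esub> (relators #>\<^bsub>P\<^esub> g)) = \<phi> i (relators #>\<^bsub>P\<^esub> g)"
      by (rule bspec[OF conjunct1[OF conjunct2[OF bspec[OF \<beta> that(1)]]] rel_in[OF that(2)]])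
    also have "\<dots> = cls (\<Phi> i g)" by (rule bspec[OF conjunct2[OF bspec[OF \<phi> that(1)]] that(2)])
    finally show ?thesis .
  qed
  interpret torsion_model Q tri r Orb M f T \<beta>
  proof (rule torsion_model.intro[OF parametrized_quandle_axioms], rule torsion_model_axioms.intro)
    fix i assume i: "i \<in> {1..r}"
    show "group (T i)" unfolding T_def by (rule normal.factorgroup_is_group[OF normalN[OF i]])
    show "\<beta> i \<in> hom (T i) H" by (rule conjunct1[OF bspec[OF \<beta> i]])
    show "t = \<one>\<^bsub>T i\<^esub>" if "t \<in> carrier (T i)" "\<beta> i t = \<one>\<^bsub>H\<^esub>" for t
      by (rule mp[OF bspec[OF conjunct2[OF conjunct2[OF bspec[OF \<beta> i]]] that(1)] that(2)])
    show "\<exists>g\<in>carrier P. \<beta> i t = cls (\<Phi> i g)" if t: "t \<in> carrier (T i)" for t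
    proof -
      obtain x where x: "x \<in> carrier G'" "t = N i #>\<^bsub>G'\<^esub> x"
        using t unfolding T_def carrier_FactGroup by blast
      then obtain g where "g \<in> carrier P" "x = relators #>\<^bsub>P\<^esub> g" unfolding G' carrier_FactGroup by blast
      then show ?thesis using coset[OF i] x(2) by blast
    qed
    show "\<exists>t\<in>carrier (T i). \<beta> i t = cls (\<Phi> i g)" if g: "g \<in> carrier P" for g
      using coset[OF i g] rel_in[OF g] unfolding T_def carrier_FactGroup by blast
  qed
  have "finite (carrier (T i))" if "i \<in> {1..r}" for i
    unfolding T_def by (rule normal.finite_FactGroup[OF normalN[OF that] finG'])
  then show ?thesis
    using normalN second_homology_iso unfolding G'_def[symmetric]
    by (intro exI[of _ T] conjI ballI exI[of _ "N _"]) (auto simp: T_def)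
qed

end
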